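(* Let $A$ be a bidga over a field, with vertical differential $d^v=m_{01}$, horizontal differential $d_h=m_{11}$ and multiplication $m=m_{02}$, and let $H^v(A)$ be its vertical homology, presented as a homotopy retract of $(A,d^v)$ with inclusion $\iota:H^v(A)\to A$, projection $\pi:A\to H^v(A)$ and homotopy $h:A\to A$. There is a derived $A_\infty$-algebra structure $(m_{ij})$ on $H^v(A)$, with $m_{01}=0$, which can be described as follows: for $i+j\ge2$, there are signs $\varepsilon_T\in\{\pm1\}$ such that $$m_{ij}=\sum_{T}\varepsilon_T\,\Phi_T,$$ where $T$ ranges over the planar trees with $j$ leaves in which every vertex has weight $2$ or $3$ and exactly $i$ vertices have weight $2$, and $\Phi_T:H^v(A)^{\otimes j}\to H^v(A)$ is the map obtained by putting $\iota$ on the leaves, $\pi$ at the root, $h$ on the internal edges, the multiplication $m$ at every vertex of weight $3$ and the horizontal differential $d_h$ at every vertex of weight $2$.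
   Context: A derived $A_\infty$-algebra over $\mathbf{k}$ is an $(\mathbb{N},\mathbb{Z})$-bigraded $\mathbf{k}$-module $A=\bigoplus A_i^j$ with $\mathbf{k}$-linear maps $m_{ij}:A^{\otimes j}\to A$, $i\ge0$, $j\ge1$, of bidegree $(i,2-i-j)$ (a map of bidegree $(u,v)$ lowers the lower, horizontal degree by $u$ and raises the upper, vertical degree by $v$) such that for all $u\ge0,v\ge1$ $$\sum_{u=i+p,\ v=j+q-1,\ j=1+r+t}(-1)^{rq+t+pj}m_{ij}(1^{\otimes r}\otimes m_{pq}\otimes1^{\otimes t})=0,$$ with Koszul sign rule $(f\otimes g)(x\otimes y)=(-1)^{pi+qj}f(x)\otimes g(y)$ for $g$ of bidegree $(p,q)$ and $x$ of bidegree $(i,j)$. A bidga is a derived $A_\infty$-algebra with $m_{ij}=0$ for $i+j\ge3$ (equivalently a monoid in bicomplexes). The vertical homology $H^v(A)$ is the homology with respect to $d^v=m_{01}$, a bigraded vector space regarded as having zero vertical differential. Homotopy retract data: $\iota,\pi$ are chain maps of bidegree $(0,0)$ and $h$ has bidegree $(0,-1)$, with $\pi\iota=1_{H^v(A)}$ and $1_A-\iota\pi=d^vh+hd^v$ (such data exist over a field). A vertex of a planar rooted tree has weight equal to its valence: weight $2$ means one input and one output, weight $3$ means two inputs and one output. *)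

theory Defs
  imports "HOL-Algebra.Module" "HOL-Algebra.AbelCoset"
begin

section \<open>Bigraded modules\<close>

text \<open>
  As for \<^typ>\<open>('k, 'a) module\<close>, the fields \<^const>\<open>mult\<close> and \<^const>\<open>one\<close> inherited from rings
  play no role.  \<open>grade A i j\<close> is $A_i^j$: \<open>i\<close> is the lower (horizontal) degree and \<open>j\<close> the
  upper (vertical) degree.
\<close>

record ('k, 'a) bigraded = "('k, 'a) module" +
  grade :: "nat \<Rightarrow> int \<Rightarrow> 'a set"

locale bigraded_module = module K A
  for K :: "('k, 'r) ring_scheme" and A :: "('k, 'a) bigraded" +
  assumes grade_submodule: "submodule (grade A i j) K A"
    and direct_sum: "x \<in> carrier A \<Longrightarrow>
      \<exists>!c. (\<forall>i j. c (i, j) \<in> grade A i j) \<and> finite {e. c e \<noteq> \<zero>\<^bsub>A\<^esub>} \<and>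
           x = (\<Oplus>\<^bsub>A\<^esub>e\<in>{e. c e \<noteq> \<zero>\<^bsub>A\<^esub>}. c e)"

text \<open>The grading extended by zero to negative horizontal degrees.\<close>

definition gradez :: "('k, 'a) bigraded \<Rightarrow> int \<Rightarrow> int \<Rightarrow> 'a set" where
  "gradez A i j = (if i < 0 then {\<zero>\<^bsub>A\<^esub>} else grade A (nat i) j)"

text \<open>
  \<open>homogeneous A ds xs\<close>: the tuple \<open>xs\<close> consists of homogeneous elements, with bidegrees \<open>ds\<close>.
  The zero element has every bidegree.
\<close>

definition homogeneous :: "('k, 'a) bigraded \<Rightarrow> (nat \<times> int) list \<Rightarrow> 'a list \<Rightarrow> bool" where
  "homogeneous A ds xs \<longleftrightarrow> list_all2 (\<lambda>(i, j) x. x \<in> grade A i j) ds xs"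

definition hdeg :: "(nat \<times> int) list \<Rightarrow> int" where
  "hdeg ds = (\<Sum>d\<leftarrow>ds. int (fst d))"

definition vdeg :: "(nat \<times> int) list \<Rightarrow> int" where
  "vdeg ds = (\<Sum>d\<leftarrow>ds. snd d)"

definition tuples :: "('k, 'a) bigraded \<Rightarrow> nat \<Rightarrow> 'a list set" where
  "tuples A n = {xs. length xs = n \<and> set xs \<subseteq> carrier A}"

text \<open>
  A linear map $A^{\otimes n} \to B$ of bidegree $(p,q)$ is given as a multilinear map on
  \<open>n\<close>-tuples; \<open>p\<close> lowers the horizontal degree and \<open>q\<close> raises the vertical degree.
\<close>

definition multilinear ::
  "('k, 'r) ring_scheme \<Rightarrow> ('k, 'a) bigraded \<Rightarrow> ('k, 'b) bigraded \<Rightarrow> nat \<Rightarrow> int \<Rightarrow> int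
    \<Rightarrow> ('a list \<Rightarrow> 'b) \<Rightarrow> bool" where
  "multilinear K A B n p q f \<longleftrightarrow>
     (\<forall>xs \<in> tuples A n. f xs \<in> carrier B) \<and>
     (\<forall>xs \<in> tuples A n. \<forall>k<n. \<forall>x \<in> carrier A. \<forall>y \<in> carrier A.
        f (xs[k := x \<oplus>\<^bsub>A\<^esub> y]) = f (xs[k := x]) \<oplus>\<^bsub>B\<^esub> f (xs[k := y])) \<and>
     (\<forall>xs \<in> tuples A n. \<forall>k<n. \<forall>a \<in> carrier K. \<forall>x \<in> carrier A.
        f (xs[k := a \<odot>\<^bsub>A\<^esub> x]) = a \<odot>\<^bsub>B\<^esub> f (xs[k := x])) \<and>
     (\<forall>ds xs. length xs = n \<and> homogeneous A ds xs \<longrightarrow>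
        f xs \<in> gradez B (hdeg ds - p) (vdeg ds + q))"

abbreviation linear_map ::
  "('k, 'r) ring_scheme \<Rightarrow> ('k, 'a) bigraded \<Rightarrow> ('k, 'b) bigraded \<Rightarrow> int \<Rightarrow> int
    \<Rightarrow> ('a \<Rightarrow> 'b) \<Rightarrow> bool" where
  "linear_map K A B p q f \<equiv> multilinear K A B 1 p q (\<lambda>xs. f (hd xs))"

section \<open>Signs\<close>

definition sgn_pow :: "int \<Rightarrow> int" where
  "sgn_pow n = (if even n then 1 else - 1)"

text \<open>
  The sign created when a map of bidegree $(p,q)$ moves past homogeneous elements of bidegrees
  \<open>ds\<close>.
\<close>

definition koszul :: "int \<Rightarrow> int \<Rightarrow> (nat \<times> int) list \<Rightarrow> int" where
  "koszul p q ds = sgn_pow (p * hdeg ds + q * vdeg ds)"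

section \<open>Derived $A_\infty$-algebras\<close>

text \<open>
  \<open>insert_op A m p q r ds xs\<close> is
  $m_{ij}(1^{\otimes r} \otimes m_{pq} \otimes 1^{\otimes t})$ applied to \<open>xs\<close>, where
  $j = 1 + r + t$.
\<close>

definition insert_op ::
  "('k, 'a) bigraded \<Rightarrow> (nat \<Rightarrow> nat \<Rightarrow> 'a list \<Rightarrow> 'a) \<Rightarrow> nat \<Rightarrow> nat \<Rightarrow> nat \<Rightarrow> nat \<Rightarrow> nat \<Rightarrow>
    (nat \<times> int) list \<Rightarrow> 'a list \<Rightarrow> 'a" where
  "insert_op A m i j p q r ds xs =
     [koszul (int p) (2 - int p - int q) (take r ds)] \<cdot>\<^bsub>A\<^esub>
       m i j (take r xs @ [m p q (take q (drop r xs))] @ drop (r + q) xs)"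

text \<open>
  The structure relations are stated on homogeneous tuples, which generate $A^{\otimes v}$.
\<close>

locale derived_Ainf = bigraded_module K A
  for K :: "('k, 'r) ring_scheme" and A :: "('k, 'a) bigraded" +
  fixes m :: "nat \<Rightarrow> nat \<Rightarrow> 'a list \<Rightarrow> 'a"
  assumes m_multilinear:
      "1 \<le> j \<Longrightarrow> multilinear K A A j (int i) (2 - int i - int j) (m i j)"
    and m_relation:
      "1 \<le> v \<Longrightarrow> length xs = v \<Longrightarrow> homogeneous A ds xs \<Longrightarrow>
        (\<Oplus>\<^bsub>A\<^esub>e \<in>
            {(i, j, p, q, r, t). u = i + p \<and> v + 1 = j + q \<and> j = 1 + r + t \<and> 1 \<le> q}.
          case e of (i, j, p, q, r, t) \<Rightarrow>
            [sgn_pow (int (r * q + t + p * j))] \<cdot>\<^bsub>A\<^esub> insert_op A m i j p q r ds xs) = \<zero>\<^bsub>A\<^esub>"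

locale bidga = derived_Ainf K A m
  for K :: "('k, 'r) ring_scheme" and A :: "('k, 'a) bigraded" and m +
  assumes higher_zero: "1 \<le> j \<Longrightarrow> 3 \<le> i + j \<Longrightarrow> xs \<in> tuples A j \<Longrightarrow> m i j xs = \<zero>\<^bsub>A\<^esub>"

section \<open>Vertical homology and homotopy retracts\<close>

definition boundaries :: "('k, 'a) bigraded \<Rightarrow> ('a \<Rightarrow> 'a) \<Rightarrow> 'a set" where
  "boundaries A d = d ` carrier A"

definition hclass :: "('k, 'a) bigraded \<Rightarrow> ('a \<Rightarrow> 'a) \<Rightarrow> 'a \<Rightarrow> 'a set" where
  "hclass A d z = boundaries A d +>\<^bsub>A\<^esub> z"

text \<open>
  The quotient of cycles by boundaries, with elements the cosets of the boundaries, graded by the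
  bidegrees of homogeneous cycles.
\<close>

definition homology :: "('k, 'a) bigraded \<Rightarrow> ('a \<Rightarrow> 'a) \<Rightarrow> ('k, 'a set) bigraded" where
  "homology A d =
     \<lparr> carrier = hclass A d ` a_kernel A A d,
       mult = undefined,
       one = undefined,
       zero = boundaries A d,
       add = (\<lambda>X Y. X <+>\<^bsub>A\<^esub> Y),
       smult = (\<lambda>a X. \<Union>x\<in>X. hclass A d (a \<odot>\<^bsub>A\<^esub> x)),
       grade = (\<lambda>i j. hclass A d ` (a_kernel A A d \<inter> grade A i j)) \<rparr>"

definition homotopy_retract ::
  "('k, 'r) ring_scheme \<Rightarrow> ('k, 'a) bigraded \<Rightarrow> ('a \<Rightarrow> 'a) \<Rightarrow> ('k, 'h) bigraded \<Rightarrow> ('h \<Rightarrow> 'h)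
    \<Rightarrow> ('h \<Rightarrow> 'a) \<Rightarrow> ('a \<Rightarrow> 'h) \<Rightarrow> ('a \<Rightarrow> 'a) \<Rightarrow> bool" where
  "homotopy_retract K A dA H dH \<iota> \<pi> h \<longleftrightarrow>
     linear_map K H A 0 0 \<iota> \<and> (\<forall>x \<in> carrier H. dA (\<iota> x) = \<iota> (dH x)) \<and>
     linear_map K A H 0 0 \<pi> \<and> (\<forall>x \<in> carrier A. dH (\<pi> x) = \<pi> (dA x)) \<and>
     linear_map K A A 0 (- 1) h \<and>
     (\<forall>x \<in> carrier H. \<pi> (\<iota> x) = x) \<and>
     (\<forall>x \<in> carrier A. x \<ominus>\<^bsub>A\<^esub> \<iota> (\<pi> x) = dA (h x) \<oplus>\<^bsub>A\<^esub> h (dA x))"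

section \<open>Planar trees with vertices of weight 2 and 3\<close>

text \<open>
  \<open>Leaf\<close> is a bare edge; the constructors \<open>V2\<close> and \<open>V3\<close> are a root vertex of weight 2
  (one input) and of weight 3 (two inputs, from left to right).
\<close>

datatype ptree = Leaf | V2 ptree | V3 ptree ptree

primrec leaves :: "ptree \<Rightarrow> nat" where
  "leaves Leaf = 1"
| "leaves (V2 T) = leaves T"
| "leaves (V3 S T) = leaves S + leaves T"

primrec weight2 :: "ptree \<Rightarrow> nat" where
  "weight2 Leaf = 0"
| "weight2 (V2 T) = Suc (weight2 T)"
| "weight2 (V3 S T) = weight2 S + weight2 T"

primrec weight3 :: "ptree \<Rightarrow> nat" where
  "weight3 Leaf = 0"
| "weight3 (V2 T) = weight3 T"
| "weight3 (V3 S T) = Suc (weight3 S + weight3 T)"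

definition trees :: "nat \<Rightarrow> nat \<Rightarrow> ptree set" where
  "trees i j = {T. leaves T = j \<and> weight2 T = i}"

text \<open>
  \<open>on_edge h T\<close> decorates the edge leaving the root of \<open>T\<close>, when \<open>T\<close> is a branch of a larger
  tree: that edge is internal unless \<open>T\<close> is a leaf.
\<close>

definition on_edge :: "('a \<Rightarrow> 'a) \<Rightarrow> ptree \<Rightarrow> 'a \<Rightarrow> 'a" where
  "on_edge h T x = (if T = Leaf then x else h x)"

text \<open>
  The composite of the operations of \<open>T\<close> below its root edge, applied to homogeneous elements of
  bidegrees \<open>ds\<close>.  At a vertex of weight 3 it is $m \circ (f \otimes g)$ with \<open>f\<close> and \<open>g\<close> the
  maps of the two branches.  The map \<open>g\<close> of a branch \<open>T\<close> contains one $d_h$, of bidegree $(1,0)$,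
  for each vertex of weight 2 and one \<open>h\<close>, of bidegree $(0,-1)$, for each vertex, whence its
  bidegree in the Koszul sign.
\<close>

primrec tree_eval ::
  "('k, 'a) bigraded \<Rightarrow> ('a \<Rightarrow> 'a) \<Rightarrow> ('a \<Rightarrow> 'a \<Rightarrow> 'a) \<Rightarrow> ('h \<Rightarrow> 'a) \<Rightarrow> ('a \<Rightarrow> 'a) \<Rightarrow>
    ptree \<Rightarrow> (nat \<times> int) list \<Rightarrow> 'h list \<Rightarrow> 'a" where
  "tree_eval A dh mul \<iota> h Leaf ds xs = \<iota> (hd xs)"
| "tree_eval A dh mul \<iota> h (V2 T) ds xs = dh (on_edge h T (tree_eval A dh mul \<iota> h T ds xs))"
| "tree_eval A dh mul \<iota> h (V3 S T) ds xs =
     [koszul (int (weight2 T)) (- int (weight2 T + weight3 T)) (take (leaves S) ds)] \<cdot>\<^bsub>A\<^esub>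
       mul (on_edge h S (tree_eval A dh mul \<iota> h S (take (leaves S) ds) (take (leaves S) xs)))
           (on_edge h T (tree_eval A dh mul \<iota> h T (drop (leaves S) ds) (drop (leaves S) xs)))"

definition tree_map ::
  "('k, 'a) bigraded \<Rightarrow> ('a \<Rightarrow> 'a) \<Rightarrow> ('a \<Rightarrow> 'a \<Rightarrow> 'a) \<Rightarrow> ('h \<Rightarrow> 'a) \<Rightarrow> ('a \<Rightarrow> 'h) \<Rightarrow> ('a \<Rightarrow> 'a) \<Rightarrow>
    ptree \<Rightarrow> (nat \<times> int) list \<Rightarrow> 'h list \<Rightarrow> 'h" where
  "tree_map A dh mul \<iota> \<pi> h T ds xs = \<pi> (tree_eval A dh mul \<iota> h T ds xs)"

end

theory Submission
  imports Defs
begin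

text \<open>
  All signs are absorbed into linear involutions. The vertical suspension, together with a
  precomposition by the sign of the total degree on operations of odd horizontal degree, turns the
  structure relations of a derived $A_\infty$-algebra into
  $\sum n_{u-p}(t^{\otimes r} \otimes n_p \otimes (s^p)^{\otimes k}) = 0$, where \<open>t\<close> and \<open>s\<close>
  are the signs by the vertical and by the total degree, and makes all operators available on
  inhomogeneous elements. Let \<open>P\<close> be the sum over all trees of the composites below the root
  edge, and \<open>F\<close> the same sum with $-h$ put on the root edge (and $\iota$ for the trivial
  tree). Then \<open>P\<close> is $d_h F$ plus the sum of the products of two values of \<open>F\<close>, and
  simultaneous induction on the number of leaves and of vertices of weight 2 gives
  $d_v P = - P \circ n$ and $d_v F = F \circ n - P$ with $n = \pi P$: the terms in which
  $d_h$ and the multiplication meet twice cancel by the bidga relations. Applying $\pi$ to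
  the first identity gives the structure relations for \<open>n\<close>.
\<close>

section \<open>Finite sums in abelian groups\<close>

text \<open>The statement evaluates trees on homogeneous tuples, with signs read off a list of
  bidegrees. A zero entry admits every bidegree, and an induction composing such operations would
  have to carry bidegrees of all intermediate values. The internal operations therefore never see a
  bidegree: they are multilinear maps on all tuples. Bidegrees return when relations known on
  homogeneous elements are extended by linearity, and when the internal operations are compared with
  the trees of the statement. In that comparison the exponent splits into a part depending on the
  tree alone and a part depending on the bidegrees and on the number of weight-2 vertices. The
  second part is the same for all trees contributing to one operation and is undone by the
  desuspension; this is why signs \<open>\<epsilon>\<close> depending only on the tree exist. A
  separate obstacle is that \<open>homology A dv\<close> is not given as a bigraded module: its
  decomposition into bidegrees is derived from that of \<open>A\<close> through the retract.\<close>

lemma (in abelian_monoid) finsum_Sigma: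
  assumes "finite X" and "\<And>x. x \<in> X \<Longrightarrow> finite (Y x)"
    and "\<And>x y. x \<in> X \<Longrightarrow> y \<in> Y x \<Longrightarrow> f x y \<in> carrier G"
  shows "(\<Oplus>x\<in>X. \<Oplus>y\<in>Y x. f x y) = finsum G (\<lambda>(x, y). f x y) (Sigma X Y)"
  using assms
proof (induction X rule: finite_induct)
  case empty
  then show ?case by simp
next
  case (insert x F)
  have img: "(\<Oplus>y\<in>Y x. f x y) = finsum G (\<lambda>(x, y). f x y) (Pair x ` Y x)"
    using insert.prems by (subst finsum_reindex) (auto simp: inj_on_def)
  have split: "Sigma (insert x F) Y = Pair x ` Y x \<union> Sigma F Y"
    by auto
  have disj: "Pair x ` Y x \<inter> Sigma F Y = {}"
    using insert.hyps by auto
  show ?case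
    unfolding split using insert disj
    by (subst finsum_Un_disjoint) (auto simp: img[symmetric])
qed

text \<open>The later re-indexings (insertions against cuts, iterated cuts, the six-index set of the
  structure relation) come with explicit inverse maps, so both maps are supplied instead of
  injectivity and an image.\<close>

lemma (in abelian_monoid) finsum_reindex_bij_witness:
  assumes "\<And>x. x \<in> S \<Longrightarrow> i (j x) = x" and "\<And>x. x \<in> S \<Longrightarrow> j x \<in> T"
    and "\<And>y. y \<in> T \<Longrightarrow> j (i y) = y" and "\<And>y. y \<in> T \<Longrightarrow> i y \<in> S"
    and "\<And>x. x \<in> S \<Longrightarrow> g (j x) = f x" and "\<And>y. y \<in> T \<Longrightarrow> g y \<in> carrier G"
  shows "finsum G f S = finsum G g T"
proof -
  have T: "T = j ` S"
    using assms by force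
  have inj: "inj_on j S"
    using assms(1) by (rule inj_on_inverseI)
  have "finsum G g T = finsum G (\<lambda>x. g (j x)) S"
    unfolding T using assms inj by (subst finsum_reindex) (auto simp: T)
  also have "\<dots> = finsum G f S"
    using assms(2,5,6) by (intro finsum_cong') (auto simp: Pi_iff, metis)
  finally show ?thesis ..
qed

lemma (in abelian_monoid) finsum_in_subset:
  assumes "\<zero> \<in> S" and "\<And>x y. x \<in> S \<Longrightarrow> y \<in> S \<Longrightarrow> x \<oplus> y \<in> S" and "S \<subseteq> carrier G"
    and "\<And>x. x \<in> X \<Longrightarrow> f x \<in> S"
  shows "finsum G f X \<in> S"
  using assms(4)
proof (induction X rule: infinite_finite_induct)
  case (insert x F)
  then show ?case
    using assms(1-3) by (subst finsum_insert) auto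
qed (use assms in auto)

lemma (in abelian_group) neg_zero [simp]: "\<ominus> \<zero> = \<zero>"
  by (rule minus_equality) simp_all

lemma (in abelian_group) neg_eq_iff: "x \<in> carrier G \<Longrightarrow> y \<in> carrier G \<Longrightarrow> x \<oplus> y = \<zero> \<longleftrightarrow> x = \<ominus> y"
  by (metis minus_equality r_neg a_comm)

section \<open>Linear maps between modules over a commutative ring\<close>

locale klin = A: module K A + B: module K B
  for K :: "('k, 'r) ring_scheme" and A :: "('k, 'a, 'c) module_scheme"
    and B :: "('k, 'b, 'd) module_scheme" +
  fixes f :: "'a \<Rightarrow> 'b"
  assumes closed [simp]: "x \<in> carrier A \<Longrightarrow> f x \<in> carrier B"
    and add: "x \<in> carrier A \<Longrightarrow> y \<in> carrier A \<Longrightarrow> f (x \<oplus>\<^bsub>A\<^esub> y) = f x \<oplus>\<^bsub>B\<^esub> f y"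
    and smult: "a \<in> carrier K \<Longrightarrow> x \<in> carrier A \<Longrightarrow> f (a \<odot>\<^bsub>A\<^esub> x) = a \<odot>\<^bsub>B\<^esub> f x"
begin

lemma zero [simp]: "f \<zero>\<^bsub>A\<^esub> = \<zero>\<^bsub>B\<^esub>"
  by (metis A.l_zero A.zero_closed B.add.r_cancel_one' add closed)

lemma neg: "x \<in> carrier A \<Longrightarrow> f (\<ominus>\<^bsub>A\<^esub> x) = \<ominus>\<^bsub>B\<^esub> f x"
  by (metis A.a_inv_closed A.l_neg B.minus_equality add closed zero)

lemma finsum:
  assumes "\<And>x. x \<in> X \<Longrightarrow> g x \<in> carrier A"
  shows "f (\<Oplus>\<^bsub>A\<^esub>x\<in>X. g x) = (\<Oplus>\<^bsub>B\<^esub>x\<in>X. f (g x))"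
  using assms
proof (induction X rule: infinite_finite_induct)
  case (insert x F)
  then show ?case
    by (simp add: Pi_iff add)
qed auto

end

lemma klin_comp:
  assumes "klin K A B f" "klin K B C g"
  shows "klin K A C (\<lambda>x. g (f x))"
proof -
  interpret f: klin K A B f by fact
  interpret g: klin K B C g by fact
  show ?thesis
    by unfold_locales (simp_all add: f.add f.smult g.add g.smult)
qed

lemma (in module) klin_neg: "klin R M M (\<lambda>x. \<ominus>\<^bsub>M\<^esub> x)"
  by unfold_locales (simp_all add: M.minus_add smult_r_minus)

lemma (in abelian_group) finsum_neg:
  assumes "\<And>x. x \<in> X \<Longrightarrow> g x \<in> carrier G"
  shows "(\<Oplus>x\<in>X. \<ominus> g x) = \<ominus> (\<Oplus>x\<in>X. g x)"
  using assms
proof (induction X rule: infinite_finite_induct)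
  case (insert x F)
  then show ?case
    by (simp add: Pi_iff minus_add)
qed auto

section \<open>Signed elements\<close>

abbreviation sg :: "('a, 'c) ring_scheme \<Rightarrow> int \<Rightarrow> 'a \<Rightarrow> 'a" where
  "sg A n x \<equiv> [sgn_pow n] \<cdot>\<^bsub>A\<^esub> x"

text \<open>Only the parity of an exponent matters, so exponents are added freely in
  \<open>int\<close> and compared modulo 2; the integer multiple is the form in which signs occur in
  the statement.\<close>

lemma (in abelian_group) sg_eq:
  assumes "x \<in> carrier G"
  shows "sg G n x = (if even n then x else \<ominus> x)"
  using assms add.int_pow_neg[of x 1]
  by (simp add: sgn_pow_def)

lemma (in abelian_group) sg_closed [simp]: "x \<in> carrier G \<Longrightarrow> sg G n x \<in> carrier G"
  by (simp add: sg_eq)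

lemma (in abelian_group) sg_sg: "x \<in> carrier G \<Longrightarrow> sg G n (sg G k x) = sg G (n + k) x"
  by (auto simp: sg_eq)

lemma (in abelian_group) sg_cong:
  "x \<in> carrier G \<Longrightarrow> even (n - k) \<Longrightarrow> sg G n x = sg G k x"
  by (auto simp: sg_eq)

lemma (in abelian_group) sg_zero [simp]: "sg G n \<zero> = \<zero>"
  by (simp add: sg_eq)

lemma (in abelian_group) sg_finsum:
  assumes "\<And>x. x \<in> X \<Longrightarrow> g x \<in> carrier G"
  shows "(\<Oplus>x\<in>X. sg G n (g x)) = sg G n (\<Oplus>x\<in>X. g x)"
proof -
  have "(\<Oplus>x\<in>X. sg G n (g x)) = (\<Oplus>x\<in>X. if even n then g x else \<ominus> g x)"
    using assms by (intro finsum_cong') (auto simp: sg_eq)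
  then show ?thesis
    using assms finsum_neg[of X g] by (auto simp: sg_eq)
qed

lemma (in klin) sg: "x \<in> carrier A \<Longrightarrow> f (sg A n x) = sg B n (f x)"
  by (simp add: A.sg_eq B.sg_eq neg)

section \<open>Multilinear maps on tuples\<close>

text \<open>The part of \<open>multilinear\<close> that ignores degrees, see
  \<open>multilinear_iff\<close>. Linearity in a slot is phrased through \<open>klin\<close>, so
  that compositions are handled by \<open>klin_comp\<close>.\<close>

definition mlin ::
  "('k, 'r) ring_scheme \<Rightarrow> ('k, 'h, 'c) module_scheme \<Rightarrow> ('k, 'a, 'd) module_scheme \<Rightarrow> nat
    \<Rightarrow> ('h list \<Rightarrow> 'a) \<Rightarrow> bool" where
  "mlin K H A n f \<longleftrightarrow>
     (\<forall>xs. length xs = n \<and> set xs \<subseteq> carrier H \<longrightarrow> f xs \<in> carrier A) \<and>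
     (\<forall>xs k. length xs = n \<and> set xs \<subseteq> carrier H \<and> k < n \<longrightarrow> klin K H A (\<lambda>v. f (xs[k := v])))"

lemma mlin_closed:
  "mlin K H A n f \<Longrightarrow> length xs = n \<Longrightarrow> set xs \<subseteq> carrier H \<Longrightarrow> f xs \<in> carrier A"
  by (auto simp: mlin_def)

lemma mlin_update:
  "mlin K H A n f \<Longrightarrow> length xs = n \<Longrightarrow> set xs \<subseteq> carrier H \<Longrightarrow> k < n \<Longrightarrow>
    klin K H A (\<lambda>v. f (xs[k := v]))"
  by (auto simp: mlin_def)

lemma mlin_slot:
  assumes "mlin K H A n f" "Suc (length ys + length zs) = n" "set ys \<subseteq> carrier H"
    "set zs \<subseteq> carrier H" "module K H"
  shows "klin K H A (\<lambda>v. f (ys @ v # zs))"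
proof -
  interpret H: module K H by fact
  have "klin K H A (\<lambda>v. f ((ys @ \<zero>\<^bsub>H\<^esub> # zs)[length ys := v]))"
    using assms by (intro mlin_update) auto
  then show ?thesis
    by simp
qed

lemma mlin_comp:
  assumes "mlin K H A n f" "klin K A B g"
  shows "mlin K H B n (\<lambda>xs. g (f xs))"
  using assms unfolding mlin_def
  by (auto intro: klin_comp[of K H A _ B g] simp: klin.closed)

lemma mlin_map:
  assumes "mlin K H A n f" "klin K H H g"
  shows "mlin K H A n (\<lambda>xs. f (map g xs))"
proof -
  interpret g: klin K H H g by fact
  have "klin K H A (\<lambda>v. f (map g (xs[k := v])))"
    if "length xs = n" "set xs \<subseteq> carrier H" "k < n" for xs k
    unfolding map_update using that assms
    by (intro klin_comp[OF assms(2)] mlin_update[OF assms(1)]) auto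
  then show ?thesis
    using assms(1) unfolding mlin_def[of _ _ _ _ "\<lambda>xs. f (map g xs)"]
    by (auto intro!: mlin_closed[OF assms(1)] g.closed)
qed

lemma klin_zero:
  assumes "module K A" "module K B"
  shows "klin K A B (\<lambda>x. \<zero>\<^bsub>B\<^esub>)"
proof -
  interpret A: module K A by fact
  interpret B: module K B by fact
  show ?thesis
    by unfold_locales simp_all
qed

lemma klin_plus:
  assumes "klin K A B f" "klin K A B g"
  shows "klin K A B (\<lambda>x. f x \<oplus>\<^bsub>B\<^esub> g x)"
proof -
  interpret f: klin K A B f by fact
  interpret g: klin K A B g by fact
  show ?thesis
    by unfold_locales
      (simp_all add: f.add f.smult g.add g.smult f.B.a_ac f.B.smult_r_distr)
qed

lemma klin_sum:
  assumes "module K A" "module K B" "finite X" "\<And>x. x \<in> X \<Longrightarrow> klin K A B (f x)"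
  shows "klin K A B (\<lambda>v. \<Oplus>\<^bsub>B\<^esub>x\<in>X. f x v)"
proof -
  interpret A: module K A by fact
  interpret B: module K B by fact
  note cl = klin.closed[OF assms(4)] klin.add[OF assms(4)] klin.smult[OF assms(4)]
  show ?thesis
  proof unfold_locales
    fix x y
    assume xy: "x \<in> carrier A" "y \<in> carrier A"
    show "(\<Oplus>\<^bsub>B\<^esub>v\<in>X. f v x) \<in> carrier B"
      using xy cl by auto
    have "(\<Oplus>\<^bsub>B\<^esub>v\<in>X. f v (x \<oplus>\<^bsub>A\<^esub> y)) = (\<Oplus>\<^bsub>B\<^esub>v\<in>X. f v x \<oplus>\<^bsub>B\<^esub> f v y)"
      using xy cl by (intro B.finsum_cong') auto
    then show "(\<Oplus>\<^bsub>B\<^esub>v\<in>X. f v (x \<oplus>\<^bsub>A\<^esub> y)) = (\<Oplus>\<^bsub>B\<^esub>v\<in>X. f v x) \<oplus>\<^bsub>B\<^esub> (\<Oplus>\<^bsub>B\<^esub>v\<in>X. f v y)"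
      using xy cl by (subst (asm) B.finsum_addf) auto
  next
    fix a x
    assume ax: "a \<in> carrier K" "x \<in> carrier A"
    have "(\<Oplus>\<^bsub>B\<^esub>v\<in>X. f v (a \<odot>\<^bsub>A\<^esub> x)) = (\<Oplus>\<^bsub>B\<^esub>v\<in>X. a \<odot>\<^bsub>B\<^esub> f v x)"
      using ax cl by (intro B.finsum_cong') auto
    then show "(\<Oplus>\<^bsub>B\<^esub>v\<in>X. f v (a \<odot>\<^bsub>A\<^esub> x)) = a \<odot>\<^bsub>B\<^esub> (\<Oplus>\<^bsub>B\<^esub>v\<in>X. f v x)"
      using ax cl \<open>finite X\<close> by (subst B.finsum_smult_ldistr) auto
  qed
qed

lemma mlin_sum:
  assumes "module K H" "module K A" "finite X" "\<And>x. x \<in> X \<Longrightarrow> mlin K H A n (f x)"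
  shows "mlin K H A n (\<lambda>xs. \<Oplus>\<^bsub>A\<^esub>x\<in>X. f x xs)"
proof -
  interpret A: module K A by fact
  show ?thesis
    unfolding mlin_def
    using assms
    by (auto intro!: A.finsum_closed klin_sum mlin_update[OF assms(4)] mlin_closed[OF assms(4)])
qed

lemma klin_funpow:
  assumes "klin K A A f"
  shows "klin K A A (f ^^ n)"
proof -
  interpret f: klin K A A f by fact
  show ?thesis
  proof (induction n)
    case 0
    then show ?case by unfold_locales simp_all
  next
    case (Suc n)
    then show ?case
      using klin_comp[OF Suc assms] by (simp add: o_def)
  qed
qed

section \<open>Planar trees\<close>

lemma leaves_pos [simp]: "0 < leaves T"
  by (induction T) auto

text \<open>Trees are classified by their root vertex. The leaf number and weight of the left branch
  are kept in the index, although \<open>S\<close> determines them, so that a sum over these trees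
  becomes an iterated sum with a product set inside.\<close>

lemma trees_rec:
  assumes "1 \<le> n"
  shows "trees w n = (if w = 0 \<and> n = 1 then {Leaf} else {}) \<union>
    (if w = 0 then {} else V2 ` trees (w - 1) n) \<union>
    (\<lambda>(_, S, T). V3 S T) `
      (SIGMA e : {1..<n} \<times> {..w}. trees (snd e) (fst e) \<times> trees (w - snd e) (n - fst e))"
    (is "_ = ?R")
proof (intro equalityI subsetI)
  fix T
  assume T: "T \<in> trees w n"
  show "T \<in> ?R"
  proof (cases T)
    case (V3 S U)
    have "((leaves S, weight2 S), S, U) \<in>
        (SIGMA e : {1..<n} \<times> {..w}. trees (snd e) (fst e) \<times> trees (w - snd e) (n - fst e))"
      using T V3 leaves_pos[of S] leaves_pos[of U] by (auto simp: trees_def simp del: leaves_pos)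
    then show ?thesis
      using V3 by (auto simp: image_iff)
  qed (use T in \<open>auto simp: trees_def\<close>)
qed (use assms in \<open>auto simp: trees_def split: if_splits\<close>)

lemma trees_0 [simp]: "trees w 0 = {}"
  using leaves_pos by (auto simp: trees_def)

text \<open>Deleting the root lowers leaf number plus weight: a weight-2 root costs one unit of
  weight, and each branch of a weight-3 root has fewer leaves and no larger weight.\<close>

lemma finite_trees [simp]: "finite (trees w n)"
proof (induction "w + n" arbitrary: w n rule: less_induct)
  case less
  show ?case
  proof (cases "n = 0")
    case False
    then show ?thesis
      using less by (subst trees_rec) (auto intro!: finite_imageI finite_SigmaI)
  qed simp
qed

section \<open>Transfer along a homotopy retract\<close>

text \<open>Gradings are replaced by the commutation rules of \<open>t\<close> and \<open>s\<close>.
  The operators \<open>h\<close> and \<open>b\<close> change sign under both and \<open>e\<close>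
  only under \<open>s\<close>: after suspension \<open>h\<close> and \<open>b\<close> have odd
  vertical degree, \<open>e\<close> has even vertical degree, and all three have odd total degree.
  The \<open>s y\<close> in \<open>e_b\<close> is the trace of the sign with which the horizontal
  differential is precomposed.\<close>

locale tree_transfer =
  A: module K A + H: module K H + i: klin K H A i + p: klin K A H p + h: klin K A A h +
  d: klin K A A d + e: klin K A A e + t: klin K A A t + s: klin K A A s +
  t': klin K H H t' + s': klin K H H s'
  for K :: "('k, 'r) ring_scheme" and A :: "('k, 'a, 'c) module_scheme"
    and H :: "('k, 'h, 'd) module_scheme" and i p h d e t s t' s' +
  fixes b :: "'a \<Rightarrow> 'a \<Rightarrow> 'a"
  assumes b_left: "y \<in> carrier A \<Longrightarrow> klin K A A (\<lambda>x. b x y)"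
    and b_right: "x \<in> carrier A \<Longrightarrow> klin K A A (b x)"
    and d_i: "u \<in> carrier H \<Longrightarrow> d (i u) = \<zero>\<^bsub>A\<^esub>"
    and p_d: "x \<in> carrier A \<Longrightarrow> p (d x) = \<zero>\<^bsub>H\<^esub>"
    and retract: "x \<in> carrier A \<Longrightarrow> x \<ominus>\<^bsub>A\<^esub> i (p x) = d (h x) \<oplus>\<^bsub>A\<^esub> h (d x)"
    and d_e: "x \<in> carrier A \<Longrightarrow> d (e x) = \<ominus>\<^bsub>A\<^esub> e (d x)"
    and e_e: "x \<in> carrier A \<Longrightarrow> e (e x) = \<zero>\<^bsub>A\<^esub>"
    and d_b: "x \<in> carrier A \<Longrightarrow> y \<in> carrier A \<Longrightarrow>
      d (b x y) = \<ominus>\<^bsub>A\<^esub> (b (d x) y \<oplus>\<^bsub>A\<^esub> b (t x) (d y))"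
    and e_b: "x \<in> carrier A \<Longrightarrow> y \<in> carrier A \<Longrightarrow>
      e (b x y) = \<ominus>\<^bsub>A\<^esub> (b (e x) (s y) \<oplus>\<^bsub>A\<^esub> b (t x) (e y))"
    and b_b: "x \<in> carrier A \<Longrightarrow> y \<in> carrier A \<Longrightarrow> z \<in> carrier A \<Longrightarrow>
      b (b x y) z = \<ominus>\<^bsub>A\<^esub> b (t x) (b y z)"
    and t_i: "u \<in> carrier H \<Longrightarrow> t (i u) = i (t' u)"
    and s_i: "u \<in> carrier H \<Longrightarrow> s (i u) = i (s' u)"
    and s_p: "x \<in> carrier A \<Longrightarrow> s' (p x) = p (s x)"
    and t_h: "x \<in> carrier A \<Longrightarrow> t (h x) = \<ominus>\<^bsub>A\<^esub> h (t x)"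
    and s_h: "x \<in> carrier A \<Longrightarrow> s (h x) = \<ominus>\<^bsub>A\<^esub> h (s x)"
    and t_e: "x \<in> carrier A \<Longrightarrow> t (e x) = e (t x)"
    and s_e: "x \<in> carrier A \<Longrightarrow> s (e x) = \<ominus>\<^bsub>A\<^esub> e (s x)"
    and t_b: "x \<in> carrier A \<Longrightarrow> y \<in> carrier A \<Longrightarrow> t (b x y) = \<ominus>\<^bsub>A\<^esub> b (t x) (t y)"
    and s_b: "x \<in> carrier A \<Longrightarrow> y \<in> carrier A \<Longrightarrow> s (b x y) = \<ominus>\<^bsub>A\<^esub> b (s x) (s y)"
    and s_t: "u \<in> carrier H \<Longrightarrow> s' (t' u) = t' (s' u)"
begin

lemma b_closed [simp]: "x \<in> carrier A \<Longrightarrow> y \<in> carrier A \<Longrightarrow> b x y \<in> carrier A"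
  using klin.closed[OF b_right] .

lemma b_zero [simp]:
  "x \<in> carrier A \<Longrightarrow> b \<zero>\<^bsub>A\<^esub> x = \<zero>\<^bsub>A\<^esub>" "x \<in> carrier A \<Longrightarrow> b x \<zero>\<^bsub>A\<^esub> = \<zero>\<^bsub>A\<^esub>"
  using klin.zero[OF b_left] klin.zero[OF b_right] by auto

lemma mlin_b:
  assumes "mlin K H A k f" "mlin K H A l g"
  shows "mlin K H A (k + l) (\<lambda>xs. b (f (take k xs)) (g (drop k xs)))"
  unfolding mlin_def
proof (intro conjI allI impI; elim conjE)
  fix xs
  assume xs: "length xs = k + l" "set xs \<subseteq> carrier H"
  have sub: "set (take k xs) \<subseteq> carrier H" "set (drop k xs) \<subseteq> carrier H"
    using xs(2) set_take_subset set_drop_subset by fast+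
  have cl: "f (take k xs) \<in> carrier A" "g (drop k xs) \<in> carrier A"
    using xs sub by (auto intro: mlin_closed[OF assms(1)] mlin_closed[OF assms(2)])
  then show "b (f (take k xs)) (g (drop k xs)) \<in> carrier A"
    by simp
  fix r
  assume r: "r < k + l"
  show "klin K H A (\<lambda>v. b (f (take k (xs[r := v]))) (g (drop k (xs[r := v]))))"
  proof (cases "r < k")
    case True
    then show ?thesis
      using xs cl sub
      by (auto simp: take_update_swap intro!: klin_comp[OF _ b_left] mlin_update[OF assms(1)])
  next
    case False
    then show ?thesis
      using xs cl sub r
      by (auto simp: drop_update_swap intro!: klin_comp[OF _ b_right] mlin_update[OF assms(2)])
  qed
qed

lemma set_map_s': "set xs \<subseteq> carrier H \<Longrightarrow> set (map (s' ^^ a) xs) \<subseteq> carrier H"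
  using klin.closed[OF klin_funpow[OF s'.klin_axioms]] by (auto simp: subset_iff)

lemma set_map_t': "set xs \<subseteq> carrier H \<Longrightarrow> set (map t' xs) \<subseteq> carrier H"
  by auto

lemma set_take: "set xs \<subseteq> carrier H \<Longrightarrow> set (take k xs) \<subseteq> carrier H"
  and set_drop: "set xs \<subseteq> carrier H \<Longrightarrow> set (drop k xs) \<subseteq> carrier H"
  using set_take_subset set_drop_subset by fast+

lemma set_Cons: "x \<in> carrier H \<Longrightarrow> set xs \<subseteq> carrier H \<Longrightarrow> set (x # xs) \<subseteq> carrier H"
  and set_app: "set ys \<subseteq> carrier H \<Longrightarrow> set xs \<subseteq> carrier H \<Longrightarrow> set (ys @ xs) \<subseteq> carrier H"
  by auto

lemma image_s': "set xs \<subseteq> carrier H \<Longrightarrow> (s' ^^ a) ` set xs \<subseteq> carrier H"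
  and image_t': "set xs \<subseteq> carrier H \<Longrightarrow> t' ` set xs \<subseteq> carrier H"
  and image_s'1: "set xs \<subseteq> carrier H \<Longrightarrow> s' ` set xs \<subseteq> carrier H"
  using set_map_s' by auto

lemmas list_closed = image_s' image_t' image_s'1 set_map_s' set_map_t' set_take set_drop set_Cons set_app

subsection \<open>The operations of a tree\<close>

text \<open>The twist by \<^term>\<open>s'\<close> of the arguments of the right branch is what remains of the
  Koszul sign of $f \otimes g$ after the suspension.\<close>

primrec Pt :: "ptree \<Rightarrow> 'h list \<Rightarrow> 'a" where
  "Pt Leaf xs = \<zero>\<^bsub>A\<^esub>"
| "Pt (V2 T) xs = e (if T = Leaf then i (hd xs) else \<ominus>\<^bsub>A\<^esub> h (Pt T xs))"
| "Pt (V3 S T) xs =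
     (let ys = take (leaves S) xs; zs = map (s' ^^ weight2 S) (drop (leaves S) xs)
      in b (if S = Leaf then i (hd ys) else \<ominus>\<^bsub>A\<^esub> h (Pt S ys))
           (if T = Leaf then i (hd zs) else \<ominus>\<^bsub>A\<^esub> h (Pt T zs)))"

text \<open>\<open>Pt\<close> and \<open>Ft\<close> are in substance mutually recursive; primitive
  recursion forces the branches to be written out inside \<open>Pt\<close>, and \<open>Pt_V2\<close>
  and \<open>Pt_V3\<close> fold them back. A bare edge has no vertex, whence the value zero of
  \<open>Pt\<close> and the missing \<open>h\<close> here.\<close>

definition Ft :: "ptree \<Rightarrow> 'h list \<Rightarrow> 'a" where
  "Ft T xs = (if T = Leaf then i (hd xs) else \<ominus>\<^bsub>A\<^esub> h (Pt T xs))"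

lemma Ft_Leaf [simp]: "Ft Leaf xs = i (hd xs)"
  and Ft_not_Leaf: "T \<noteq> Leaf \<Longrightarrow> Ft T xs = \<ominus>\<^bsub>A\<^esub> h (Pt T xs)"
  by (simp_all add: Ft_def)

lemma Pt_V2: "Pt (V2 T) xs = e (Ft T xs)"
  and Pt_V3: "Pt (V3 S T) xs =
    b (Ft S (take (leaves S) xs)) (Ft T (map (s' ^^ weight2 S) (drop (leaves S) xs)))"
  by (simp_all add: Ft_def Let_def)

declare Pt.simps(2,3) [simp del]

text \<open>A root vertex turns facts \<open>Q\<close> about the \<open>Ft\<close> of the branches
  into a fact \<open>R\<close> about \<open>Pt\<close>; the root edge turns \<open>R\<close> into
  \<open>Q\<close> for the same tree. Each operator is thus treated exactly once.\<close>

lemma ptree_induct_FP [case_names Leaf V2 V3 edge]: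
  assumes "Q Leaf \<and> R Leaf" and "\<And>T. Q T \<Longrightarrow> R (V2 T)" and "\<And>S T. Q S \<Longrightarrow> Q T \<Longrightarrow> R (V3 S T)"
    and "\<And>T. T \<noteq> Leaf \<Longrightarrow> R T \<Longrightarrow> Q T"
  shows "Q T \<and> R T"
  by (induction T) (use assms in blast)+

lemma mlin_Ft_Pt: "mlin K H A (leaves T) (Ft T) \<and> mlin K H A (leaves T) (Pt T)"
proof (induction T rule: ptree_induct_FP)
  case Leaf
  show ?case
    unfolding mlin_def
    by (auto simp: length_Suc_conv i.klin_axioms klin_zero H.module_axioms A.module_axioms)
next
  case (V2 T)
  then show ?case
    by (simp add: Pt_V2[abs_def] mlin_comp[OF _ e.klin_axioms])
next
  case (V3 S T)
  then show ?case
    using mlin_b[OF V3(1) mlin_map[OF V3(2) klin_funpow[OF s'.klin_axioms]]]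
    by (simp add: Pt_V3[abs_def] drop_map)
next
  case (edge T)
  then show ?case
    using mlin_comp[OF mlin_comp[OF edge(2) h.klin_axioms] A.klin_neg]
    by (simp add: Ft_not_Leaf[OF edge(1), abs_def])
qed

lemmas mlin_Ft = mlin_Ft_Pt[THEN conjunct1]
lemmas mlin_Pt = mlin_Ft_Pt[THEN conjunct2]

lemma Ft_closed: "length xs = leaves T \<Longrightarrow> set xs \<subseteq> carrier H \<Longrightarrow> Ft T xs \<in> carrier A"
  and Pt_closed: "length xs = leaves T \<Longrightarrow> set xs \<subseteq> carrier H \<Longrightarrow> Pt T xs \<in> carrier A"
  using mlin_closed[OF mlin_Ft] mlin_closed[OF mlin_Pt] by auto

lemma b_neg:
  "x \<in> carrier A \<Longrightarrow> y \<in> carrier A \<Longrightarrow> b (\<ominus>\<^bsub>A\<^esub> x) y = \<ominus>\<^bsub>A\<^esub> b x y"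
  "x \<in> carrier A \<Longrightarrow> y \<in> carrier A \<Longrightarrow> b x (\<ominus>\<^bsub>A\<^esub> y) = \<ominus>\<^bsub>A\<^esub> b x y"
  using klin.neg[OF b_left] klin.neg[OF b_right] by auto

lemma b_sg:
  "x \<in> carrier A \<Longrightarrow> y \<in> carrier A \<Longrightarrow> b (sg A k x) y = sg A k (b x y)"
  "x \<in> carrier A \<Longrightarrow> y \<in> carrier A \<Longrightarrow> b x (sg A k y) = sg A k (b x y)"
  using klin.sg[OF b_left] klin.sg[OF b_right] by auto

section \<open>Behaviour of the tree operations under the sign operators\<close>

lemma map_funpow_s': "map s' (map (s' ^^ a) xs) = map (s' ^^ a) (map s' xs)"
  by (simp add: funpow_swap1)

lemma t'_funpow_s': "u \<in> carrier H \<Longrightarrow> t' ((s' ^^ a) u) = (s' ^^ a) (t' u)"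
proof (induction a)
  case (Suc a)
  then show ?case
    using klin.closed[OF klin_funpow[OF s'.klin_axioms]] by (simp add: s_t[symmetric])
qed simp

lemma map_t'_funpow_s':
  "set xs \<subseteq> carrier H \<Longrightarrow> map t' (map (s' ^^ a) xs) = map (s' ^^ a) (map t' xs)"
  by (auto simp: t'_funpow_s')

text \<open>Every vertex and every \<open>h\<close> anticommutes with \<open>s\<close>. In
  \<open>Ft\<close> they are equally many and the signs cancel; \<open>Pt\<close> lacks the
  \<open>h\<close> on the root edge.\<close>

lemma Ft_Pt_s:
  "(\<forall>xs. length xs = leaves T \<and> set xs \<subseteq> carrier H \<longrightarrow> Ft T (map s' xs) = s (Ft T xs)) \<and>
   (\<forall>xs. length xs = leaves T \<and> set xs \<subseteq> carrier H \<longrightarrow> Pt T (map s' xs) = \<ominus>\<^bsub>A\<^esub> s (Pt T xs))"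
proof (induction T rule: ptree_induct_FP)
  case Leaf
  then show ?case
    by (auto simp: length_Suc_conv s_i)
next
  case (V2 T)
  then show ?case
    by (simp add: Pt_V2 s_e Ft_closed)
next
  case (V3 S T)
  have "Pt (V3 S T) (map s' xs) = \<ominus>\<^bsub>A\<^esub> s (Pt (V3 S T) xs)"
    if "length xs = leaves (V3 S T)" "set xs \<subseteq> carrier H" for xs
  proof -
    let ?ys = "take (leaves S) xs" and ?zs = "map (s' ^^ weight2 S) (drop (leaves S) xs)"
    have "length ?ys = leaves S" "length ?zs = leaves T"
      and "set ?ys \<subseteq> carrier H" "set ?zs \<subseteq> carrier H"
      using that by (simp, simp, (intro list_closed that)+)
    moreover have "Pt (V3 S T) (map s' xs) = b (Ft S (map s' ?ys)) (Ft T (map s' ?zs))"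
      unfolding Pt_V3 take_map drop_map map_funpow_s' ..
    ultimately show ?thesis
      using V3 by (simp add: Pt_V3 s_b Ft_closed del: map_map)
  qed
  then show ?case by blast
next
  case (edge T)
  then show ?case
    by (simp add: Ft_not_Leaf s_h Pt_closed s.neg h.neg)
qed

lemmas Ft_s = Ft_Pt_s[THEN conjunct1, rule_format, OF conjI]

text \<open>Weight-2 vertices commute with \<open>t\<close>, while weight-3 vertices and all
  \<open>h\<close> anticommute with it. With one \<open>h\<close> per vertex, a weight-3 vertex
  cancels against its outgoing edge and a weight-2 vertex leaves one sign.\<close>

lemma Ft_Pt_t:
  "(\<forall>xs. length xs = leaves T \<and> set xs \<subseteq> carrier H \<longrightarrow>
     Ft T (map t' xs) = sg A (int (weight2 T)) (t (Ft T xs))) \<and>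
   (\<forall>xs. length xs = leaves T \<and> set xs \<subseteq> carrier H \<longrightarrow>
     Pt T (map t' xs) = \<ominus>\<^bsub>A\<^esub> sg A (int (weight2 T)) (t (Pt T xs)))"
proof (induction T rule: ptree_induct_FP)
  case Leaf
  then show ?case
    by (auto simp: length_Suc_conv t_i A.sg_eq)
next
  case (V2 T)
  then show ?case
    by (simp add: Pt_V2 t_e Ft_closed A.sg_eq e.neg)
next
  case (V3 S T)
  have "Pt (V3 S T) (map t' xs) = \<ominus>\<^bsub>A\<^esub> sg A (int (weight2 (V3 S T))) (t (Pt (V3 S T) xs))"
    if "length xs = leaves (V3 S T)" "set xs \<subseteq> carrier H" for xs
  proof -
    let ?ys = "take (leaves S) xs" and ?zs = "map (s' ^^ weight2 S) (drop (leaves S) xs)"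
    have "length ?ys = leaves S" "length ?zs = leaves T"
      and "set ?ys \<subseteq> carrier H" "set ?zs \<subseteq> carrier H"
      using that by (simp, simp, (intro list_closed that)+)
    moreover have "Pt (V3 S T) (map t' xs) = b (Ft S (map t' ?ys)) (Ft T (map t' ?zs))"
      unfolding Pt_V3 take_map drop_map
      by (subst map_t'_funpow_s') (simp_all only: list_closed that)
    ultimately show ?thesis
      using V3 by (simp add: Pt_V3 t_b Ft_closed A.sg_eq b_neg del: map_map)
  qed
  then show ?case by blast
next
  case (edge T)
  then show ?case
    by (simp add: Ft_not_Leaf t_h Pt_closed t.neg h.neg A.sg_eq)
qed

lemmas Ft_t = Ft_Pt_t[THEN conjunct1, rule_format, OF conjI]

subsection \<open>Sums over trees\<close>

definition F :: "nat \<Rightarrow> 'h list \<Rightarrow> 'a" where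
  "F w xs = (\<Oplus>\<^bsub>A\<^esub>T\<in>trees w (length xs). Ft T xs)"

definition P :: "nat \<Rightarrow> 'h list \<Rightarrow> 'a" where
  "P w xs = (\<Oplus>\<^bsub>A\<^esub>T\<in>trees w (length xs). Pt T xs)"

definition N :: "nat \<Rightarrow> 'h list \<Rightarrow> 'h" where
  "N w xs = p (P w xs)"

text \<open>A cut leaves at least one leaf on each side, whereas either side may have weight
  0.\<close>

definition splits :: "nat \<Rightarrow> nat \<Rightarrow> (nat \<times> nat) set" where
  "splits n w = {1..<n} \<times> {..w}"

text \<open>Truncated subtraction would repeat \<open>G 0\<close> at \<open>w = 0\<close>, but a
  tree of weight 0 cannot have a weight-2 root, so the term has to vanish there.\<close>

definition lower :: "(nat \<Rightarrow> 'h list \<Rightarrow> 'a) \<Rightarrow> nat \<Rightarrow> 'h list \<Rightarrow> 'a" where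
  "lower G w xs = (if w = 0 then \<zero>\<^bsub>A\<^esub> else G (w - 1) xs)"

text \<open>A convolution over the distributions of leaves and weight to two factors. The right
  inputs carry the same twist by the left weight as at a weight-3 vertex in \<open>Pt\<close>; it
  makes the product associative up to the sign of \<open>b_b\<close>.\<close>

definition product :: "(nat \<Rightarrow> 'h list \<Rightarrow> 'a) \<Rightarrow> (nat \<Rightarrow> 'h list \<Rightarrow> 'a) \<Rightarrow> nat \<Rightarrow> 'h list \<Rightarrow> 'a" where
  "product G G' w xs = (\<Oplus>\<^bsub>A\<^esub>e \<in> splits (length xs) w.
     b (G (snd e) (take (fst e) xs)) (G' (w - snd e) (map (s' ^^ snd e) (drop (fst e) xs))))"

abbreviation htup :: "'h list \<Rightarrow> bool" where
  "htup xs \<equiv> set xs \<subseteq> carrier H"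

lemma finite_splits [simp]: "finite (splits n w)"
  by (simp add: splits_def)

lemma mem_splits [simp]: "(k, a) \<in> splits n w \<longleftrightarrow> 1 \<le> k \<and> k < n \<and> a \<le> w"
  by (auto simp: splits_def)

lemma trees_leaves: "T \<in> trees w n \<Longrightarrow> leaves T = n" "T \<in> trees w n \<Longrightarrow> weight2 T = w"
  by (auto simp: trees_def)

lemma mlin_F: "mlin K H A n (F w)"
proof -
  have "mlin K H A n (\<lambda>xs. \<Oplus>\<^bsub>A\<^esub>T\<in>trees w n. Ft T xs)"
    using mlin_Ft
    by (intro mlin_sum H.module_axioms A.module_axioms finite_trees) (auto simp: trees_def)
  then show ?thesis
    by (auto simp: mlin_def F_def)
qed

lemma mlin_P: "mlin K H A n (P w)"
proof -
  have "mlin K H A n (\<lambda>xs. \<Oplus>\<^bsub>A\<^esub>T\<in>trees w n. Pt T xs)"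
    using mlin_Pt
    by (intro mlin_sum H.module_axioms A.module_axioms finite_trees) (auto simp: trees_def)
  then show ?thesis
    by (auto simp: mlin_def P_def)
qed

lemma mlin_N: "mlin K H H n (N w)"
  unfolding N_def[abs_def] by (rule mlin_comp[OF mlin_P p.klin_axioms])

lemma F_closed [simp]: "htup xs \<Longrightarrow> F w xs \<in> carrier A"
  and P_closed [simp]: "htup xs \<Longrightarrow> P w xs \<in> carrier A"
  and N_closed [simp]: "htup xs \<Longrightarrow> N w xs \<in> carrier H"
  using mlin_closed[OF mlin_F] mlin_closed[OF mlin_P] mlin_closed[OF mlin_N] by auto

lemma lower_closed:
  "G (w - 1) xs \<in> carrier A \<Longrightarrow> lower G w xs \<in> carrier A"
  by (simp add: lower_def)

lemma F_s: "htup xs \<Longrightarrow> F w (map s' xs) = s (F w xs)"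
  unfolding F_def
  by (subst s.finsum) (auto intro!: A.finsum_cong' simp: Ft_closed Ft_s trees_leaves)

lemma F_t: "htup xs \<Longrightarrow> F w (map t' xs) = sg A (int w) (t (F w xs))"
  unfolding F_def
  by (subst t.finsum, simp add: Ft_closed trees_leaves, subst A.sg_finsum[symmetric])
    (auto intro!: A.finsum_cong' simp: Ft_closed Ft_t trees_leaves)

lemma N_s: "htup xs \<Longrightarrow> N w (map s' xs) = \<ominus>\<^bsub>H\<^esub> s' (N w xs)"
proof -
  assume xs: "htup xs"
  have "P w (map s' xs) = \<ominus>\<^bsub>A\<^esub> s (P w xs)"
    unfolding P_def using xs Ft_Pt_s
    by (subst s.finsum, simp add: Pt_closed trees_leaves, subst A.finsum_neg[symmetric])
      (auto intro!: A.finsum_cong' simp: Pt_closed trees_leaves)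
  then show ?thesis
    using xs by (simp add: N_def s_p p.neg)
qed

lemma N_s_pow: "htup xs \<Longrightarrow> (s' ^^ a) (N w xs) = sg H (int a) (N w (map (s' ^^ a) xs))"
proof (induction a)
  case (Suc a)
  have "(s' ^^ Suc a) (N w xs) = sg H (int a) (s' (N w (map (s' ^^ a) xs)))"
    using Suc by (simp add: s'.sg list_closed)
  also have "s' (N w (map (s' ^^ a) xs)) = \<ominus>\<^bsub>H\<^esub> N w (map s' (map (s' ^^ a) xs))"
    using Suc.prems by (simp add: N_s list_closed del: map_map)
  also have "map s' (map (s' ^^ a) xs) = map (s' ^^ Suc a) xs"
    by simp
  finally show ?case
    using set_map_s'[OF Suc.prems, of "Suc a"] by (simp add: H.sg_eq del: funpow.simps)
qed (simp add: H.sg_eq)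

text \<open>The bare edge is the only tree of weight 0 with one leaf, and the only tree whose root
  edge carries \<open>i\<close> in place of \<open>- h\<close>.\<close>

lemma F_rec:
  "F w xs = (if w = 0 \<and> length xs = 1 then i (hd xs) else \<ominus>\<^bsub>A\<^esub> h (P w xs))" if "htup xs"
proof (cases "w = 0 \<and> length xs = 1")
  case True
  have "trees 0 1 = {Leaf}"
    using trees_rec[of 1 0] by auto
  then show ?thesis
    using True that by (cases xs) (auto simp: F_def A.finsum_insert)
next
  case False
  have "T \<noteq> Leaf" if "T \<in> trees w (length xs)" for T
    using False that by (auto simp: trees_def)
  then have "F w xs = (\<Oplus>\<^bsub>A\<^esub>T\<in>trees w (length xs). \<ominus>\<^bsub>A\<^esub> h (Pt T xs))"
    unfolding F_def using \<open>htup xs\<close>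
    by (intro A.finsum_cong') (auto simp: Ft_not_Leaf Pt_closed trees_leaves)
  also have "\<dots> = \<ominus>\<^bsub>A\<^esub> h (P w xs)"
    unfolding P_def using that
    by (subst h.finsum, simp add: Pt_closed trees_leaves, subst A.finsum_neg)
      (auto simp: Pt_closed trees_leaves)
  finally show ?thesis
    using False by auto
qed

lemma product_closed [simp]:
  assumes "htup xs" "\<And>w ys. htup ys \<Longrightarrow> G w ys \<in> carrier A" "\<And>w ys. htup ys \<Longrightarrow> G' w ys \<in> carrier A"
  shows "product G G' w xs \<in> carrier A"
  unfolding product_def using assms by (intro A.finsum_closed Pi_I b_closed) (simp_all add: list_closed)

lemma b_finsum:
  assumes "finite X" "finite Y" "\<And>x. x \<in> X \<Longrightarrow> f x \<in> carrier A" "\<And>y. y \<in> Y \<Longrightarrow> g y \<in> carrier A"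
  shows "b (finsum A f X) (finsum A g Y) = finsum A (\<lambda>(x, y). b (f x) (g y)) (X \<times> Y)"
proof -
  have "b (finsum A f X) (finsum A g Y) = (\<Oplus>\<^bsub>A\<^esub>x\<in>X. b (f x) (finsum A g Y))"
    by (rule klin.finsum[OF b_left]) (use assms in auto)
  also have "\<dots> = (\<Oplus>\<^bsub>A\<^esub>x\<in>X. \<Oplus>\<^bsub>A\<^esub>y\<in>Y. b (f x) (g y))"
    using assms by (intro A.finsum_cong') (auto intro!: klin.finsum[OF b_right])
  also have "\<dots> = finsum A (\<lambda>(x, y). b (f x) (g y)) (X \<times> Y)"
    using assms by (intro A.finsum_Sigma) auto
  finally show ?thesis .
qed

text \<open>Removing a weight-2 root leaves an arbitrary tree of weight one less. Removing a
  weight-3 root leaves two independent trees, and bilinearity of \<open>b\<close> turns the sum over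
  pairs into \<open>b\<close> applied to two sums. The bare edge contributes zero.\<close>

lemma P_rec:
  assumes xs: "htup xs" "xs \<noteq> []"
  shows "P w xs = e (lower F w xs) \<oplus>\<^bsub>A\<^esub> product F F w xs"
proof -
  define n where "n = length xs"
  have n: "1 \<le> n"
    using xs by (cases xs) (auto simp: n_def)
  define X where "X = (if w = 0 \<and> n = 1 then {Leaf} else {})"
  define Y where "Y = (if w = 0 then {} else V2 ` trees (w - 1) n)"
  define Z where
    "Z = (SIGMA e : splits n w. trees (snd e) (fst e) \<times> trees (w - snd e) (n - fst e))"
  define V where "V = (\<lambda>(_ :: nat \<times> nat, S, T). V3 S T)"
  have Z_iff: "z \<in> Z \<longleftrightarrow> (\<exists>k a S T. z = ((k, a), S, T) \<and> 1 \<le> k \<and> k < n \<and> a \<le> w \<and>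
      leaves S = k \<and> weight2 S = a \<and> leaves T = n - k \<and> weight2 T = w - a)" for z
    by (cases z) (auto simp: Z_def trees_def)
  have trees: "trees w n = X \<union> Y \<union> V ` Z"
    unfolding X_def Y_def Z_def V_def splits_def using n by (rule trees_rec)
  have disj: "X \<inter> Y = {}" "(X \<union> Y) \<inter> V ` Z = {}"
    by (auto simp: X_def Y_def V_def)
  have fin: "finite X" "finite Y" "finite Z"
    by (auto simp: X_def Y_def Z_def)
  have cl: "Pt T xs \<in> carrier A" if "T \<in> X \<union> Y \<union> V ` Z" for T
    using that xs by (intro Pt_closed) (auto simp: trees[symmetric] trees_leaves n_def)
  have "P w xs = (\<Oplus>\<^bsub>A\<^esub>T\<in>X. Pt T xs) \<oplus>\<^bsub>A\<^esub> (\<Oplus>\<^bsub>A\<^esub>T\<in>Y. Pt T xs) \<oplus>\<^bsub>A\<^esub> (\<Oplus>\<^bsub>A\<^esub>T\<in>V ` Z. Pt T xs)"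
    unfolding P_def n_def[symmetric] trees using fin disj cl
    by (subst A.finsum_Un_disjoint; (subst A.finsum_Un_disjoint)?) auto
  also have "(\<Oplus>\<^bsub>A\<^esub>T\<in>X. Pt T xs) = \<zero>\<^bsub>A\<^esub>"
    by (auto simp: X_def)
  also have "(\<Oplus>\<^bsub>A\<^esub>T\<in>Y. Pt T xs) = e (lower F w xs)"
  proof (cases w)
    case (Suc v)
    have "(\<Oplus>\<^bsub>A\<^esub>T\<in>Y. Pt T xs) = (\<Oplus>\<^bsub>A\<^esub>T\<in>trees v n. Pt (V2 T) xs)"
      using cl Suc by (simp add: Y_def, subst A.finsum_reindex) (auto simp: inj_on_def)
    also have "\<dots> = e (lower F w xs)"
      using xs
      by (auto simp: Suc lower_def F_def e.finsum Pt_V2 Ft_closed trees_leaves n_def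
          intro!: A.finsum_cong')
    finally show ?thesis .
  qed (simp add: Y_def lower_def)
  also have "(\<Oplus>\<^bsub>A\<^esub>T\<in>V ` Z. Pt T xs) = (\<Oplus>\<^bsub>A\<^esub>z\<in>Z. Pt (V z) xs)"
  proof (rule A.finsum_reindex)
    show "inj_on V Z"
      by (auto simp: inj_on_def V_def Z_iff)
  qed (use cl in auto)
  also have "\<dots> = finsum A (\<lambda>(e, z). Pt (V (e, z)) xs) Z"
    by (rule arg_cong[of _ _ "\<lambda>f. finsum A f Z"]) auto
  also have "\<dots> = (\<Oplus>\<^bsub>A\<^esub>e\<in>splits n w. \<Oplus>\<^bsub>A\<^esub>z\<in>trees (snd e) (fst e) \<times> trees (w - snd e) (n - fst e).
      Pt (V (e, z)) xs)"
    unfolding Z_def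
    by (rule A.finsum_Sigma[symmetric])
      (use cl in \<open>auto simp: Z_def image_iff split_beta\<close>)
  also have "\<dots> = product F F w xs"
    unfolding product_def n_def[symmetric]
  proof (rule A.finsum_cong'[OF refl])
    show "(\<lambda>e. b (F (snd e) (take (fst e) xs)) (F (w - snd e) (map (s' ^^ snd e) (drop (fst e) xs))))
        \<in> splits n w \<rightarrow> carrier A"
      using xs by (intro Pi_I b_closed F_closed list_closed)
  next
    fix c
    assume c: "c \<in> splits n w"
    obtain k a where ka: "c = (k, a)"
      by fastforce
    have k: "1 \<le> k" "k < n" "a \<le> w"
      using c ka by auto
    let ?ys = "take k xs" and ?zs = "map (s' ^^ a) (drop k xs)"
    have len: "length ?ys = k" "length ?zs = n - k"
      using k by (auto simp: n_def)
    have cls: "htup ?ys" "htup ?zs"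
      using xs by (auto intro!: list_closed simp del: set_map)
    have "(\<Oplus>\<^bsub>A\<^esub>z\<in>trees a k \<times> trees (w - a) (n - k). Pt (V (c, z)) xs) =
        finsum A (\<lambda>(S, T). b (Ft S ?ys) (Ft T ?zs)) (trees a k \<times> trees (w - a) (n - k))"
      using cls len
      by (intro A.finsum_cong') (auto simp: V_def Pt_V3 Ft_closed trees_leaves)
    also have "\<dots> = b (F a ?ys) (F (w - a) ?zs)"
      unfolding F_def len using cls len
      by (subst b_finsum) (auto simp: Ft_closed trees_leaves)
    finally show "(\<Oplus>\<^bsub>A\<^esub>z\<in>trees (snd c) (fst c) \<times> trees (w - snd c) (n - fst c). Pt (V (c, z)) xs) =
        b (F (snd c) (take (fst c) xs)) (F (w - snd c) (map (s' ^^ snd c) (drop (fst c) xs)))"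
      by (simp add: ka)
  qed
  finally show ?thesis
    using xs by (simp add: lower_closed)
qed

lemma P_single: "htup [x] \<Longrightarrow> P 0 [x] = \<zero>\<^bsub>A\<^esub>"
  by (subst P_rec) (auto simp: lower_def product_def splits_def)

end

definition positions :: "nat \<Rightarrow> nat \<Rightarrow> (nat \<times> nat \<times> nat) set" where
  "positions n w = {(r, q, m). 1 \<le> q \<and> r + q \<le> n \<and> m \<le> w}"

lemma mem_positions [simp]: "(r, q, m) \<in> positions n w \<longleftrightarrow> 1 \<le> q \<and> r + q \<le> n \<and> m \<le> w"
  by (simp add: positions_def)

lemma finite_positions [simp]: "finite (positions n w)"
proof (rule finite_subset)
  show "positions n w \<subseteq> {..n} \<times> {..n} \<times> {..w}"
    by (auto simp: positions_def)
qed simp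

text \<open>For small concrete \<open>n\<close> and \<open>w\<close> the right-hand side evaluates
  to an explicit list; in this form the bidga identities are read off from the general structure
  relation.\<close>

lemma positions_list:
  "positions n w = set [(r, q, m). r \<leftarrow> [0..<n], q \<leftarrow> [1..<Suc (n - r)], m \<leftarrow> [0..<Suc w]]"
  by (auto simp: positions_def image_iff simp del: upt_Suc)

context tree_transfer
begin

subsection \<open>Inserting the transferred operations\<close>

definition slot :: "nat \<Rightarrow> nat \<Rightarrow> nat \<Rightarrow> 'h list \<Rightarrow> 'h list" where
  "slot r q m xs = map t' (take r xs) @ N m (take q (drop r xs)) # map (s' ^^ m) (drop (r + q) xs)"

definition ins :: "(nat \<Rightarrow> 'h list \<Rightarrow> 'a) \<Rightarrow> nat \<Rightarrow> 'h list \<Rightarrow> 'a" where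
  "ins G w xs =
     finsum A (\<lambda>(r, q, m). G (w - m) (slot r q m xs)) (positions (length xs) w)"

lemma slot_closed [simp]: "htup xs \<Longrightarrow> htup (slot r q m xs)"
  unfolding slot_def by (intro list_closed N_closed)

lemma length_slot: "r + q \<le> length xs \<Longrightarrow> length (slot r q m xs) = Suc (length xs - q)"
  by (simp add: slot_def)

lemma slot_not_Nil [simp]: "slot r q m xs \<noteq> []"
  by (simp add: slot_def)

lemma ins_closed [simp]:
  assumes "htup xs" "\<And>w ys. htup ys \<Longrightarrow> G w ys \<in> carrier A"
  shows "ins G w xs \<in> carrier A"
  unfolding ins_def using assms by (intro A.finsum_closed Pi_I) auto

text \<open>An insertion that uses up the whole weight leaves none for the weight-2 root, so
  positions with \<open>m = w\<close> contribute zero and the others are the positions of total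
  weight \<open>w - 1\<close>.\<close>

lemma ins_lower:
  assumes xs: "htup xs"
  shows "finsum A (\<lambda>(r, q, m). e (lower F (w - m) (slot r q m xs))) (positions (length xs) w) =
    e (lower (ins F) w xs)"
proof (cases w)
  case 0
  have "finsum A (\<lambda>(r, q, m). e (lower F (w - m) (slot r q m xs))) (positions (length xs) w) =
      (\<Oplus>\<^bsub>A\<^esub>_\<in>positions (length xs) w. \<zero>\<^bsub>A\<^esub>)"
    using xs 0 by (intro A.finsum_cong') (auto simp: lower_def)
  then show ?thesis
    using 0 by (simp add: lower_def)
next
  case (Suc v)
  have "e (lower (ins F) w xs) =
      finsum A (\<lambda>(r, q, m). e (F (v - m) (slot r q m xs))) (positions (length xs) v)"
    using xs
    by (auto simp: Suc lower_def ins_def e.finsum split_beta intro!: A.finsum_cong')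
  also have "\<dots> =
      finsum A (\<lambda>(r, q, m). e (lower F (w - m) (slot r q m xs))) (positions (length xs) w)"
  proof (rule A.add.finprod_mono_neutral_cong_left)
    fix z
    assume "z \<in> positions (length xs) w - positions (length xs) v"
    then show "(case z of (r, q, m) \<Rightarrow> e (lower F (w - m) (slot r q m xs))) = \<zero>\<^bsub>A\<^esub>"
      by (cases z) (auto simp: Suc lower_def not_le)
  qed (use xs in \<open>auto simp: Suc lower_def Suc_diff_le\<close>)
  finally show ?thesis ..
qed

lemma take_slot_left: "k \<le> r \<Longrightarrow> r \<le> length xs \<Longrightarrow> take k (slot r q m xs) = map t' (take k xs)"
  by (simp add: slot_def take_map min_def)

lemma drop_slot_left: "k \<le> r \<Longrightarrow> r \<le> length xs \<Longrightarrow> drop k (slot r q m xs) =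
    map t' (take (r - k) (drop k xs)) @ N m (take q (drop (r - k) (drop k xs))) #
      map (s' ^^ m) (drop (r - k + q) (drop k xs))"
  by (simp add: slot_def drop_map drop_take)

lemma slot_append:
  "length ys = r \<Longrightarrow> length us = q \<Longrightarrow>
    slot r q m (ys @ us @ zs) = map t' ys @ N m us # map (s' ^^ m) zs"
  by (simp add: slot_def)

text \<open>The inserted operation merges \<open>q\<close> entries into one. A cut to the right of
  it after \<open>k\<close> entries of the new tuple is therefore a cut after
  \<open>k + q - 1\<close> entries of the old one.\<close>

lemma
  assumes "r < k" "r + q \<le> length xs"
  shows take_slot_right: "take k (slot r q m xs) = slot r q m (take (k + q - 1) xs)"
    and drop_slot_right: "drop k (slot r q m xs) = map (s' ^^ m) (drop (k + q - 1) xs)"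
proof -
  obtain c where k: "k = Suc (r + c)"
    using assms(1) less_imp_Suc_add by blast
  define ys us zs where "ys = take r xs" and "us = take q (drop r xs)" and "zs = drop (r + q) xs"
  have xs: "xs = ys @ us @ zs"
    by (simp add: ys_def us_def zs_def add.commute flip: drop_drop)
  have len: "length ys = r" "length us = q"
    using assms(2) by (auto simp: ys_def us_def)
  have "take (k + q - 1) xs = ys @ us @ take c zs" "drop (k + q - 1) xs = drop c zs"
    using len by (simp_all add: xs k)
  then show "take k (slot r q m xs) = slot r q m (take (k + q - 1) xs)"
    and "drop k (slot r q m xs) = map (s' ^^ m) (drop (k + q - 1) xs)"
    using len by (simp_all add: xs slot_append) (simp_all add: k take_map drop_map)
qed

lemma map_funpow_commute: "map (f ^^ a) (map (f ^^ c) xs) = map (f ^^ c) (map (f ^^ a) xs)"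
  by (simp add: add.commute flip: funpow_add)

lemma F_slot_sg:
  assumes "htup ys" "htup zs" "u \<in> carrier H"
  shows "F w (ys @ sg H n u # zs) = sg A n (F w (ys @ u # zs))"
  using klin.sg[OF mlin_slot[OF mlin_F refl assms(1,2) H.module_axioms] assms(3)] by simp

text \<open>Moving \<^term>\<open>s'\<close> past the inserted operation and \<^term>\<open>t'\<close> past the left branch
  produces the same sign.\<close>

lemma insert_left_branch:
  assumes xs: "htup xs" and k: "k \<le> r" "r + q \<le> length xs"
  shows "b (F a (take k (slot r q m xs))) (F c (map (s' ^^ a) (drop k (slot r q m xs)))) =
    b (t (F a (take k xs))) (F c (slot (r - k) q m (map (s' ^^ a) (drop k xs))))"
proof -
  let ?X = "drop k xs"
  let ?l = "map t' (take (r - k) (map (s' ^^ a) ?X))"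
  let ?c = "map (s' ^^ m) (drop (r - k + q) (map (s' ^^ a) ?X))"
  let ?n = "N m (take q (drop (r - k) (map (s' ^^ a) ?X)))"
  have X: "htup ?X" "htup (map (s' ^^ a) ?X)"
    using xs by (auto simp: list_closed)
  have l: "map (s' ^^ a) (map t' (take (r - k) ?X)) = ?l"
    using X by (subst map_t'_funpow_s'[symmetric]) (auto simp: list_closed take_map)
  have c: "map (s' ^^ a) (map (s' ^^ m) (drop (r - k + q) ?X)) = ?c"
    unfolding drop_map by (rule map_funpow_commute)
  have "(s' ^^ a) (N m (take q (drop (r - k) ?X))) = sg H (int a) ?n"
    using N_s_pow[of "take q (drop (r - k) ?X)" a] X
    by (simp add: list_closed take_map drop_map del: drop_drop)
  then have "F c (map (s' ^^ a) (drop k (slot r q m xs))) = F c (?l @ sg H (int a) ?n # ?c)"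
    using k l c by (simp add: drop_slot_left)
  also have "\<dots> = sg A (int a) (F c (?l @ ?n # ?c))"
    using X xs by (intro F_slot_sg list_closed N_closed)
  finally have 1: "F c (map (s' ^^ a) (drop k (slot r q m xs))) =
      sg A (int a) (F c (slot (r - k) q m (map (s' ^^ a) ?X)))"
    by (simp add: slot_def)
  have 2: "F a (take k (slot r q m xs)) = sg A (int a) (t (F a (take k xs)))"
    using k xs by (simp add: take_slot_left F_t list_closed)
  have "t (F a (take k xs)) \<in> carrier A" "F c (slot (r - k) q m (map (s' ^^ a) ?X)) \<in> carrier A"
    using xs X by (simp_all add: list_closed)
  then show ?thesis
    unfolding 1 2 by (simp add: b_sg A.sg_sg, simp add: A.sg_eq)
qed

text \<open>The left factor absorbs the inserted operation and its weight \<open>m\<close>. The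
  twist \<open>m\<close> left on the trailing inputs and the twist \<open>a\<close> of the product
  add up to the twist by the new left weight.\<close>

lemma insert_right_branch:
  assumes "r < k" "r + q \<le> length xs"
  shows "b (F c (take k (slot r q m xs))) (F c' (map (s' ^^ a) (drop k (slot r q m xs)))) =
    b (F c (slot r q m (take (k + q - 1) xs))) (F c' (map (s' ^^ (a + m)) (drop (k + q - 1) xs)))"
  using assms by (simp add: take_slot_right drop_slot_right funpow_add)

lemma b_ins_left:
  assumes "htup ys" "y \<in> carrier A"
  shows "b (ins F w ys) y =
    finsum A (\<lambda>(r, q, m). b (F (w - m) (slot r q m ys)) y) (positions (length ys) w)"
  unfolding ins_def using assms
  by (subst klin.finsum[OF b_left]) (auto intro!: A.finsum_cong')

lemma b_ins_right:
  assumes "htup zs" "x \<in> carrier A"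
  shows "b x (ins F w zs) =
    finsum A (\<lambda>(r, q, m). b x (F (w - m) (slot r q m zs))) (positions (length zs) w)"
  unfolding ins_def using assms
  by (subst klin.finsum[OF b_right]) (auto intro!: A.finsum_cong')

text \<open>A Leibniz rule: after expanding \<open>P\<close> at the root, every cut of the modified
  tuple leaves the inserted value entirely in one of the two factors. The \<open>t\<close> on the
  left factor arises when the insertion happens in the right one, by
  \<open>insert_left_branch\<close>.\<close>

lemma ins_P:
  assumes xs: "htup xs"
  shows "ins P w xs = e (lower (ins F) w xs) \<oplus>\<^bsub>A\<^esub>
    (product (ins F) F w xs \<oplus>\<^bsub>A\<^esub> product (\<lambda>w ys. t (F w ys)) (ins F) w xs)"
proof -
  define n where "n = length xs"
  define summand where "summand = (\<lambda>((r, q, m), (k, a)).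
    b (F a (take k (slot r q m xs))) (F (w - m - a) (map (s' ^^ a) (drop k (slot r q m xs)))))"
  \<comment> \<open>\<open>Suc (n - q)\<close> is the length of the tuple after insertion, and
    \<open>w - m\<close> the weight that the insertion leaves to the outer trees.\<close>
  define U where "U = (SIGMA z : positions n w. case z of (r, q, m) \<Rightarrow> splits (Suc (n - q)) (w - m))"
  \<comment> \<open>The inserted entry has index \<open>r\<close>. A cut after
    \<open>k \<le> r\<close> entries puts it into the right factor (\<open>L\<close>), a cut after
    \<open>k > r\<close> entries into the left one (\<open>R\<close>).\<close>
  define L where "L = {((r, q, m), (k, a)) | r q m k a. ((r, q, m), (k, a)) \<in> U \<and> k \<le> r}"
  define R where "R = {((r, q, m), (k, a)) | r q m k a. ((r, q, m), (k, a)) \<in> U \<and> r < k}"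
  have summand_closed: "summand z \<in> carrier A" for z
    using xs by (auto simp: summand_def list_closed split: prod.split)
  have U_iff: "((r, q, m), (k, a)) \<in> U \<longleftrightarrow>
      1 \<le> q \<and> r + q \<le> n \<and> m \<le> w \<and> 1 \<le> k \<and> k \<le> n - q \<and> a \<le> w - m" for r q m k a
    by (auto simp: U_def)
  have U: "U = L \<union> R"
    unfolding L_def R_def by (auto simp: not_le[symmetric])
  have disj: "L \<inter> R = {}"
    by (auto simp: L_def R_def)
  have "finite U"
    unfolding U_def by (intro finite_SigmaI) auto
  then have fin: "finite L" "finite R"
    unfolding U by auto

  have "ins P w xs = finsum A (\<lambda>(r, q, m). e (lower F (w - m) (slot r q m xs)) \<oplus>\<^bsub>A\<^esub>
      product F F (w - m) (slot r q m xs)) (positions n w)"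
    unfolding ins_def n_def using xs
    by (intro A.finsum_cong') (auto simp: P_rec lower_closed)
  also have "\<dots> = (\<Oplus>\<^bsub>A\<^esub>z\<in>positions n w.
      (case z of (r, q, m) \<Rightarrow> e (lower F (w - m) (slot r q m xs))) \<oplus>\<^bsub>A\<^esub>
      (case z of (r, q, m) \<Rightarrow> product F F (w - m) (slot r q m xs)))"
    by (rule arg_cong[of _ _ "\<lambda>f. finsum A f _"]) auto
  also have "\<dots> = e (lower (ins F) w xs) \<oplus>\<^bsub>A\<^esub>
      finsum A (\<lambda>(r, q, m). product F F (w - m) (slot r q m xs)) (positions n w)"
    using xs by (subst A.finsum_addf) (auto simp: ins_lower n_def lower_closed)
  also have "finsum A (\<lambda>(r, q, m). product F F (w - m) (slot r q m xs)) (positions n w) =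
      (\<Oplus>\<^bsub>A\<^esub>z\<in>positions n w. \<Oplus>\<^bsub>A\<^esub>c\<in>(case z of (r, q, m) \<Rightarrow> splits (Suc (n - q)) (w - m)). summand (z, c))"
  proof (intro A.finsum_cong'[OF refl])
    fix z
    assume "z \<in> positions n w"
    then show "(case z of (r, q, m) \<Rightarrow> product F F (w - m) (slot r q m xs)) =
        (\<Oplus>\<^bsub>A\<^esub>c\<in>(case z of (r, q, m) \<Rightarrow> splits (Suc (n - q)) (w - m)). summand (z, c))"
      by (cases z) (auto simp: product_def summand_def n_def length_slot split_beta)
  qed (auto intro!: A.finsum_closed summand_closed)
  also have "\<dots> = finsum A (\<lambda>(z, c). summand (z, c)) U"
    unfolding U_def using summand_closed by (intro A.finsum_Sigma) (auto split: prod.split)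
  also have "\<dots> = finsum A summand U"
    by (rule arg_cong[of _ _ "\<lambda>f. finsum A f _"]) auto
  also have "\<dots> = finsum A summand L \<oplus>\<^bsub>A\<^esub> finsum A summand R"
    unfolding U using fin disj summand_closed by (intro A.finsum_Un_disjoint) auto
  also have "finsum A summand L = product (\<lambda>w ys. t (F w ys)) (ins F) w xs"
  proof -
    have "product (\<lambda>w ys. t (F w ys)) (ins F) w xs =
        (\<Oplus>\<^bsub>A\<^esub>c\<in>splits n w. \<Oplus>\<^bsub>A\<^esub>z\<in>positions (n - fst c) (w - snd c). case z of (r, q, m) \<Rightarrow>
          b (t (F (snd c) (take (fst c) xs)))
            (F (w - snd c - m) (slot r q m (map (s' ^^ snd c) (drop (fst c) xs)))))"
      unfolding product_def n_def using xs
      by (intro A.finsum_cong'[OF refl] Pi_I)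
        (auto simp: b_ins_right list_closed intro!: A.finsum_closed)
    also have "\<dots> = finsum A (\<lambda>(c, z). case z of (r, q, m) \<Rightarrow>
          b (t (F (snd c) (take (fst c) xs)))
            (F (w - snd c - m) (slot r q m (map (s' ^^ snd c) (drop (fst c) xs)))))
        (SIGMA c : splits n w. positions (n - fst c) (w - snd c))"
      using xs by (intro A.finsum_Sigma) (auto simp: list_closed)
    also have "\<dots> = finsum A summand L"
    \<comment> \<open>The choices are exchanged: the cut of \<open>xs\<close> comes first, and the
      position is then counted from the beginning of the right factor.\<close>
    proof (rule A.finsum_reindex_bij_witness[symmetric, where
          j = "\<lambda>((r, q, m), (k, a)). ((k, a), (r - k, q, m))" and
          i = "\<lambda>((k, a), (r, q, m)). ((r + k, q, m), (k, a))"])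
      fix z
      assume "z \<in> L"
      then obtain r q m k a where z: "z = ((r, q, m), (k, a))" and mem: "(z \<in> U)" "k \<le> r"
        by (auto simp: L_def)
      then have k: "r + q \<le> length xs" "w - m - a = w - a - m"
        by (auto simp: U_iff n_def)
      show "(\<lambda>(c, z). case z of (r, q, m) \<Rightarrow> b (t (F (snd c) (take (fst c) xs)))
            (F (w - snd c - m) (slot r q m (map (s' ^^ snd c) (drop (fst c) xs)))))
          ((\<lambda>((r, q, m), (k, a)). ((k, a), (r - k, q, m))) z) = summand z"
        using insert_left_branch[OF xs mem(2) k(1), of a m "w - m - a"] k(2)
        by (simp add: z summand_def)
    qed (use xs in \<open>auto simp: L_def U_iff list_closed\<close>)
    finally show ?thesis ..
  qed
  also have "finsum A summand R = product (ins F) F w xs"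
  proof -
    have "product (ins F) F w xs =
        (\<Oplus>\<^bsub>A\<^esub>c\<in>splits n w. \<Oplus>\<^bsub>A\<^esub>z\<in>positions (fst c) (snd c). case z of (r, q, m) \<Rightarrow>
          b (F (snd c - m) (slot r q m (take (fst c) xs)))
            (F (w - snd c) (map (s' ^^ snd c) (drop (fst c) xs))))"
      unfolding product_def n_def using xs
      by (intro A.finsum_cong'[OF refl] Pi_I)
        (auto simp: b_ins_left list_closed min_def intro!: A.finsum_closed)
    also have "\<dots> = finsum A (\<lambda>(c, z). case z of (r, q, m) \<Rightarrow>
          b (F (snd c - m) (slot r q m (take (fst c) xs)))
            (F (w - snd c) (map (s' ^^ snd c) (drop (fst c) xs))))
        (SIGMA c : splits n w. positions (fst c) (snd c))"
      using xs by (intro A.finsum_Sigma) (auto simp: list_closed)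
    also have "\<dots> = finsum A summand R"
    \<comment> \<open>Here the left factor of the cut of \<open>xs\<close> contains all
      \<open>q\<close> inputs of the inserted operation and its weight \<open>m\<close>, while the
      position is unchanged.\<close>
    proof (rule A.finsum_reindex_bij_witness[symmetric, where
          j = "\<lambda>((r, q, m), (k, a)). ((k + q - 1, a + m), (r, q, m))" and
          i = "\<lambda>((k, a), (r, q, m)). ((r, q, m), (k + 1 - q, a - m))"])
      fix z
      assume "z \<in> R"
      then obtain r q m k a where z: "z = ((r, q, m), (k, a))" and mem: "(z \<in> U)" "r < k"
        by (auto simp: R_def)
      then have k: "r + q \<le> length xs" "w - m - a = w - (a + m)"
        by (auto simp: U_iff n_def)
      show "(\<lambda>(c, z). case z of (r, q, m) \<Rightarrow> b (F (snd c - m) (slot r q m (take (fst c) xs)))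
            (F (w - snd c) (map (s' ^^ snd c) (drop (fst c) xs))))
          ((\<lambda>((r, q, m), (k, a)). ((k + q - 1, a + m), (r, q, m))) z) = summand z"
        using insert_right_branch[OF mem(2) k(1), of a m "w - m - a" a] k(2)
        by (simp add: z summand_def)
    qed (use xs in \<open>auto simp: R_def U_iff list_closed\<close>)
    finally show ?thesis ..
  qed
  finally show ?thesis
    using xs by (simp add: A.a_ac lower_closed)
qed

subsection \<open>The structure relations\<close>

definition closed_op :: "(nat \<Rightarrow> 'h list \<Rightarrow> 'a) \<Rightarrow> bool" where
  "closed_op G \<longleftrightarrow> (\<forall>w xs. htup xs \<longrightarrow> G w xs \<in> carrier A)"

lemma closed_opD [simp]: "closed_op G \<Longrightarrow> htup xs \<Longrightarrow> G w xs \<in> carrier A"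
  by (simp add: closed_op_def)

lemma closed_op [simp]:
  "closed_op F" "closed_op P" "closed_op (\<lambda>w xs. t (F w xs))" "closed_op (\<lambda>w xs. d (F w xs))"
  "closed_op (ins F)" "closed_op (\<lambda>w xs. e (lower F w xs))"
  by (auto simp: closed_op_def lower_closed)

lemma closed_op_product [simp]: "closed_op G \<Longrightarrow> closed_op G' \<Longrightarrow> closed_op (product G G')"
  by (simp add: closed_op_def)

lemma closed_op_add [simp]:
  "closed_op G \<Longrightarrow> closed_op G' \<Longrightarrow> closed_op (\<lambda>w xs. G w xs \<oplus>\<^bsub>A\<^esub> G' w xs)"
  by (simp add: closed_op_def)

lemma closed_op_neg [simp]: "closed_op G \<Longrightarrow> closed_op (\<lambda>w xs. \<ominus>\<^bsub>A\<^esub> G w xs)"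
  by (simp add: closed_op_def)

text \<open>Both factors receive nonempty, strictly shorter tuples and no larger weight. Asking for
  agreement only there is what lets an induction hypothesis act inside a product.\<close>

lemma product_cong:
  assumes "htup xs" "closed_op G2" "closed_op G2'"
    and "\<And>w' ys. htup ys \<Longrightarrow> ys \<noteq> [] \<Longrightarrow> length ys < length xs \<Longrightarrow> w' \<le> w \<Longrightarrow> G1 w' ys = G2 w' ys"
    and "\<And>w' ys. htup ys \<Longrightarrow> ys \<noteq> [] \<Longrightarrow> length ys < length xs \<Longrightarrow> w' \<le> w \<Longrightarrow> G1' w' ys = G2' w' ys"
  shows "product G1 G1' w xs = product G2 G2' w xs"
  unfolding product_def
proof (intro A.finsum_cong'[OF refl] Pi_I)
  fix c
  assume c: "c \<in> splits (length xs) w"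
  obtain k a where ka: "c = (k, a)"
    by fastforce
  let ?ys = "take k xs" and ?zs = "map (s' ^^ a) (drop k xs)"
  have htup: "htup ?ys" "htup ?zs"
    using assms(1) by (auto intro!: list_closed simp del: set_map)
  then show "b (G2 (snd c) (take (fst c) xs)) (G2' (w - snd c) (map (s' ^^ snd c) (drop (fst c) xs)))
      \<in> carrier A"
    using assms by (simp add: ka)
  have "G1 a ?ys = G2 a ?ys" "G1' (w - a) ?zs = G2' (w - a) ?zs"
    using htup c by (auto simp: ka intro!: assms(4,5))
  then show "b (G1 (snd c) (take (fst c) xs)) (G1' (w - snd c) (map (s' ^^ snd c) (drop (fst c) xs))) =
      b (G2 (snd c) (take (fst c) xs)) (G2' (w - snd c) (map (s' ^^ snd c) (drop (fst c) xs)))"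
    by (simp add: ka)
qed

lemma product_apply:
  assumes "htup xs" "closed_op G" "closed_op G'" "klin K A A f"
  shows "f (product G G' w xs) = (\<Oplus>\<^bsub>A\<^esub>c \<in> splits (length xs) w.
     f (b (G (snd c) (take (fst c) xs)) (G' (w - snd c) (map (s' ^^ snd c) (drop (fst c) xs)))))"
  unfolding product_def using assms(1-3)
  by (intro klin.finsum[OF assms(4)]) (simp add: list_closed)

lemma product_add_left:
  assumes "htup xs" "closed_op G1" "closed_op G2" "closed_op G'"
  shows "product (\<lambda>w xs. G1 w xs \<oplus>\<^bsub>A\<^esub> G2 w xs) G' w xs = product G1 G' w xs \<oplus>\<^bsub>A\<^esub> product G2 G' w xs"
proof -
  have "product (\<lambda>w xs. G1 w xs \<oplus>\<^bsub>A\<^esub> G2 w xs) G' w xs = (\<Oplus>\<^bsub>A\<^esub>c\<in>splits (length xs) w.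
      b (G1 (snd c) (take (fst c) xs)) (G' (w - snd c) (map (s' ^^ snd c) (drop (fst c) xs))) \<oplus>\<^bsub>A\<^esub>
      b (G2 (snd c) (take (fst c) xs)) (G' (w - snd c) (map (s' ^^ snd c) (drop (fst c) xs))))"
    unfolding product_def using assms
    by (intro A.finsum_cong'[OF refl] Pi_I klin.add[OF b_left] A.add.m_closed)
      (simp_all add: list_closed)
  then show ?thesis
    unfolding product_def using assms by (subst (asm) A.finsum_addf) (simp_all add: list_closed)
qed

lemma product_add_right:
  assumes "htup xs" "closed_op G1" "closed_op G2" "closed_op G'"
  shows "product G' (\<lambda>w xs. G1 w xs \<oplus>\<^bsub>A\<^esub> G2 w xs) w xs = product G' G1 w xs \<oplus>\<^bsub>A\<^esub> product G' G2 w xs"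
proof -
  have "product G' (\<lambda>w xs. G1 w xs \<oplus>\<^bsub>A\<^esub> G2 w xs) w xs = (\<Oplus>\<^bsub>A\<^esub>c\<in>splits (length xs) w.
      b (G' (snd c) (take (fst c) xs)) (G1 (w - snd c) (map (s' ^^ snd c) (drop (fst c) xs))) \<oplus>\<^bsub>A\<^esub>
      b (G' (snd c) (take (fst c) xs)) (G2 (w - snd c) (map (s' ^^ snd c) (drop (fst c) xs))))"
    unfolding product_def using assms
    by (intro A.finsum_cong'[OF refl] Pi_I klin.add[OF b_right] A.add.m_closed)
      (simp_all add: list_closed)
  then show ?thesis
    unfolding product_def using assms by (subst (asm) A.finsum_addf) (simp_all add: list_closed)
qed

lemma product_neg:
  assumes "htup xs" "closed_op G" "closed_op G'"
  shows "product (\<lambda>w xs. \<ominus>\<^bsub>A\<^esub> G w xs) G' w xs = \<ominus>\<^bsub>A\<^esub> product G G' w xs"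
    and "product G (\<lambda>w xs. \<ominus>\<^bsub>A\<^esub> G' w xs) w xs = \<ominus>\<^bsub>A\<^esub> product G G' w xs"
  unfolding product_def using assms
  by (auto simp: list_closed b_neg intro!: A.finsum_cong' simp flip: A.finsum_neg)

lemma d_product:
  assumes "htup xs"
  shows "d (product F F w xs) = \<ominus>\<^bsub>A\<^esub> (product (\<lambda>w xs. d (F w xs)) F w xs \<oplus>\<^bsub>A\<^esub>
    product (\<lambda>w xs. t (F w xs)) (\<lambda>w xs. d (F w xs)) w xs)"
proof -
  let ?ys = "\<lambda>c. take (fst c) xs" and ?zs = "\<lambda>c. map (s' ^^ snd c) (drop (fst c) xs)"
  have "d (product F F w xs) = (\<Oplus>\<^bsub>A\<^esub>c\<in>splits (length xs) w. \<ominus>\<^bsub>A\<^esub>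
      (b (d (F (snd c) (?ys c))) (F (w - snd c) (?zs c)) \<oplus>\<^bsub>A\<^esub>
       b (t (F (snd c) (?ys c))) (d (F (w - snd c) (?zs c)))))"
    unfolding product_apply[OF assms closed_op(1) closed_op(1) d.klin_axioms] using assms
    by (intro A.finsum_cong'[OF refl] Pi_I d_b) (simp_all add: list_closed)
  also have "\<dots> = \<ominus>\<^bsub>A\<^esub> (\<Oplus>\<^bsub>A\<^esub>c\<in>splits (length xs) w.
      b (d (F (snd c) (?ys c))) (F (w - snd c) (?zs c)) \<oplus>\<^bsub>A\<^esub>
      b (t (F (snd c) (?ys c))) (d (F (w - snd c) (?zs c))))"
    using assms by (intro A.finsum_neg) (simp add: list_closed)
  finally show ?thesis
    unfolding product_def using assms by (subst (asm) A.finsum_addf) (simp_all add: list_closed)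
qed

text \<open>Factors built with \<open>lower\<close> vanish at weight 0, so a sum over all cuts and
  the corresponding sum with shifted weight differ by zero terms; this allows the index set to be
  cut down before shifting.\<close>

lemma product_zero_weights:
  assumes "htup xs" "closed_op G" "closed_op G'" "X \<subseteq> splits (length xs) w"
    and "\<And>k a. (k, a) \<in> splits (length xs) w - X \<Longrightarrow>
      G a (take k xs) = \<zero>\<^bsub>A\<^esub> \<or> G' (w - a) (map (s' ^^ a) (drop k xs)) = \<zero>\<^bsub>A\<^esub>"
  shows "product G G' w xs = (\<Oplus>\<^bsub>A\<^esub>c \<in> X.
     b (G (snd c) (take (fst c) xs)) (G' (w - snd c) (map (s' ^^ snd c) (drop (fst c) xs))))"
  unfolding product_def
proof (rule A.add.finprod_mono_neutral_cong_left[symmetric])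
  fix c
  assume c: "c \<in> splits (length xs) w - X"
  obtain k a where ka: "c = (k, a)"
    by fastforce
  have "G a (take k xs) = \<zero>\<^bsub>A\<^esub> \<or> G' (w - a) (map (s' ^^ a) (drop k xs)) = \<zero>\<^bsub>A\<^esub>"
    using c unfolding ka by (rule assms(5))
  moreover have "htup (take k xs)" "htup (map (s' ^^ a) (drop k xs))"
    using assms(1) by (auto intro!: list_closed simp del: set_map)
  ultimately show "b (G (snd c) (take (fst c) xs)) (G' (w - snd c) (map (s' ^^ snd c) (drop (fst c) xs))) =
      \<zero>\<^bsub>A\<^esub>"
    using assms(2,3) by (auto simp: ka)
qed (use assms in \<open>auto simp: list_closed\<close>)

text \<open>Expanding \<open>P\<close> at the root, the weight-2 part dies because \<open>e\<close>
  squares to zero. On the product part \<open>e\<close> acts as a derivation up to the signs of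
  \<open>e_b\<close>, which puts a weight-2 vertex on top of either factor.\<close>

lemma lower_cancel:
  assumes xs: "htup xs" "xs \<noteq> []"
  shows "e (lower P w xs) = \<ominus>\<^bsub>A\<^esub> (product (\<lambda>w xs. e (lower F w xs)) F w xs \<oplus>\<^bsub>A\<^esub>
    product (\<lambda>w xs. t (F w xs)) (\<lambda>w xs. e (lower F w xs)) w xs)"
proof (cases w)
  case 0
  have "product (\<lambda>w xs. e (lower F w xs)) F w xs = \<zero>\<^bsub>A\<^esub>"
    "product (\<lambda>w xs. t (F w xs)) (\<lambda>w xs. e (lower F w xs)) w xs = \<zero>\<^bsub>A\<^esub>"
    using xs by (subst product_zero_weights[where X = "{}"]; simp; simp add: 0 lower_def)+
  then show ?thesis
    by (simp add: 0 lower_def)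
next
  case (Suc v)
  let ?f = "\<lambda>(k, a). b (e (F a (take k xs))) (F (v - a) (map (s' ^^ Suc a) (drop k xs)))"
  let ?g = "\<lambda>(k, a). b (t (F a (take k xs))) (e (F (v - a) (map (s' ^^ a) (drop k xs))))"
  have cl: "?f c \<in> carrier A" "?g c \<in> carrier A" for c
    using xs set_map_s'[OF set_drop, of xs "Suc (snd c)" "fst c"]
    by (auto simp: list_closed split_beta simp del: funpow.simps set_map)
  have "e (lower P w xs) = e (product F F v xs)"
    using xs by (simp add: Suc lower_def P_rec e.add lower_closed e_e)
  also have "\<dots> = finsum A (\<lambda>c. \<ominus>\<^bsub>A\<^esub> (?f c \<oplus>\<^bsub>A\<^esub> ?g c)) (splits (length xs) v)"
  proof (subst product_apply[OF xs(1) closed_op(1) closed_op(1) e.klin_axioms],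
      rule A.finsum_cong'[OF refl])
    fix c
    assume "c \<in> splits (length xs) v"
    obtain k a where c: "c = (k, a)"
      by fastforce
    let ?zs = "map (s' ^^ a) (drop k xs)"
    \<comment> \<open>The extra \<open>s\<close> that \<open>e_b\<close> puts on the right argument
      becomes one more \<open>s'\<close> on the right inputs: exactly the twist owed to a left
      factor that has gained a weight-2 vertex.\<close>
    have "F (v - a) (map s' ?zs) = s (F (v - a) ?zs)"
      using xs by (intro F_s list_closed)
    then show "e (b (F (snd c) (take (fst c) xs)) (F (v - snd c) (map (s' ^^ snd c) (drop (fst c) xs)))) =
        \<ominus>\<^bsub>A\<^esub> (?f c \<oplus>\<^bsub>A\<^esub> ?g c)"
      using xs by (simp add: c e_b list_closed)
  qed (use cl in auto)
  also have "\<dots> = \<ominus>\<^bsub>A\<^esub> (finsum A ?f (splits (length xs) v) \<oplus>\<^bsub>A\<^esub> finsum A ?g (splits (length xs) v))"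
    using cl by (subst A.finsum_neg, simp, subst A.finsum_addf) auto
  also have "finsum A ?f (splits (length xs) v) = product (\<lambda>w xs. e (lower F w xs)) F w xs"
  proof -
    \<comment> \<open>The left factor contains the new vertex and so has weight at least 1; its
      weight is \<open>Suc a\<close> where \<open>?f\<close> counts \<open>a\<close>.\<close>
    let ?X = "{1..<length xs} \<times> {1..w}"
    have "product (\<lambda>w xs. e (lower F w xs)) F w xs = (\<Oplus>\<^bsub>A\<^esub>c\<in>?X.
        b (e (lower F (snd c) (take (fst c) xs))) (F (w - snd c) (map (s' ^^ snd c) (drop (fst c) xs))))"
      using xs by (intro product_zero_weights closed_op) (auto simp: lower_def)
    also have "\<dots> = finsum A ?f (splits (length xs) v)"
    proof (rule A.finsum_reindex_bij_witness[where j = "\<lambda>(k, a). (k, a - 1)" and i = "\<lambda>(k, a). (k, Suc a)"])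
      fix c
      assume "c \<in> ?X"
      then show "?f ((\<lambda>(k, a). (k, a - 1)) c) =
          b (e (lower F (snd c) (take (fst c) xs))) (F (w - snd c) (map (s' ^^ snd c) (drop (fst c) xs)))"
        by (cases c; cases "snd c") (auto simp: lower_def Suc)
    qed (use cl in \<open>auto simp: Suc\<close>)
    finally show ?thesis ..
  qed
  also have "finsum A ?g (splits (length xs) v) =
      product (\<lambda>w xs. t (F w xs)) (\<lambda>w xs. e (lower F w xs)) w xs"
  proof -
    have "product (\<lambda>w xs. t (F w xs)) (\<lambda>w xs. e (lower F w xs)) w xs = (\<Oplus>\<^bsub>A\<^esub>c\<in>splits (length xs) v.
        b (t (F (snd c) (take (fst c) xs)))
          (e (lower F (w - snd c) (map (s' ^^ snd c) (drop (fst c) xs)))))"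
      using xs by (intro product_zero_weights closed_op) (auto simp: Suc lower_def not_le)
    also have "\<dots> = finsum A ?g (splits (length xs) v)"
      using cl by (intro A.finsum_cong'[OF refl]) (auto simp: lower_def Suc Suc_diff_le)
    finally show ?thesis ..
  qed
  finally show ?thesis .
qed

text \<open>Two nested cuts divide a tuple into three pieces, whichever cut is made first. On the
  last piece the twists \<open>a'\<close> and \<open>a - a'\<close> compose to the twist
  \<open>a\<close>, so both readings involve the same values of \<open>F\<close> and
  \<open>b_b\<close> applies term by term.\<close>

lemma product_assoc:
  assumes xs: "htup xs"
  shows "product (product F F) F w xs = \<ominus>\<^bsub>A\<^esub> product (\<lambda>w xs. t (F w xs)) (product F F) w xs"
proof -
  define n where "n = length xs"
  define f where "f = (\<lambda>k a k' a'. b (b (F a' (take k' xs)) (F (a - a') (map (s' ^^ a') (drop k' (take k xs)))))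
    (F (w - a) (map (s' ^^ a) (drop k xs))))"
  define g where "g = (\<lambda>k a l c. b (t (F a (take k xs)))
    (b (F c (take l (map (s' ^^ a) (drop k xs))))
       (F (w - a - c) (map (s' ^^ c) (drop l (map (s' ^^ a) (drop k xs)))))))"
  have cl: "f k a k' a' \<in> carrier A" "g k a l c \<in> carrier A" for k a k' a' l c
    using xs by (auto simp: f_def g_def list_closed)
  have "product (product F F) F w xs =
      (\<Oplus>\<^bsub>A\<^esub>x\<in>splits n w. \<Oplus>\<^bsub>A\<^esub>y\<in>splits (fst x) (snd x). f (fst x) (snd x) (fst y) (snd y))"
    unfolding product_def[of _ _ w xs] n_def
  proof (rule A.finsum_cong'[OF refl])
    fix x
    assume x: "x \<in> splits (length xs) w"
    let ?y = "F (w - snd x) (map (s' ^^ snd x) (drop (fst x) xs))"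
    have "?y \<in> carrier A"
      using xs by (intro F_closed list_closed)
    then have "b (product F F (snd x) (take (fst x) xs)) ?y =
        (\<Oplus>\<^bsub>A\<^esub>y\<in>splits (length (take (fst x) xs)) (snd x). f (fst x) (snd x) (fst y) (snd y))"
      using x xs unfolding f_def
      by (subst product_apply[where f = "\<lambda>v. b v ?y"])
        (auto intro!: b_left A.finsum_cong' simp: list_closed min_def)
    also have "length (take (fst x) xs) = fst x"
      using x by (cases x) auto
    finally show "b (product F F (snd x) (take (fst x) xs)) ?y =
        (\<Oplus>\<^bsub>A\<^esub>y\<in>splits (fst x) (snd x). f (fst x) (snd x) (fst y) (snd y))" .
  qed (use cl in \<open>auto intro!: A.finsum_closed\<close>)
  also have "\<dots> = finsum A (\<lambda>(x, y). f (fst x) (snd x) (fst y) (snd y))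
      (SIGMA x : splits n w. splits (fst x) (snd x))"
    using cl by (intro A.finsum_Sigma) auto
  also have "\<dots> = finsum A (\<lambda>(x, y). \<ominus>\<^bsub>A\<^esub> g (fst x) (snd x) (fst y) (snd y))
      (SIGMA x : splits n w. splits (n - fst x) (w - snd x))"
  proof (rule A.finsum_reindex_bij_witness[where
        j = "\<lambda>((k, a), (k', a')). ((k', a'), (k - k', a - a'))" and
        i = "\<lambda>((k, a), (l, c)). ((k + l, a + c), (k, a))"])
    fix z
    assume "z \<in> (SIGMA x : splits n w. splits (fst x) (snd x))"
    then obtain k a k' a' where z: "z = ((k, a), (k', a'))"
      and mem: "1 \<le> k" "k < n" "a \<le> w" "1 \<le> k'" "k' < k" "a' \<le> a"
      by auto
    have 1: "map (s' ^^ (a - a')) (drop (k - k') (map (s' ^^ a') (drop k' xs))) = map (s' ^^ a) (drop k xs)"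
      using mem by (simp add: drop_map flip: funpow_add)
    have 2: "take (k - k') (map (s' ^^ a') (drop k' xs)) = map (s' ^^ a') (drop k' (take k xs))"
      by (simp add: take_map drop_take)
    have 3: "w - a' - (a - a') = w - a"
      using mem by simp
    have "f k a k' a' = \<ominus>\<^bsub>A\<^esub> g k' a' (k - k') (a - a')"
      unfolding g_def 1 2 3 f_def using xs by (intro b_b F_closed list_closed)
    then show "(\<lambda>(x, y). \<ominus>\<^bsub>A\<^esub> g (fst x) (snd x) (fst y) (snd y))
        ((\<lambda>((k, a), (k', a')). ((k', a'), (k - k', a - a'))) z) =
        (\<lambda>(x, y). f (fst x) (snd x) (fst y) (snd y)) z"
      by (simp add: z)
  qed (use cl in auto)
  also have "\<dots> = (\<Oplus>\<^bsub>A\<^esub>x\<in>splits n w. \<Oplus>\<^bsub>A\<^esub>y\<in>splits (n - fst x) (w - snd x).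
      \<ominus>\<^bsub>A\<^esub> g (fst x) (snd x) (fst y) (snd y))"
    using cl by (intro A.finsum_Sigma[symmetric]) auto
  also have "\<dots> = \<ominus>\<^bsub>A\<^esub> (\<Oplus>\<^bsub>A\<^esub>x\<in>splits n w. \<Oplus>\<^bsub>A\<^esub>y\<in>splits (n - fst x) (w - snd x).
      g (fst x) (snd x) (fst y) (snd y))"
    using cl
    by (subst A.finsum_neg[symmetric], simp)
      (intro A.finsum_cong'[OF refl] Pi_I A.finsum_neg A.a_inv_closed A.finsum_closed; simp)
  also have "(\<Oplus>\<^bsub>A\<^esub>x\<in>splits n w. \<Oplus>\<^bsub>A\<^esub>y\<in>splits (n - fst x) (w - snd x).
      g (fst x) (snd x) (fst y) (snd y)) = product (\<lambda>w xs. t (F w xs)) (product F F) w xs"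
    unfolding product_def[of _ _ w xs] n_def
  proof (rule A.finsum_cong'[OF refl])
    fix x
    assume x: "x \<in> splits (length xs) w"
    let ?x = "t (F (snd x) (take (fst x) xs))" and ?zs = "map (s' ^^ snd x) (drop (fst x) xs)"
    have "?x \<in> carrier A" "htup ?zs"
      using xs by (auto intro!: t.closed F_closed list_closed simp del: set_map)
    then have "b ?x (product F F (w - snd x) ?zs) =
        (\<Oplus>\<^bsub>A\<^esub>y\<in>splits (length ?zs) (w - snd x). g (fst x) (snd x) (fst y) (snd y))"
      using xs unfolding g_def
      by (subst product_apply[where f = "b ?x"])
        (auto intro!: b_right A.finsum_cong' simp: list_closed)
    then show "(\<Oplus>\<^bsub>A\<^esub>y\<in>splits (length xs - fst x) (w - snd x). g (fst x) (snd x) (fst y) (snd y)) =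
        b ?x (product F F (w - snd x) ?zs)"
      by simp
  qed (use xs in \<open>auto intro!: b_closed t.closed F_closed product_closed list_closed simp del: set_map\<close>)
  finally show ?thesis .
qed

text \<open>These are the terms where two adjacent vertices meet on an edge without
  \<open>h\<close>. Two weight-2 vertices give zero by \<open>e_e\<close>, mixed pairs cancel by the
  derivation rule, and two weight-3 vertices cancel by associativity.\<close>

lemma product_P_cancel:
  assumes xs: "htup xs" "xs \<noteq> []"
  shows "e (lower P w xs) \<oplus>\<^bsub>A\<^esub>
    (product P F w xs \<oplus>\<^bsub>A\<^esub> product (\<lambda>w xs. t (F w xs)) P w xs) = \<zero>\<^bsub>A\<^esub>"
proof -
  let ?E = "\<lambda>w xs. e (lower F w xs)" and ?t = "\<lambda>w xs. t (F w xs)"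
  have "product P F w xs = product (\<lambda>w xs. ?E w xs \<oplus>\<^bsub>A\<^esub> product F F w xs) F w xs"
    using xs by (intro product_cong) (simp_all add: P_rec)
  also have "\<dots> = product ?E F w xs \<oplus>\<^bsub>A\<^esub> product (product F F) F w xs"
    using xs by (intro product_add_left) simp_all
  finally have 1: "product P F w xs = product ?E F w xs \<oplus>\<^bsub>A\<^esub> product (product F F) F w xs" .
  have "product ?t P w xs = product ?t (\<lambda>w xs. ?E w xs \<oplus>\<^bsub>A\<^esub> product F F w xs) w xs"
    using xs by (intro product_cong) (simp_all add: P_rec)
  also have "\<dots> = product ?t ?E w xs \<oplus>\<^bsub>A\<^esub> product ?t (product F F) w xs"
    using xs by (intro product_add_right) simp_all
  finally have 2: "product ?t P w xs = product ?t ?E w xs \<oplus>\<^bsub>A\<^esub> product ?t (product F F) w xs" .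
  have cl: "product ?E F w xs \<in> carrier A" "product ?t ?E w xs \<in> carrier A"
    "product ?t (product F F) w xs \<in> carrier A"
    using xs by (simp_all add: lower_closed)
  have "product ?E F w xs \<oplus>\<^bsub>A\<^esub> product (product F F) F w xs \<oplus>\<^bsub>A\<^esub>
      (product ?t ?E w xs \<oplus>\<^bsub>A\<^esub> product ?t (product F F) w xs) =
      (product ?E F w xs \<oplus>\<^bsub>A\<^esub> product ?t ?E w xs) \<oplus>\<^bsub>A\<^esub>
      (\<ominus>\<^bsub>A\<^esub> product ?t (product F F) w xs \<oplus>\<^bsub>A\<^esub> product ?t (product F F) w xs)"
    using cl by (simp add: product_assoc[OF xs(1)] A.a_ac)
  also have "\<dots> = product ?E F w xs \<oplus>\<^bsub>A\<^esub> product ?t ?E w xs"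
    using cl by (simp add: A.l_neg)
  finally show ?thesis
    unfolding 1 2 lower_cancel[OF xs] using cl by (simp add: A.l_neg)
qed

text \<open>Away from the bare edge \<open>F\<close> is \<open>- h P\<close>, so the homotopy
  identity at \<open>P\<close> gives \<open>d F = i p P + h d P - P\<close>. The first two terms
  form \<open>ins F\<close>: inserting everything at once yields \<open>i p P\<close>, and the other
  insertions yield \<open>- h\<close> of \<open>ins P\<close>, which is \<open>h d P\<close> by the
  assumption on \<open>d P\<close>.\<close>

lemma d_F_step:
  assumes xs: "htup xs" "xs \<noteq> []" and IH: "d (P w xs) = \<ominus>\<^bsub>A\<^esub> ins P w xs"
  shows "d (F w xs) = ins F w xs \<oplus>\<^bsub>A\<^esub> \<ominus>\<^bsub>A\<^esub> P w xs"
proof -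
  define n where "n = length xs"
  have n: "1 \<le> n"
    using xs by (cases xs) (auto simp: n_def)
  \<comment> \<open>The removed position inserts an operation with all inputs and all weight. It
    leaves a single entry and weight 0, the one case where \<open>F\<close> is \<open>i\<close> and
    not \<open>- h P\<close>.\<close>
  define X where "X = positions n w - {(0, n, w)}"
  have X: "positions n w = insert (0, n, w) X" "(0, n, w) \<notin> X" "finite X"
    using n by (auto simp: X_def)
  have top: "slot 0 n w xs = [N w xs]"
    by (simp add: slot_def n_def)
  have notop: "F (w - m) (slot r q m xs) = \<ominus>\<^bsub>A\<^esub> h (P (w - m) (slot r q m xs))"
    if "(r, q, m) \<in> X" for r q m
    using that xs
    by (subst F_rec) (auto simp: X_def n_def length_slot)
  have "ins F w xs = F 0 [N w xs] \<oplus>\<^bsub>A\<^esub>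
      finsum A (\<lambda>(r, q, m). F (w - m) (slot r q m xs)) X"
    unfolding ins_def n_def[symmetric] X(1) using X(2,3) xs top
    by (subst A.finsum_insert) auto
  also have "finsum A (\<lambda>(r, q, m). F (w - m) (slot r q m xs)) X =
      finsum A (\<lambda>c. \<ominus>\<^bsub>A\<^esub> h (case c of (r, q, m) \<Rightarrow> P (w - m) (slot r q m xs))) X"
    using notop xs by (intro A.finsum_cong'[OF refl]) (auto simp del: A.minus_minus)
  also have "\<dots> = \<ominus>\<^bsub>A\<^esub> h (finsum A (\<lambda>(r, q, m). P (w - m) (slot r q m xs)) X)"
    using xs by (subst A.finsum_neg; (subst h.finsum)?) auto
  \<comment> \<open>The removed position may be put back, since its term \<open>P 0 [N w xs]\<close>
    is zero by \<open>P_single\<close>.\<close>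
  also have "finsum A (\<lambda>(r, q, m). P (w - m) (slot r q m xs)) X = ins P w xs"
    unfolding ins_def n_def[symmetric] X(1) using X(2,3) xs top
    by (subst A.finsum_insert) (auto simp: P_single intro!: A.l_zero[symmetric] A.finsum_closed)
  also have "F 0 [N w xs] = i (p (P w xs))"
    using xs by (subst F_rec) (auto simp: N_def)
  finally have insF: "ins F w xs = i (p (P w xs)) \<oplus>\<^bsub>A\<^esub> h (d (P w xs))"
    using xs by (simp add: IH h.neg)
  show ?thesis
  proof (cases "w = 0 \<and> n = 1")
    case True
    then obtain x where "xs = [x]"
      by (auto simp: n_def length_Suc_conv)
    then show ?thesis
      using True xs insF by (simp add: P_single F_rec d_i)
  next
    case False
    have "d (h (P w xs)) = P w xs \<ominus>\<^bsub>A\<^esub> i (p (P w xs)) \<ominus>\<^bsub>A\<^esub> h (d (P w xs))"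
      using retract[of "P w xs"] xs by (simp add: A.minus_eq A.a_ac A.r_neg)
    moreover have "F w xs = \<ominus>\<^bsub>A\<^esub> h (P w xs)"
      using False xs by (subst F_rec) (auto simp: n_def)
    ultimately show ?thesis
      using xs by (simp add: insF d.neg A.minus_eq A.minus_add A.a_ac)
  qed
qed

lemma d_P_F:
  assumes "htup xs" "xs \<noteq> []"
  shows "d (P w xs) = \<ominus>\<^bsub>A\<^esub> ins P w xs \<and> d (F w xs) = ins F w xs \<oplus>\<^bsub>A\<^esub> \<ominus>\<^bsub>A\<^esub> P w xs"
  using assms
proof (induction "w + length xs" arbitrary: w xs rule: less_induct)
  case less
  note xs = less.prems
  let ?t = "\<lambda>w xs. t (F w xs)" and ?d = "\<lambda>w xs. d (F w xs)"
  let ?D = "\<lambda>w xs. ins F w xs \<oplus>\<^bsub>A\<^esub> \<ominus>\<^bsub>A\<^esub> P w xs"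
  \<comment> \<open>Below a weight-2 root the tuple stays and the weight drops; in a product the
    tuple gets shorter and the weight does not grow. Either way weight plus length
    decreases.\<close>
  have IH: "d (F w' ys) = ?D w' ys"
    if "htup ys" "ys \<noteq> []" "w' + length ys < w + length xs" for w' ys
    using less.hyps[OF that(3,1,2)] by simp
  have lower: "d (e (lower F w xs)) = \<ominus>\<^bsub>A\<^esub> (e (lower (ins F) w xs) \<oplus>\<^bsub>A\<^esub> \<ominus>\<^bsub>A\<^esub> e (lower P w xs))"
    using xs by (cases w) (simp_all add: lower_def d_e IH e.add e.neg)
  have "product ?d F w xs = product ?D F w xs" "product ?t ?d w xs = product ?t ?D w xs"
    using xs by (auto intro!: product_cong IH)
  then have "product ?d F w xs = product (ins F) F w xs \<oplus>\<^bsub>A\<^esub> \<ominus>\<^bsub>A\<^esub> product P F w xs"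
    "product ?t ?d w xs = product ?t (ins F) w xs \<oplus>\<^bsub>A\<^esub> \<ominus>\<^bsub>A\<^esub> product ?t P w xs"
    using xs by (simp_all add: product_add_left product_add_right product_neg)
  then have dP: "d (P w xs) =
      \<ominus>\<^bsub>A\<^esub> (e (lower (ins F) w xs) \<oplus>\<^bsub>A\<^esub> \<ominus>\<^bsub>A\<^esub> e (lower P w xs)) \<oplus>\<^bsub>A\<^esub>
      \<ominus>\<^bsub>A\<^esub> (product (ins F) F w xs \<oplus>\<^bsub>A\<^esub> \<ominus>\<^bsub>A\<^esub> product P F w xs \<oplus>\<^bsub>A\<^esub>
        (product ?t (ins F) w xs \<oplus>\<^bsub>A\<^esub> \<ominus>\<^bsub>A\<^esub> product ?t P w xs))"
    using xs by (simp add: P_rec d.add lower d_product lower_closed)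
  have cl: "e (lower (ins F) w xs) \<in> carrier A" "e (lower P w xs) \<in> carrier A"
    "product (ins F) F w xs \<in> carrier A" "product P F w xs \<in> carrier A"
    "product ?t (ins F) w xs \<in> carrier A" "product ?t P w xs \<in> carrier A"
    using xs by (simp_all add: lower_closed)
  \<comment> \<open>The hypothesis replaces every \<open>d F\<close> by \<open>ins F - P\<close>.
    The insertion terms add up by \<open>ins_P\<close>; what is left are the terms that
    \<open>product_P_cancel\<close> kills.\<close>
  have "d (P w xs) = \<ominus>\<^bsub>A\<^esub> ins P w xs \<oplus>\<^bsub>A\<^esub>
    (e (lower P w xs) \<oplus>\<^bsub>A\<^esub> (product P F w xs \<oplus>\<^bsub>A\<^esub> product ?t P w xs))"
    unfolding dP ins_P[OF xs(1)] using cl by (simp add: A.minus_add A.a_ac)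
  then have "d (P w xs) = \<ominus>\<^bsub>A\<^esub> ins P w xs"
    using xs by (simp add: product_P_cancel)
  with d_F_step[OF xs this] show ?case
    by simp
qed

theorem N_relation:
  assumes "htup xs" "xs \<noteq> []"
  shows "finsum H (\<lambda>(r, q, m). N (w - m) (slot r q m xs)) (positions (length xs) w) = \<zero>\<^bsub>H\<^esub>"
proof -
  have "finsum H (\<lambda>(r, q, m). N (w - m) (slot r q m xs)) (positions (length xs) w) = p (ins P w xs)"
    unfolding ins_def using assms(1)
    by (subst p.finsum) (auto simp: N_def intro!: H.finsum_cong')
  also have "ins P w xs = \<ominus>\<^bsub>A\<^esub> d (P w xs)"
    using assms d_P_F[OF assms, of w] by simp
  also have "p \<dots> = \<zero>\<^bsub>H\<^esub>"
    using assms by (simp add: p.neg p_d)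
  finally show ?thesis .
qed

end

section \<open>Bigraded modules\<close>

definition decomposes :: "('k, 'a) bigraded \<Rightarrow> (nat \<times> int \<Rightarrow> 'a) \<Rightarrow> 'a \<Rightarrow> bool" where
  "decomposes A c x \<longleftrightarrow> (\<forall>i j. c (i, j) \<in> grade A i j) \<and> finite {e. c e \<noteq> \<zero>\<^bsub>A\<^esub>} \<and>
     x = (\<Oplus>\<^bsub>A\<^esub>e\<in>{e. c e \<noteq> \<zero>\<^bsub>A\<^esub>}. c e)"

definition components :: "('k, 'a) bigraded \<Rightarrow> 'a \<Rightarrow> nat \<times> int \<Rightarrow> 'a" where
  "components A x = (THE c. decomposes A c x)"

text \<open>Turns a sign depending on the bidegree into a linear operator on all of
  \<open>A\<close>; on one bidegree it is that sign, see \<open>twist_grade\<close>. Reading the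
  bidegrees off the components removes the ambiguity at zero.\<close>

definition twist :: "('k, 'a) bigraded \<Rightarrow> int \<Rightarrow> int \<Rightarrow> 'a \<Rightarrow> 'a" where
  "twist A \<alpha> \<beta> x = (\<Oplus>\<^bsub>A\<^esub>e\<in>{e. components A x e \<noteq> \<zero>\<^bsub>A\<^esub>}.
     sg A (\<alpha> * int (fst e) + \<beta> * snd e) (components A x e))"

context bigraded_module
begin

lemma grade_closed: "x \<in> grade A i j \<Longrightarrow> x \<in> carrier A"
  using submoduleE(1)[OF grade_submodule] by auto

lemma grade_zero [simp]: "\<zero>\<^bsub>A\<^esub> \<in> grade A i j"
  using submodule.axioms(1)[OF grade_submodule[of i j]] subgroup.one_closed by fastforce

lemma grade_add: "x \<in> grade A i j \<Longrightarrow> y \<in> grade A i j \<Longrightarrow> x \<oplus>\<^bsub>A\<^esub> y \<in> grade A i j"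
  using submoduleE(5)[OF grade_submodule] by auto

lemma grade_neg: "x \<in> grade A i j \<Longrightarrow> \<ominus>\<^bsub>A\<^esub> x \<in> grade A i j"
  using submoduleE(3)[OF grade_submodule] by auto

lemma grade_smult: "a \<in> carrier K \<Longrightarrow> x \<in> grade A i j \<Longrightarrow> a \<odot>\<^bsub>A\<^esub> x \<in> grade A i j"
  using submoduleE(4)[OF grade_submodule] by auto

lemma gradez_int [simp]: "gradez A (int i) j = grade A i j"
  by (simp add: gradez_def)

lemma gradez_closed: "x \<in> gradez A i j \<Longrightarrow> x \<in> carrier A"
  by (auto simp: gradez_def grade_closed split: if_splits)

lemma gradez_zero [simp]: "\<zero>\<^bsub>A\<^esub> \<in> gradez A i j"
  by (simp add: gradez_def)

lemma gradez_add: "x \<in> gradez A i j \<Longrightarrow> y \<in> gradez A i j \<Longrightarrow> x \<oplus>\<^bsub>A\<^esub> y \<in> gradez A i j"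
  by (auto simp: gradez_def grade_add split: if_splits)

lemma gradez_neg: "x \<in> gradez A i j \<Longrightarrow> \<ominus>\<^bsub>A\<^esub> x \<in> gradez A i j"
  by (auto simp: gradez_def grade_neg split: if_splits)

lemma gradez_sg: "x \<in> gradez A i j \<Longrightarrow> sg A n x \<in> gradez A i j"
  by (simp add: sg_eq gradez_closed gradez_neg)

lemma gradez_finsum: "(\<And>x. x \<in> X \<Longrightarrow> f x \<in> gradez A i j) \<Longrightarrow> finsum A f X \<in> gradez A i j"
  by (rule finsum_in_subset) (auto simp: gradez_add gradez_closed)

lemma decomposesD:
  assumes "decomposes A c x"
  shows "c e \<in> grade A (fst e) (snd e)" "c e \<in> carrier A" "finite {e. c e \<noteq> \<zero>\<^bsub>A\<^esub>}"
  using assms grade_closed by (auto simp: decomposes_def) (metis prod.collapse)+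

lemma decomposes_finsum:
  assumes "decomposes A c x" "finite E" "{e. c e \<noteq> \<zero>\<^bsub>A\<^esub>} \<subseteq> E"
    and "\<And>e. f e \<zero>\<^bsub>A\<^esub> = \<zero>\<^bsub>A\<^esub>" "\<And>e. f e (c e) \<in> carrier A"
  shows "(\<Oplus>\<^bsub>A\<^esub>e\<in>{e. c e \<noteq> \<zero>\<^bsub>A\<^esub>}. f e (c e)) = (\<Oplus>\<^bsub>A\<^esub>e\<in>E. f e (c e))"
proof (rule add.finprod_mono_neutral_cong_left)
  fix e
  assume "e \<in> E - {e. c e \<noteq> \<zero>\<^bsub>A\<^esub>}"
  then show "f e (c e) = \<zero>\<^bsub>A\<^esub>"
    using assms(4)[of e] by auto
qed (use assms in auto)

text \<open>Adding or scaling families of components may shrink their supports. Summing over a fixed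
  finite superset lets several families be compared termwise.\<close>

lemma decomposes_iff:
  assumes "\<And>i j. c (i, j) \<in> grade A i j" "finite E" "{e. c e \<noteq> \<zero>\<^bsub>A\<^esub>} \<subseteq> E"
  shows "decomposes A c x \<longleftrightarrow> x = (\<Oplus>\<^bsub>A\<^esub>e\<in>E. c e)"
proof -
  have cl: "c e \<in> carrier A" for e
    using assms(1) grade_closed by (metis prod.collapse)
  have "(\<Oplus>\<^bsub>A\<^esub>e\<in>{e. c e \<noteq> \<zero>\<^bsub>A\<^esub>}. c e) = (\<Oplus>\<^bsub>A\<^esub>e\<in>E. c e)"
    by (rule add.finprod_mono_neutral_cong_left) (use assms cl in auto)
  then show ?thesis
    using assms by (auto simp: decomposes_def intro: finite_subset)
qed

lemma decomposes_unique:
  assumes "decomposes A c x" "decomposes A c' x"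
  shows "c = c'"
proof -
  have "x \<in> carrier A"
    using assms(1) decomposesD[OF assms(1)] by (auto simp: decomposes_def)
  then show ?thesis
    using direct_sum[of x] assms unfolding decomposes_def by blast
qed

lemma components: "x \<in> carrier A \<Longrightarrow> decomposes A (components A x) x"
  unfolding components_def
  using theI'[OF direct_sum[of x]] unfolding decomposes_def .

lemma components_eq: "decomposes A c x \<Longrightarrow> components A x = c"
  unfolding components_def using decomposes_unique by blast

lemma twist_eq:
  assumes "decomposes A c x" "finite E" "{e. c e \<noteq> \<zero>\<^bsub>A\<^esub>} \<subseteq> E"
  shows "twist A \<alpha> \<beta> x = (\<Oplus>\<^bsub>A\<^esub>e\<in>E. sg A (\<alpha> * int (fst e) + \<beta> * snd e) (c e))"
  unfolding twist_def components_eq[OF assms(1)]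
  using decomposesD[OF assms(1)] by (intro decomposes_finsum[OF assms]) auto

lemma klin_sg: "klin K A A (sg A n)"
proof (cases "even n")
  case True
  then show ?thesis
    by unfold_locales (auto simp: sg_eq)
next
  case False
  then show ?thesis
    by unfold_locales (auto simp: sg_eq minus_add smult_r_minus)
qed

lemma klin_twist: "klin K A A (twist A \<alpha> \<beta>)"
proof unfold_locales
  fix x
  assume x: "x \<in> carrier A"
  note c = components[OF x]
  interpret sg: klin K A A "sg A n" for n
    by (rule klin_sg)
  show "twist A \<alpha> \<beta> x \<in> carrier A"
    unfolding twist_def using decomposesD[OF c] by (intro finsum_closed) auto
  {
    fix y
    assume y: "y \<in> carrier A"
    note c' = components[OF y]
    let ?c'' = "\<lambda>e. components A x e \<oplus>\<^bsub>A\<^esub> components A y e"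
    define E where "E = {e. components A x e \<noteq> \<zero>\<^bsub>A\<^esub>} \<union> {e. components A y e \<noteq> \<zero>\<^bsub>A\<^esub>}"
    have E: "finite E" "{e. components A x e \<noteq> \<zero>\<^bsub>A\<^esub>} \<subseteq> E" "{e. components A y e \<noteq> \<zero>\<^bsub>A\<^esub>} \<subseteq> E"
      using decomposesD[OF c] decomposesD[OF c'] by (auto simp: E_def)
    then have E'': "{e. ?c'' e \<noteq> \<zero>\<^bsub>A\<^esub>} \<subseteq> E"
      by (auto simp: E_def)
    have eq: "x = finsum A (components A x) E" "y = finsum A (components A y) E"
      using c c' decomposesD[OF c] decomposesD[OF c'] E
      by (subst decomposes_iff[symmetric]; auto simp: decomposes_def)+
    have "decomposes A ?c'' (x \<oplus>\<^bsub>A\<^esub> y)"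
    proof (subst decomposes_iff[OF _ E(1) E''])
      show "?c'' (i, j) \<in> grade A i j" for i j
        using c c' by (auto simp: decomposes_def intro: grade_add)
      show "x \<oplus>\<^bsub>A\<^esub> y = finsum A ?c'' E"
        using decomposesD[OF c] decomposesD[OF c']
        by (subst finsum_addf) (auto simp flip: eq)
    qed
    from twist_eq[OF this E(1) E'']
    show "twist A \<alpha> \<beta> (x \<oplus>\<^bsub>A\<^esub> y) = twist A \<alpha> \<beta> x \<oplus>\<^bsub>A\<^esub> twist A \<alpha> \<beta> y"
      using decomposesD[OF c] decomposesD[OF c']
      by (simp add: twist_eq[OF c E(1,2)] twist_eq[OF c' E(1,3)] sg.add)
  next
    fix a
    assume a: "a \<in> carrier K"
    let ?c' = "\<lambda>e. a \<odot>\<^bsub>A\<^esub> components A x e"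
    define E where "E = {e. components A x e \<noteq> \<zero>\<^bsub>A\<^esub>}"
    have E: "finite E" "{e. components A x e \<noteq> \<zero>\<^bsub>A\<^esub>} \<subseteq> E"
      using decomposesD[OF c] by (auto simp: E_def)
    have E': "{e. ?c' e \<noteq> \<zero>\<^bsub>A\<^esub>} \<subseteq> E"
      using a by (auto simp: E_def)
    have eq: "x = finsum A (components A x) E"
      using c by (auto simp: decomposes_def E_def)
    have "decomposes A ?c' (a \<odot>\<^bsub>A\<^esub> x)"
    proof (subst decomposes_iff[OF _ E(1) E'])
      show "?c' (i, j) \<in> grade A i j" for i j
        using c a by (auto simp: decomposes_def intro: grade_smult)
      show "a \<odot>\<^bsub>A\<^esub> x = finsum A ?c' E"
        using decomposesD[OF c] a E
        by (subst finsum_smult_ldistr[symmetric]) (auto simp flip: eq)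
    qed
    from twist_eq[OF this E(1) E']
    show "twist A \<alpha> \<beta> (a \<odot>\<^bsub>A\<^esub> x) = a \<odot>\<^bsub>A\<^esub> twist A \<alpha> \<beta> x"
      using decomposesD[OF c] a E(1)
      by (simp add: twist_eq[OF c E(1,2)] sg.smult finsum_smult_ldistr)
  }
qed

lemma twist_closed [simp]: "x \<in> carrier A \<Longrightarrow> twist A \<alpha> \<beta> x \<in> carrier A"
  by (rule klin.closed[OF klin_twist])

lemma twist_grade:
  assumes x: "x \<in> grade A i j"
  shows "twist A \<alpha> \<beta> x = sg A (\<alpha> * int i + \<beta> * j) x"
proof -
  let ?c = "\<lambda>e. if e = (i, j) then x else \<zero>\<^bsub>A\<^esub>"
  have E: "finite {(i, j)}" "{e. ?c e \<noteq> \<zero>\<^bsub>A\<^esub>} \<subseteq> {(i, j)}"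
    by auto
  have "decomposes A ?c x"
    using x grade_closed[OF x] by (subst decomposes_iff[OF _ E]) auto
  from twist_eq[OF this E] show ?thesis
    using grade_closed[OF x] by simp
qed

lemma twist_gradez: "x \<in> gradez A i j \<Longrightarrow> twist A \<alpha> \<beta> x = sg A (\<alpha> * i + \<beta> * j) x"
  using twist_grade[of x "nat i" j] klin.zero[OF klin_twist]
  by (auto simp: gradez_def split: if_splits)

text \<open>Every element is the sum of its components. This is the passage from relations stated on
  homogeneous elements to identities of operators.\<close>

lemma graded_ext:
  assumes "klin K A B f" "klin K A B g" "x \<in> carrier A"
    and "\<And>i j y. y \<in> grade A i j \<Longrightarrow> f y = g y"
  shows "f x = g x"
proof -
  interpret f: klin K A B f by fact
  interpret g: klin K A B g by fact
  note c = components[OF assms(3)]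
  define E where "E = {e. components A x e \<noteq> \<zero>\<^bsub>A\<^esub>}"
  have x: "x = finsum A (components A x) E"
    using c by (auto simp: decomposes_def E_def)
  have "f x = (\<Oplus>\<^bsub>B\<^esub>e\<in>E. f (components A x e))"
    by (subst x, rule f.finsum) (rule decomposesD[OF c])
  also have "\<dots> = (\<Oplus>\<^bsub>B\<^esub>e\<in>E. g (components A x e))"
    using decomposesD[OF c] by (intro f.B.finsum_cong') (auto intro: assms(4))
  also have "\<dots> = g x"
    by (subst (2) x, rule g.finsum[symmetric]) (rule decomposesD[OF c])
  finally show ?thesis .
qed

lemma twist_twist: "x \<in> carrier A \<Longrightarrow> twist A \<alpha> \<beta> (twist A \<gamma> \<delta> x) = twist A (\<alpha> + \<gamma>) (\<beta> + \<delta>) x"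
  by (rule graded_ext[OF klin_comp[OF klin_twist klin_twist] klin_twist])
    (auto simp: twist_grade klin.sg[OF klin_twist] grade_closed sg_sg algebra_simps intro!: sg_cong)

lemma twist_cong:
  "x \<in> carrier A \<Longrightarrow> even (\<alpha> - \<gamma>) \<Longrightarrow> even (\<beta> - \<delta>) \<Longrightarrow> twist A \<alpha> \<beta> x = twist A \<gamma> \<delta> x"
  by (rule graded_ext[OF klin_twist klin_twist]) (auto simp: twist_grade grade_closed intro!: sg_cong)

lemma twist_even: "x \<in> carrier A \<Longrightarrow> even \<alpha> \<Longrightarrow> even \<beta> \<Longrightarrow> twist A \<alpha> \<beta> x = x"
  by (rule graded_ext[OF klin_twist, where g = "\<lambda>x. x"])
    (auto simp: twist_grade grade_closed sg_eq intro: klin.intro, unfold_locales, auto)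

end

section \<open>Homogeneous tuples and graded linear maps\<close>

lemma homogeneous_Nil [simp]: "homogeneous A ds [] \<longleftrightarrow> ds = []"
  and homogeneous_Cons: "homogeneous A ds (x # xs) \<longleftrightarrow>
    (\<exists>i j es. ds = (i, j) # es \<and> x \<in> grade A i j \<and> homogeneous A es xs)"
  by (auto simp: homogeneous_def list_all2_Cons2)

lemma homogeneous_length: "homogeneous A ds xs \<Longrightarrow> length ds = length xs"
  by (auto simp: homogeneous_def list_all2_lengthD)

lemma homogeneous_take: "homogeneous A ds xs \<Longrightarrow> homogeneous A (take n ds) (take n xs)"
  and homogeneous_drop: "homogeneous A ds xs \<Longrightarrow> homogeneous A (drop n ds) (drop n xs)"
  by (auto simp: homogeneous_def)

lemma (in bigraded_module) homogeneous_closed: "homogeneous A ds xs \<Longrightarrow> set xs \<subseteq> carrier A"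
  by (induction xs arbitrary: ds) (auto simp: homogeneous_Cons grade_closed)

lemma hdeg_simps [simp]: "hdeg [] = 0" "hdeg (e # ds) = int (fst e) + hdeg ds"
    "hdeg (ds @ es) = hdeg ds + hdeg es"
  and vdeg_simps [simp]: "vdeg [] = 0" "vdeg (e # ds) = snd e + vdeg ds"
    "vdeg (ds @ es) = vdeg ds + vdeg es"
  by (auto simp: hdeg_def vdeg_def)

lemma multilinear_iff:
  assumes "module K A" "module K B"
  shows "multilinear K A B n p q f \<longleftrightarrow> mlin K A B n f \<and>
    (\<forall>ds xs. length xs = n \<and> homogeneous A ds xs \<longrightarrow> f xs \<in> gradez B (hdeg ds - p) (vdeg ds + q))"
proof -
  interpret A: module K A by fact
  interpret B: module K B by fact
  have upd: "xs[k := v] \<in> tuples A n" if "xs \<in> tuples A n" "v \<in> carrier A" for xs k v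
    using that set_update_subset_insert[of xs k v] by (auto simp: tuples_def)
  show ?thesis
    unfolding multilinear_def mlin_def
    using upd
    by (auto simp: klin_def klin_axioms_def assms tuples_def)
qed

locale graded_klin = A: bigraded_module K A + B: bigraded_module K B + klin K A B f
  for K :: "('k, 'r) ring_scheme" and A :: "('k, 'a) bigraded" and B :: "('k, 'b) bigraded"
    and f :: "'a \<Rightarrow> 'b" +
  fixes p q :: int
  assumes graded: "x \<in> grade A i j \<Longrightarrow> f x \<in> gradez B (int i - p) (j + q)"
begin

lemma gradedz: "x \<in> gradez A i j \<Longrightarrow> f x \<in> gradez B (i - p) (j + q)"
  using graded[of x "nat i" j] by (auto simp: gradez_def[of A] split: if_splits)

text \<open>On a homogeneous element both sides are signs for bidegrees that differ by the bidegree
  of \<open>f\<close>. Lowering the horizontal degree by \<open>p\<close> changes its parity in the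
  same way as raising it.\<close>

lemma twist_commute:
  "x \<in> carrier A \<Longrightarrow> twist B \<alpha> \<beta> (f x) = sg B (\<alpha> * p + \<beta> * q) (f (twist A \<alpha> \<beta> x))"
proof (rule A.graded_ext[where f = "\<lambda>x. twist B \<alpha> \<beta> (f x)"])
  fix i j x
  assume x: "x \<in> grade A i j"
  show "twist B \<alpha> \<beta> (f x) = sg B (\<alpha> * p + \<beta> * q) (f (twist A \<alpha> \<beta> x))"
    using x graded[OF x] A.grade_closed[OF x]
    by (auto simp: B.twist_gradez A.twist_grade sg B.sg_sg algebra_simps intro!: B.sg_cong)
qed (auto intro!: klin_comp[OF klin_axioms B.klin_twist]
      klin_comp[OF klin_comp[OF A.klin_twist klin_axioms] B.klin_sg])

end

lemma graded_klinI:
  assumes "bigraded_module K A" "bigraded_module K B" "multilinear K A B 1 p q f"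
  shows "graded_klin K A B (\<lambda>x. f [x]) p q"
proof -
  interpret A: bigraded_module K A by fact
  interpret B: bigraded_module K B by fact
  have mlin: "mlin K A B 1 f"
    and deg: "\<And>ds xs. length xs = 1 \<Longrightarrow> homogeneous A ds xs \<Longrightarrow>
      f xs \<in> gradez B (hdeg ds - p) (vdeg ds + q)"
    using assms(3) by (auto simp: multilinear_iff[OF A.module_axioms B.module_axioms])
  have "klin K A B (\<lambda>x. f [x])"
    using mlin_update[OF mlin, of "[\<zero>\<^bsub>A\<^esub>]" 0] by simp
  moreover have "f [x] \<in> gradez B (int i - p) (j + q)" if "x \<in> grade A i j" for i j x
    using deg[of "[x]" "[(i, j)]"] that by (auto simp: homogeneous_Cons)
  ultimately show ?thesis
    using assms by (auto simp: graded_klin_def graded_klin_axioms_def)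
qed

section \<open>Signs on homogeneous tuples\<close>

text \<open>A relation and not a function, since the exponent \<open>k\<close> cannot be recovered
  from the entries: a zero entry equals its negative.\<close>

inductive signed :: "('a, 'c) ring_scheme \<Rightarrow> int \<Rightarrow> 'a list \<Rightarrow> 'a list \<Rightarrow> bool"
  for A where
  signed_Nil: "signed A 0 [] []"
| signed_Cons: "signed A n ys xs \<Longrightarrow> signed A (k + n) (sg A k x # ys) (x # xs)"

lemma signed_append: "signed A k ys xs \<Longrightarrow> signed A n vs us \<Longrightarrow> signed A (k + n) (ys @ vs) (xs @ us)"
  by (induction rule: signed.induct) (auto simp: add.assoc intro: signed.intros)

text \<open>The prefix \<open>us\<close> collects the slots already treated, so that linearity is
  used in one slot at a time.\<close>

lemma mlin_signed_append:
  assumes "signed H k ys xs" "mlin K H A n f" "length us + length xs = n" "set us \<subseteq> carrier H"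
    "set xs \<subseteq> carrier H" "module K H" "module K A"
  shows "f (us @ ys) = sg A k (f (us @ xs))"
  using assms(1,3-5)
proof (induction arbitrary: us rule: signed.induct)
  case signed_Nil
  interpret A: module K A by fact
  show ?case
    using mlin_closed[OF assms(2)] signed_Nil by (auto simp: A.sg_eq)
next
  case (signed_Cons k ys xs l x)
  interpret A: module K A by fact
  interpret H: module K H by fact
  have cl: "f (us @ x # xs) \<in> carrier A"
    using mlin_closed[OF assms(2)] signed_Cons.prems by auto
  have ys: "set (sg H l x # ys) \<subseteq> carrier H" if "set (x # xs) \<subseteq> carrier H"
    using signed_Cons.hyps that by (induction rule: signed.induct) auto
  have "f (us @ sg H l x # ys) = f ((us @ [sg H l x]) @ ys)"
    by simp
  also have "\<dots> = sg A k (f ((us @ [sg H l x]) @ xs))"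
    using signed_Cons.prems by (intro signed_Cons.IH) auto
  also have "f ((us @ [sg H l x]) @ xs) = sg A l (f (us @ x # xs))"
    using klin.sg[OF mlin_slot[OF assms(2) _ _ _ assms(6), of us xs], of x l] signed_Cons.prems
    by simp
  finally show ?case
    using cl by (simp add: A.sg_sg add.commute)
qed

lemma mlin_signed:
  assumes "signed H k ys xs" "mlin K H A (length xs) f" "set xs \<subseteq> carrier H" "module K H" "module K A"
  shows "f ys = sg A k (f xs)"
  using mlin_signed_append[OF assms(1,2), of "[]"] assms(3-5) by simp

text \<open>\<open>wsum\<close> is the exponent of the sign relating an operation on \<open>A\<close> to the corresponding
  operation on the vertical suspension of \<open>A\<close>, in which the structure relations become sign-free.\<close>

primrec wsum :: "(nat \<times> int) list \<Rightarrow> int" where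
  "wsum [] = 0"
| "wsum (e # ds) = int (length ds) * snd e + wsum ds"

lemma wsum_append: "wsum (ds @ es) = wsum ds + int (length es) * vdeg ds + wsum es"
  by (induction ds) (auto simp: algebra_simps)

text \<open>The linear counterpart of the exponent \<open>i * (hdeg ds + vdeg ds) + wsum ds\<close>,
  see \<open>signed_twists\<close>: the summand \<open>length xs\<close> counts the entries further
  right, as in \<open>wsum\<close>. It makes the desuspended operations multilinear on all
  tuples.\<close>

primrec twists :: "('k, 'a) bigraded \<Rightarrow> nat \<Rightarrow> 'a list \<Rightarrow> 'a list" where
  "twists A i [] = []"
| "twists A i (x # xs) = twist A (int i) (int (i + length xs)) x # twists A i xs"

lemma length_twists [simp]: "length (twists A i xs) = length xs"
  by (induction xs) auto

lemma twists_update: "k < length xs \<Longrightarrow>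
  twists A i (xs[k := v]) = (twists A i xs)[k := twist A (int i) (int (i + (length xs - k - 1))) v]"
  by (induction xs arbitrary: k) (auto split: nat.split)

context bigraded_module
begin

lemma twists_closed: "set xs \<subseteq> carrier A \<Longrightarrow> set (twists A i xs) \<subseteq> carrier A"
  by (induction xs) auto

lemma mlin_twists:
  assumes "mlin K A B n f"
  shows "mlin K A B n (\<lambda>xs. f (twists A i xs))"
  unfolding mlin_def
proof (intro conjI allI impI; elim conjE)
  fix xs
  assume xs: "length xs = n" "set xs \<subseteq> carrier A"
  then show "f (twists A i xs) \<in> carrier B"
    by (intro mlin_closed[OF assms] twists_closed) auto
  fix k
  assume "k < n"
  then show "klin K A B (\<lambda>v. f (twists A i (xs[k := v])))"
    using xs
    by (auto simp: twists_update intro!: klin_comp[OF klin_twist] mlin_update[OF assms] twists_closed)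
qed

lemma signed_map:
  assumes "homogeneous A ds xs" "\<And>x i j. x \<in> grade A i j \<Longrightarrow> f x = sg A (a * int i + b * j + c) x"
  shows "signed A (a * hdeg ds + b * vdeg ds + c * int (length ds)) (map f xs) xs"
  using assms(1)
proof (induction xs arbitrary: ds)
  case (Cons x xs)
  then obtain i j es where ds: "ds = (i, j) # es" "x \<in> grade A i j" "homogeneous A es xs"
    by (auto simp: homogeneous_Cons)
  have "signed A ((a * int i + b * j + c) + (a * hdeg es + b * vdeg es + c * int (length es)))
      (f x # map f xs) (x # xs)"
    using Cons.IH[OF ds(3)] assms(2)[OF ds(2)] by (auto intro: signed_Cons)
  then show ?case
    by (simp add: ds algebra_simps)
qed (auto intro: signed_Nil)

lemma signed_twists:
  "homogeneous A ds xs \<Longrightarrow> signed A (int i * hdeg ds + int i * vdeg ds + wsum ds) (twists A i xs) xs"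
proof (induction xs arbitrary: ds)
  case (Cons x xs)
  then obtain p q es where ds: "ds = (p, q) # es" "x \<in> grade A p q" "homogeneous A es xs"
    by (auto simp: homogeneous_Cons)
  have "signed A ((int i * int p + int (i + length xs) * q) + (int i * hdeg es + int i * vdeg es + wsum es))
      (twists A i (x # xs)) (x # xs)"
    using Cons.IH[OF ds(3)] ds(2) by (auto simp: twist_grade intro: signed_Cons)
  then show ?case
    using homogeneous_length[OF ds(3)] by (simp add: ds algebra_simps)
qed (auto intro: signed_Nil)

text \<open>The value \<open>y\<close> of an inserted operation may fall into a negative horizontal
  degree, which \<open>homogeneous\<close> cannot express, so its bidegree is kept apart as a pair
  of integers. The term with \<open>Suc (length zs)\<close> accounts for the entries to the right of
  the prefix.\<close>

lemma signed_twists_slot: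
  assumes "homogeneous A ds xs" "homogeneous A es zs" "y \<in> gradez A p q"
  shows "signed A (int i * hdeg ds + int i * vdeg ds + wsum ds + int (Suc (length zs)) * vdeg ds +
      (int i * p + int (i + length zs) * q) + (int i * hdeg es + int i * vdeg es + wsum es))
    (twists A i (xs @ y # zs)) (xs @ y # zs)"
  using assms(1)
proof (induction xs arbitrary: ds)
  case Nil
  then show ?case
    using signed_Cons[OF signed_twists[OF assms(2), of i]] by (auto simp: twist_gradez[OF assms(3)])
next
  case (Cons x xs)
  then obtain k l fs where ds: "ds = (k, l) # fs" "x \<in> grade A k l" "homogeneous A fs xs"
    by (auto simp: homogeneous_Cons)
  have "signed A ((int i * int k + int (i + length (xs @ y # zs)) * l) + (int i * hdeg fs + int i * vdeg fs +
        wsum fs + int (Suc (length zs)) * vdeg fs +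
        (int i * p + int (i + length zs) * q) + (int i * hdeg es + int i * vdeg es + wsum es)))
      (twists A i ((x # xs) @ y # zs)) ((x # xs) @ y # zs)"
    using Cons.IH[OF ds(3)] ds(2) by (auto simp: twist_grade intro: signed_Cons)
  then show ?case
    using homogeneous_length[OF ds(3)] by (simp add: ds algebra_simps)
qed

end

section \<open>Bidgas\<close>

context derived_Ainf
begin

lemma mlin_m: "1 \<le> j \<Longrightarrow> mlin K A A j (m i j)"
  using m_multilinear multilinear_iff[OF module_axioms module_axioms] by blast

lemma insert_op_closed:
  assumes "set xs \<subseteq> carrier A" "r + q \<le> length xs" "1 \<le> q" "j = length xs + 1 - q"
  shows "insert_op A m i j p q r ds xs \<in> carrier A"
proof -
  have sub: "set (take q (drop r xs)) \<subseteq> carrier A" "set (take r xs) \<subseteq> carrier A"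
    "set (drop (r + q) xs) \<subseteq> carrier A"
    using assms(1) by (auto dest: in_set_takeD in_set_dropD)
  then have "m p q (take q (drop r xs)) \<in> carrier A"
    using assms by (intro mlin_closed[OF mlin_m]) auto
  then show ?thesis
    unfolding insert_op_def using assms sub
    by (auto simp: koszul_def intro!: sg_closed mlin_closed[OF mlin_m])
qed

end

text \<open>The equations determine \<open>i\<close>, \<open>j\<close> and \<open>t\<close> from
  \<open>r\<close>, \<open>q\<close> and \<open>p\<close>; what remains of them is membership in
  \<open>positions\<close>.\<close>

lemma (in abelian_group) index_set_reindex:
  fixes f :: "nat \<Rightarrow> nat \<Rightarrow> nat \<Rightarrow> nat \<Rightarrow> nat \<Rightarrow> nat \<Rightarrow> 'a"
  assumes "\<And>r q p. 1 \<le> q \<Longrightarrow> r + q \<le> v \<Longrightarrow> p \<le> u \<Longrightarrow> f (u - p) (v + 1 - q) p q r (v - r - q) \<in> carrier G"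
  shows "(\<Oplus>e \<in> {(i, j, p, q, r, t). u = i + p \<and> v + 1 = j + q \<and> j = 1 + r + t \<and> 1 \<le> q}.
      case e of (i, j, p, q, r, t) \<Rightarrow> f i j p q r t) =
    finsum G (\<lambda>(r, q, p). f (u - p) (v + 1 - q) p q r (v - r - q)) (positions v u)"
proof (rule finsum_reindex_bij_witness[where j = "\<lambda>(i, j, p, q, r, t). (r, q, p)" and
      i = "\<lambda>(r, q, p). (u - p, v + 1 - q, p, q, r, v - r - q)"])
  fix x
  assume "x \<in> {(i, j, p, q, r, t). u = i + p \<and> v + 1 = j + q \<and> j = 1 + r + t \<and> 1 \<le> q}"
  then obtain i j p q r t where x: "x = (i, j, p, q, r, t)"
    and eqs: "u = i + p" "v + 1 = j + q" "j = 1 + r + t"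
    by auto
  have "u - p = i" "v + 1 - q = j" "v - r - q = t"
    using eqs by auto
  then show "(\<lambda>(r, q, p). (u - p, v + 1 - q, p, q, r, v - r - q)) ((\<lambda>(i, j, p, q, r, t). (r, q, p)) x) = x"
    and "(\<lambda>(r, q, p). f (u - p) (v + 1 - q) p q r (v - r - q)) ((\<lambda>(i, j, p, q, r, t). (r, q, p)) x) =
      (case x of (i, j, p, q, r, t) \<Rightarrow> f i j p q r t)"
    by (simp_all add: x)
qed (use assms in auto)

lemma (in abelian_group) neg_add_eq_zero_iff:
  "x \<in> carrier G \<Longrightarrow> y \<in> carrier G \<Longrightarrow> \<ominus> x \<oplus> y = \<zero> \<longleftrightarrow> x = y"
  by (metis a_inv_closed minus_minus neg_eq_iff)

lemma (in derived_Ainf) m_relation_positions: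
  assumes "1 \<le> length xs" "homogeneous A ds xs"
  shows "finsum A (\<lambda>(r, q, p). sg A (int (r * q + (length xs - r - q) + p * (length xs + 1 - q)))
      (insert_op A m (u - p) (length xs + 1 - q) p q r ds xs)) (positions (length xs) u) = \<zero>\<^bsub>A\<^esub>"
  using m_relation[OF assms(1) refl assms(2), of u] homogeneous_closed[OF assms(2)]
  by (subst (asm) index_set_reindex) (auto intro!: insert_op_closed sg_closed)

section \<open>Operators of a bidga and their identities on all elements\<close>

context bidga
begin

abbreviation "dv \<equiv> \<lambda>x. m 0 1 [x]"
abbreviation "dh \<equiv> \<lambda>x. m 1 1 [x]"
abbreviation "mul \<equiv> \<lambda>x y. m 0 2 [x, y]"

lemma graded_klin_dv: "graded_klin K A A dv 0 1"
  and graded_klin_dh: "graded_klin K A A dh 1 0"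
  using m_multilinear[of 1 0] m_multilinear[of 1 1]
  by (auto intro!: graded_klinI bigraded_module_axioms)

sublocale dv: graded_klin K A A dv 0 1
  by (rule graded_klin_dv)

sublocale dh: graded_klin K A A dh 1 0
  by (rule graded_klin_dh)

lemmas unary_simps = dv.closed[unfolded One_nat_def] dh.closed[unfolded One_nat_def]
  dv.zero[unfolded One_nat_def] dh.zero[unfolded One_nat_def]

lemma mul_left: "y \<in> carrier A \<Longrightarrow> klin K A A (\<lambda>x. mul x y)"
  using mlin_slot[OF mlin_m[of 2 0], of "[]" "[y]"] module_axioms by simp

lemma mul_right: "x \<in> carrier A \<Longrightarrow> klin K A A (mul x)"
  using mlin_slot[OF mlin_m[of 2 0], of "[x]" "[]"] module_axioms by simp

lemma mul_closed [simp]: "x \<in> carrier A \<Longrightarrow> y \<in> carrier A \<Longrightarrow> mul x y \<in> carrier A"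
  using klin.closed[OF mul_right] .

lemma mul_gradez:
  assumes "x \<in> gradez A i j" "y \<in> gradez A k l"
  shows "mul x y \<in> gradez A (i + k) (j + l)"
proof (cases "i < 0 \<or> k < 0")
  case True
  then have "x = \<zero>\<^bsub>A\<^esub> \<or> y = \<zero>\<^bsub>A\<^esub>"
    using assms by (auto simp: gradez_def)
  then show ?thesis
    using assms klin.zero[OF mul_left] klin.zero[OF mul_right] by (auto simp: gradez_closed)
next
  case False
  then have "homogeneous A [(nat i, j), (nat k, l)] [x, y]"
    using assms by (auto simp: homogeneous_def gradez_def)
  moreover have "multilinear K A A 2 0 0 (m 0 2)"
    using m_multilinear[of 2 0] by simp
  ultimately have "mul x y \<in> gradez A (hdeg [(nat i, j), (nat k, l)] - 0) (vdeg [(nat i, j), (nat k, l)] + 0)"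
    unfolding multilinear_def by (metis length_Cons list.size(3) numeral_2_eq_2)
  then show ?thesis
    using False by simp
qed

lemma mul_sg:
  "x \<in> carrier A \<Longrightarrow> y \<in> carrier A \<Longrightarrow> mul (sg A n x) y = sg A n (mul x y)"
  "x \<in> carrier A \<Longrightarrow> y \<in> carrier A \<Longrightarrow> mul x (sg A n y) = sg A n (mul x y)"
  using klin.sg[OF mul_left] klin.sg[OF mul_right] by auto

lemma mul_neg:
  "x \<in> carrier A \<Longrightarrow> y \<in> carrier A \<Longrightarrow> mul (\<ominus>\<^bsub>A\<^esub> x) y = \<ominus>\<^bsub>A\<^esub> mul x y"
  "x \<in> carrier A \<Longrightarrow> y \<in> carrier A \<Longrightarrow> mul x (\<ominus>\<^bsub>A\<^esub> y) = \<ominus>\<^bsub>A\<^esub> mul x y"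
  using klin.neg[OF mul_left] klin.neg[OF mul_right] by auto

lemma graded_ext2:
  assumes "\<And>y. y \<in> carrier A \<Longrightarrow> klin K A A (\<lambda>x. f x y)" "\<And>x. x \<in> carrier A \<Longrightarrow> klin K A A (f x)"
    and "\<And>y. y \<in> carrier A \<Longrightarrow> klin K A A (\<lambda>x. g x y)" "\<And>x. x \<in> carrier A \<Longrightarrow> klin K A A (g x)"
    and "\<And>i j k l x y. x \<in> grade A i j \<Longrightarrow> y \<in> grade A k l \<Longrightarrow> f x y = g x y"
    and "x \<in> carrier A" "y \<in> carrier A"
  shows "f x y = g x y"
proof (rule graded_ext[where f = "\<lambda>x. f x y" and B = A])
  fix i j x
  assume x: "x \<in> grade A i j"
  show "f x y = g x y"
    by (rule graded_ext[where f = "f x" and B = A]) (use assms x grade_closed in auto)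
qed (use assms in auto)

lemma twist_mul:
  "x \<in> carrier A \<Longrightarrow> y \<in> carrier A \<Longrightarrow>
    twist A \<alpha> \<beta> (mul x y) = mul (twist A \<alpha> \<beta> x) (twist A \<alpha> \<beta> y)"
proof (rule graded_ext2[where f = "\<lambda>x y. twist A \<alpha> \<beta> (mul x y)"
      and g = "\<lambda>x y. mul (twist A \<alpha> \<beta> x) (twist A \<alpha> \<beta> y)"])
  fix i j k l x y
  assume "x \<in> grade A i j" "y \<in> grade A k l"
  then show "twist A \<alpha> \<beta> (mul x y) = mul (twist A \<alpha> \<beta> x) (twist A \<alpha> \<beta> y)"
    using mul_gradez[of x "int i" j y "int k" l]
    by (auto simp: twist_gradez twist_grade mul_sg grade_closed sg_sg algebra_simps intro!: sg_cong)
qed (auto intro!: klin_comp[OF mul_left klin_twist] klin_comp[OF mul_right klin_twist]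
      klin_comp[OF klin_twist mul_left] klin_comp[OF klin_twist mul_right])

text \<open>The structure relations for one input with \<open>u = 1\<close> and
  \<open>u = 2\<close>; terms with \<open>m 2 1\<close> vanish by \<open>higher_zero\<close>. In
  this sign convention the two differentials commute.\<close>

lemma
  assumes "x \<in> carrier A"
  shows dv_dh: "dv (dh x) = dh (dv x)" and dh_dh: "dh (dh x) = \<zero>\<^bsub>A\<^esub>"
proof -
  have zero: "m 2 (Suc 0) [y] = \<zero>\<^bsub>A\<^esub>" if "y \<in> carrier A" for y
    using higher_zero[of "Suc 0" 2 "[y]"] that by (simp add: tuples_def)
  show "dv (dh x) = dh (dv x)"
  proof (rule graded_ext[OF klin_comp[OF dh.klin_axioms dv.klin_axioms]
        klin_comp[OF dv.klin_axioms dh.klin_axioms] assms])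
    fix i j y
    assume y: "y \<in> grade A i j"
    then have "dh (dv y) \<oplus>\<^bsub>A\<^esub> \<ominus>\<^bsub>A\<^esub> dv (dh y) = \<zero>\<^bsub>A\<^esub>"
      using m_relation_positions[of "[y]" "[(i, j)]" 1] grade_closed[OF y]
       by (simp add: positions_list upt_rec numeral_2_eq_2[symmetric] homogeneous_Cons insert_op_def koszul_def sg_eq unary_simps Pi_iff)
    then show "dv (dh y) = dh (dv y)"
      using grade_closed[OF y] by (simp add: neg_eq_iff unary_simps)
  qed
  show "dh (dh x) = \<zero>\<^bsub>A\<^esub>"
  proof (rule graded_ext[OF klin_comp[OF dh.klin_axioms dh.klin_axioms]
        klin_zero[OF module_axioms module_axioms] assms])
    fix i j y
    assume y: "y \<in> grade A i j"
    have "\<ominus>\<^bsub>A\<^esub> dh (dh y) = \<zero>\<^bsub>A\<^esub>"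
      using m_relation_positions[of "[y]" "[(i, j)]" 2] grade_closed[OF y] y
      by (simp add: positions_list upt_rec numeral_2_eq_2[symmetric] homogeneous_Cons insert_op_def koszul_def sg_eq unary_simps Pi_iff zero)
    then show "dh (dh y) = \<zero>\<^bsub>A\<^esub>"
      using grade_closed[OF y] by (metis dh.closed minus_minus neg_zero)
  qed
qed

text \<open>The structure relations for two inputs with \<open>u = 0\<close> and
  \<open>u = 1\<close>; \<open>m 1 2\<close> vanishes by \<open>higher_zero\<close>. The Koszul sign
  at the first input becomes \<open>twist\<close>, which makes both sides linear in it, so the
  identities extend from homogeneous pairs.\<close>

lemma
  assumes "x \<in> carrier A" "y \<in> carrier A"
  shows dv_mul: "dv (mul x y) = mul (dv x) y \<oplus>\<^bsub>A\<^esub> mul (twist A 0 1 x) (dv y)"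
    and dh_mul: "dh (mul x y) = mul (dh x) y \<oplus>\<^bsub>A\<^esub> mul (twist A 1 0 x) (dh y)"
proof -
  have zero: "m (Suc 0) 2 [y, z] = \<zero>\<^bsub>A\<^esub>" if "y \<in> carrier A" "z \<in> carrier A" for y z
    using higher_zero[of 2 "Suc 0" "[y, z]"] that by (simp add: tuples_def)
  show "dv (mul x y) = mul (dv x) y \<oplus>\<^bsub>A\<^esub> mul (twist A 0 1 x) (dv y)"
  proof (rule graded_ext2[where f = "\<lambda>x y. dv (mul x y)" and
        g = "\<lambda>x y. mul (dv x) y \<oplus>\<^bsub>A\<^esub> mul (twist A 0 1 x) (dv y)", OF _ _ _ _ _ assms])
    fix i j k l x y
    assume xy: "x \<in> grade A i j" "y \<in> grade A k l"
    note cl = xy[THEN grade_closed]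
    have "dv (mul x y) \<oplus>\<^bsub>A\<^esub> \<ominus>\<^bsub>A\<^esub> (mul (dv x) y \<oplus>\<^bsub>A\<^esub> sg A j (mul x (dv y))) = \<zero>\<^bsub>A\<^esub>"
      using m_relation_positions[of "[x, y]" "[(i, j), (k, l)]" 0] cl xy

      by (cases "even j") (simp_all add: positions_list upt_rec numeral_2_eq_2[symmetric] homogeneous_Cons insert_op_def koszul_def sg_eq unary_simps Pi_iff minus_add a_ac)
    then show "dv (mul x y) = mul (dv x) y \<oplus>\<^bsub>A\<^esub> mul (twist A 0 1 x) (dv y)"
      using cl xy by (simp add: neg_eq_iff twist_grade mul_sg unary_simps)
  qed (auto simp del: One_nat_def intro!: klin_plus klin_comp[OF mul_left dv.klin_axioms] klin_comp[OF mul_right dv.klin_axioms]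
        klin_comp[OF dv.klin_axioms mul_left] klin_comp[OF dv.klin_axioms mul_right] mul_left mul_right
        klin_comp[OF klin_twist mul_left])
  show "dh (mul x y) = mul (dh x) y \<oplus>\<^bsub>A\<^esub> mul (twist A 1 0 x) (dh y)"
  proof (rule graded_ext2[where f = "\<lambda>x y. dh (mul x y)" and
        g = "\<lambda>x y. mul (dh x) y \<oplus>\<^bsub>A\<^esub> mul (twist A 1 0 x) (dh y)", OF _ _ _ _ _ assms])
    fix i j k l x y
    assume xy: "x \<in> grade A i j" "y \<in> grade A k l"
    note cl = xy[THEN grade_closed]
    have "dh (mul x y) \<oplus>\<^bsub>A\<^esub> \<ominus>\<^bsub>A\<^esub> (mul (dh x) y \<oplus>\<^bsub>A\<^esub> sg A (int i) (mul x (dh y))) = \<zero>\<^bsub>A\<^esub>"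
      using m_relation_positions[of "[x, y]" "[(i, j), (k, l)]" 1] cl xy

      by (cases "even i") (simp_all add: positions_list upt_rec numeral_2_eq_2[symmetric] homogeneous_Cons insert_op_def koszul_def sg_eq unary_simps Pi_iff minus_add a_ac zero)
    then show "dh (mul x y) = mul (dh x) y \<oplus>\<^bsub>A\<^esub> mul (twist A 1 0 x) (dh y)"
      using cl xy by (simp add: neg_eq_iff twist_grade mul_sg unary_simps)
  qed (auto simp del: One_nat_def intro!: klin_plus klin_comp[OF mul_left dh.klin_axioms] klin_comp[OF mul_right dh.klin_axioms]
        klin_comp[OF dh.klin_axioms mul_left] klin_comp[OF dh.klin_axioms mul_right] mul_left mul_right
        klin_comp[OF klin_twist mul_left])
qed

text \<open>The structure relation for three inputs with \<open>u = 0\<close>, where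
  \<open>m 0 3\<close> vanishes. Linearity extends it from homogeneous triples in the first two
  slots and then in the third.\<close>

lemma mul_assoc:
  assumes "x \<in> carrier A" "y \<in> carrier A" "z \<in> carrier A"
  shows "mul (mul x y) z = mul x (mul y z)"
proof -
  have zero: "m 0 3 [x, y, z] = \<zero>\<^bsub>A\<^esub>"
    if "x \<in> carrier A" "y \<in> carrier A" "z \<in> carrier A" for x y z
    using higher_zero[of 3 0 "[x, y, z]"] that by (simp add: tuples_def)
  have hom: "mul (mul x y) z = mul x (mul y z)"
    if xyz: "x \<in> grade A i j" "y \<in> grade A k l" "z \<in> grade A k' l'" for x y z i j k l k' l'
  proof -
    note cl = xyz[THEN grade_closed]
    have "\<ominus>\<^bsub>A\<^esub> mul (mul x y) z \<oplus>\<^bsub>A\<^esub> mul x (mul y z) = \<zero>\<^bsub>A\<^esub>"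
      using m_relation_positions[of "[x, y, z]" "[(i, j), (k, l), (k', l')]" 0] cl xyz

      by (simp add: positions_list upt_rec numeral_2_eq_2[symmetric] homogeneous_Cons insert_op_def koszul_def sg_eq unary_simps Pi_iff
          zero)
    then show ?thesis
      using cl by (simp add: neg_add_eq_zero_iff)
  qed
  have "mul (mul x y) z = mul x (mul y z)" if "z \<in> grade A k' l'" "x \<in> carrier A" "y \<in> carrier A" for x y z k' l'
    by (rule graded_ext2[where f = "\<lambda>x y. mul (mul x y) z" and g = "\<lambda>x y. mul x (mul y z)",
          OF _ _ _ _ _ that(2,3)])
      (use hom that(1) grade_closed[OF that(1)] in
        \<open>auto intro!: klin_comp[OF mul_left mul_left] klin_comp[OF mul_right mul_left]
          mul_left klin_comp[OF mul_left mul_right]\<close>)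
  then show ?thesis
    by (intro graded_ext[where f = "mul (mul x y)" and B = A and g = "\<lambda>z. mul x (mul y z)", OF _ _ assms(3)])
      (use assms in \<open>auto intro!: mul_right klin_comp[OF mul_right mul_right]\<close>)
qed

end

section \<open>Transfer to a homotopy retract\<close>

locale bidga_retract = bidga K A m + H: bigraded_module K H
  for K :: "('k, 'r) ring_scheme" and A :: "('k, 'a) bigraded" and m
    and H :: "('k, 'h) bigraded" +
  fixes \<iota> :: "'h \<Rightarrow> 'a" and \<pi> :: "'a \<Rightarrow> 'h" and h :: "'a \<Rightarrow> 'a"
  assumes retract: "homotopy_retract K A (\<lambda>x. m 0 1 [x]) H (\<lambda>_. \<zero>\<^bsub>H\<^esub>) \<iota> \<pi> h"
begin

lemma graded_klin_\<iota>: "graded_klin K H A \<iota> 0 0"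
  and graded_klin_\<pi>: "graded_klin K A H \<pi> 0 0"
  and graded_klin_h: "graded_klin K A A h 0 (- 1)"
  using graded_klinI[of K H A 0 0 "\<lambda>xs. \<iota> (hd xs)"] graded_klinI[of K A H 0 0 "\<lambda>xs. \<pi> (hd xs)"]
    graded_klinI[of K A A 0 "-1" "\<lambda>xs. h (hd xs)"] retract bigraded_module_axioms H.bigraded_module_axioms
  by (auto simp: homotopy_retract_def)

sublocale \<iota>: graded_klin K H A \<iota> 0 0
  by (rule graded_klin_\<iota>)

sublocale \<pi>: graded_klin K A H \<pi> 0 0
  by (rule graded_klin_\<pi>)

sublocale h: graded_klin K A A h 0 "- 1"
  by (rule graded_klin_h)

text \<open>In the vertical suspension, \<open>t\<close> and \<open>s\<close> are the signs by the vertical and by the total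
  degree; \<open>d\<^sub>h\<close> is precomposed with \<open>s\<close> so that it anticommutes with \<open>d\<^sub>v\<close>.\<close>

definition "tA x = \<ominus>\<^bsub>A\<^esub> twist A 0 1 x"
definition "sA x = \<ominus>\<^bsub>A\<^esub> twist A 1 1 x"
definition "tH x = \<ominus>\<^bsub>H\<^esub> twist H 0 1 x"
definition "sH x = \<ominus>\<^bsub>H\<^esub> twist H 1 1 x"
definition "eA x = dh (sA x)"
definition "bA x y = mul (twist A 0 1 x) y"

lemma twist_reduce:
  assumes "x \<in> carrier A"
  shows "twist A 0 2 x = x" "twist A 2 2 x = x" "twist A 1 2 x = twist A 1 0 x"
    "twist A 2 0 x = x"
  using assms by (auto intro: twist_even twist_cong)

lemmas twist_commutes = \<iota>.twist_commute \<pi>.twist_commute h.twist_commute dv.twist_commute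
  dh.twist_commute twist_mul

lemma klin_tA: "klin K A A tA"
  and klin_sA: "klin K A A sA"
  and klin_tH: "klin K H H tH"
  and klin_sH: "klin K H H sH"
  using klin_comp[OF klin_twist klin_neg] klin_comp[OF H.klin_twist H.klin_neg]
  by (auto simp: tA_def[abs_def] sA_def[abs_def] tH_def[abs_def] sH_def[abs_def])

lemma klin_eA: "klin K A A eA"
  unfolding eA_def[abs_def] by (rule klin_comp[OF klin_sA dh.klin_axioms])

lemma homotopy:
  assumes "x \<in> carrier A"
  shows "\<pi> (dv x) = \<zero>\<^bsub>H\<^esub>" "x \<ominus>\<^bsub>A\<^esub> \<iota> (\<pi> x) = dv (h x) \<oplus>\<^bsub>A\<^esub> h (dv x)"
  using retract assms by (auto simp: homotopy_retract_def simp del: One_nat_def)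

lemma dv_\<iota>: "u \<in> carrier H \<Longrightarrow> dv (\<iota> u) = \<zero>\<^bsub>A\<^esub>"
  using retract by (auto simp: homotopy_retract_def simp del: One_nat_def)

text \<open>All twists are moved inwards by \<open>twist_commutes\<close>, merged by
  \<open>twist_twist\<close> and reduced modulo 2 by \<open>twist_reduce\<close>. What is left is
  settled by the bidga identities and the homotopy retract.\<close>

sublocale tree: tree_transfer K A H \<iota> \<pi> h dv eA tA sA tH sH bA
proof -
  note defs = tA_def sA_def tH_def sH_def eA_def bA_def
  note negs = dv.neg dh.neg h.neg \<iota>.neg \<pi>.neg klin.neg[OF klin_twist] mul_neg
  note simps = defs negs twist_commutes twist_twist sg_eq twist_reduce
  show "tree_transfer K A H \<iota> \<pi> h dv eA tA sA tH sH bA"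
  proof (intro tree_transfer.intro tree_transfer_axioms.intro)
    fix x y z
    assume x: "x \<in> carrier A" and y: "y \<in> carrier A" and z: "z \<in> carrier A"
    show "dv (bA x y) = \<ominus>\<^bsub>A\<^esub> (bA (dv x) y \<oplus>\<^bsub>A\<^esub> bA (tA x) (dv y))"
      using x y by (simp add: simps dv_mul minus_add del: One_nat_def)
    show "eA (bA x y) = \<ominus>\<^bsub>A\<^esub> (bA (eA x) (sA y) \<oplus>\<^bsub>A\<^esub> bA (tA x) (eA y))"
      using x y by (simp add: simps dh_mul minus_add del: One_nat_def)
    show "bA (bA x y) z = \<ominus>\<^bsub>A\<^esub> bA (tA x) (bA y z)"
      using x y z by (simp add: simps mul_assoc del: One_nat_def)
    show "tA (bA x y) = \<ominus>\<^bsub>A\<^esub> bA (tA x) (tA y)" "sA (bA x y) = \<ominus>\<^bsub>A\<^esub> bA (sA x) (sA y)"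
      using x y by (simp_all add: simps del: One_nat_def)
  next
    fix x
    assume x: "x \<in> carrier A"
    show "dv (eA x) = \<ominus>\<^bsub>A\<^esub> eA (dv x)" "eA (eA x) = \<zero>\<^bsub>A\<^esub>"
      "\<pi> (dv x) = \<zero>\<^bsub>H\<^esub>" "x \<ominus>\<^bsub>A\<^esub> \<iota> (\<pi> x) = dv (h x) \<oplus>\<^bsub>A\<^esub> h (dv x)"
      "sH (\<pi> x) = \<pi> (sA x)" "tA (h x) = \<ominus>\<^bsub>A\<^esub> h (tA x)" "sA (h x) = \<ominus>\<^bsub>A\<^esub> h (sA x)"
      "tA (eA x) = eA (tA x)" "sA (eA x) = \<ominus>\<^bsub>A\<^esub> eA (sA x)"
      using x by (simp_all add: simps dv_dh dh_dh homotopy H.sg_eq del: One_nat_def)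
    show "klin K A A (\<lambda>y. bA y x)" "klin K A A (bA x)"
      using x klin_comp[OF klin_twist mul_left] mul_right by (auto simp: bA_def[abs_def])
  next
    fix u
    assume u: "u \<in> carrier H"
    then show "dv (\<iota> u) = \<zero>\<^bsub>A\<^esub>" "tA (\<iota> u) = \<iota> (tH u)" "sA (\<iota> u) = \<iota> (sH u)" "sH (tH u) = tH (sH u)"
      by (simp_all add: simps dv_\<iota> H.twist_twist klin.neg[OF H.klin_twist] del: One_nat_def)
  qed (fact module_axioms H.module_axioms \<iota>.klin_axioms \<pi>.klin_axioms h.klin_axioms dv.klin_axioms
      klin_eA klin_tA klin_sA klin_tH klin_sH)+
qed

lemma sH_grade: "x \<in> grade H i j \<Longrightarrow> sH x = sg H (1 * int i + 1 * j + 1) x"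
  using H.grade_closed by (simp add: sH_def H.twist_grade H.sg_eq)

lemma sH_pow: "x \<in> grade H i j \<Longrightarrow> (sH ^^ a) x = sg H (int a * int i + int a * j + int a) x"
proof (induction a)
  case (Suc a)
  have x: "x \<in> carrier H"
    using Suc.prems by (rule H.grade_closed)
  have "(sH ^^ Suc a) x = sg H (int a * int i + int a * j + int a) (sH x)"
    using Suc x by (simp add: klin.sg[OF klin_sH])
  then show ?case
    using x by (simp add: sH_grade[OF Suc.prems] H.sg_sg algebra_simps)
qed (simp add: H.sg_eq H.grade_closed)

lemma tH_grade: "x \<in> grade H i j \<Longrightarrow> tH x = sg H (0 * int i + 1 * j + 1) x"
  using H.grade_closed by (simp add: tH_def H.twist_grade H.sg_eq)

lemma homogeneous_sH: "homogeneous H ds xs \<Longrightarrow> homogeneous H ds (map (sH ^^ a) xs)"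
proof (induction xs arbitrary: ds)
  case (Cons x xs)
  have "(sH ^^ a) y \<in> grade H i j" if "y \<in> grade H i j" for y i j
    using H.gradez_sg[of y "int i" j] that by (simp add: sH_pow)
  then show ?case
    using Cons by (force simp: homogeneous_Cons)
qed simp

lemma eA_gradez: "x \<in> gradez A i j \<Longrightarrow> eA x = sg A (1 + i + j) (dh x)"
  using gradez_closed[of x i j] by (simp add: eA_def sA_def twist_gradez sg_eq dh.neg del: One_nat_def)

lemma bA_gradez: "x \<in> gradez A i j \<Longrightarrow> y \<in> carrier A \<Longrightarrow> bA x y = sg A j (mul x y)"
  using gradez_closed[of x i j] by (simp add: bA_def twist_gradez mul_sg)

lemma leaves_weight3: "leaves T = Suc (weight3 T)"
  by (induction T) auto

text \<open>Each weight-2 vertex lowers the horizontal degree by one, and the \<open>h\<close> above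
  each vertex lowers the vertical degree by one; \<open>Pt\<close> lacks the \<open>h\<close> on the
  root edge.\<close>

lemma Ft_Pt_gradez:
  "(\<forall>ds xs. homogeneous H ds xs \<and> length xs = leaves T \<longrightarrow>
     tree.Ft T xs \<in> gradez A (hdeg ds - int (weight2 T)) (vdeg ds - int (weight2 T + weight3 T))) \<and>
   (\<forall>ds xs. homogeneous H ds xs \<and> length xs = leaves T \<longrightarrow>
     tree.Pt T xs \<in> gradez A (hdeg ds - int (weight2 T)) (vdeg ds - int (weight2 T + weight3 T) + 1))"
proof (induction T rule: tree.ptree_induct_FP)
  case Leaf
  then show ?case
    using \<iota>.graded by (auto simp: length_Suc_conv homogeneous_Cons)
next
  case (V2 T)
  have "eA x \<in> gradez A (i - 1) j" if "x \<in> gradez A i j" for x i j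
    using dh.gradedz[OF that] by (simp add: eA_gradez[OF that] gradez_sg)
  from this[OF V2[rule_format]] show ?case
    by (auto simp: tree.Pt_V2 algebra_simps)
next
  case (V3 S T)
  have b: "bA x y \<in> gradez A (i + k) (j + l)" if "x \<in> gradez A i j" "y \<in> gradez A k l" for x y i j k l
    using mul_gradez[OF that] that by (simp add: bA_gradez gradez_sg gradez_closed)
  show ?case
  proof (intro allI impI; elim conjE)
    fix ds xs
    assume xs: "homogeneous H ds xs" "length xs = leaves (V3 S T)"
    let ?n = "leaves S"
    have "hdeg ds = hdeg (take ?n ds) + hdeg (drop ?n ds)" "vdeg ds = vdeg (take ?n ds) + vdeg (drop ?n ds)"
      by (metis append_take_drop_id hdeg_simps(3), metis append_take_drop_id vdeg_simps(3))
    then show "tree.Pt (V3 S T) xs \<in> gradez A (hdeg ds - int (weight2 (V3 S T)))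
        (vdeg ds - int (weight2 (V3 S T) + weight3 (V3 S T)) + 1)"
      using b[OF V3(1)[rule_format, of "take ?n ds" "take ?n xs"]
          V3(2)[rule_format, of "drop ?n ds" "map (sH ^^ weight2 S) (drop ?n xs)"]] xs
      by (simp add: tree.Pt_V3 homogeneous_take homogeneous_drop homogeneous_sH algebra_simps)
  qed
next
  case (edge T)
  show ?case
  proof (intro allI impI; elim conjE)
    fix ds xs
    assume "homogeneous H ds xs" "length xs = leaves T"
    from h.gradedz[OF edge(2)[rule_format, OF conjI[OF this]]]
    show "tree.Ft T xs \<in> gradez A (hdeg ds - int (weight2 T)) (vdeg ds - int (weight2 T + weight3 T))"
      by (simp add: tree.Ft_not_Leaf[OF edge(1)] gradez_neg)
  qed
qed

lemmas Ft_gradez = Ft_Pt_gradez[THEN conjunct1, rule_format, OF conjI]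
lemmas Pt_gradez = Ft_Pt_gradez[THEN conjunct2, rule_format, OF conjI]

lemma N_gradez:
  assumes "homogeneous H ds xs"
  shows "tree.N w xs \<in> gradez H (hdeg ds - int w) (vdeg ds + 2 - int w - int (length xs))"
proof -
  have "tree.P w xs \<in> gradez A (hdeg ds - int w) (vdeg ds + 2 - int w - int (length xs))"
    unfolding tree.P_def
  proof (rule gradez_finsum)
    fix T
    assume "T \<in> trees w (length xs)"
    \<comment> \<open>A tree with \<open>n\<close> leaves has \<open>n - 1\<close> vertices of
      weight 3, which turns the number of \<open>h\<close> into the vertical degree
      \<open>2 - w - n\<close>.\<close>
    then have T: "leaves T = length xs" "weight2 T = w" "int (length xs) = int (weight3 T) + 1"
      using leaves_weight3[of T] by (auto simp: trees_def)
    then show "tree.Pt T xs \<in> gradez A (hdeg ds - int w) (vdeg ds + 2 - int w - int (length xs))"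
      using Pt_gradez[OF assms, of T] by (simp add: T(2,3) algebra_simps)
  qed
  from \<pi>.gradedz[OF this] show ?thesis
    by (simp add: tree.N_def)
qed

subsection \<open>Comparison with the trees of the statement\<close>

text \<open>The part of the exponent free of bidegrees. The \<open>1\<close> for each branch other
  than a leaf is the sign of \<open>- h\<close>. At a weight-2 root, \<open>leaves T\<close> is the
  parity left over from the total degree of the branch plus one. At a weight-3 root,
  \<open>weight2 S + leaves S + 1\<close> is the vertical degree shift of the left branch, and
  \<open>weight2 S * leaves T\<close> comes from the minus sign in \<open>sH\<close>, once for each
  right input and each twist.\<close>

primrec tsign :: "ptree \<Rightarrow> int" where
  "tsign Leaf = 0"
| "tsign (V2 T) = tsign T + (if T = Leaf then 0 else 1) + int (leaves T)"
| "tsign (V3 S T) = tsign S + (if S = Leaf then 0 else 1) + (tsign T + (if T = Leaf then 0 else 1)) +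
     int (weight2 S) + int (leaves S) + 1 + int (weight2 S) * int (leaves T)"

definition esign :: "ptree \<Rightarrow> int" where
  "esign T = tsign T + (if T = Leaf then 0 else 1)"

text \<open>The part of the exponent that depends on bidegrees. The tree enters only through its
  weight, so this part is common to all of \<open>trees i j\<close>.\<close>

definition hsign :: "ptree \<Rightarrow> (nat \<times> int) list \<Rightarrow> int" where
  "hsign T ds = int (weight2 T) * (hdeg ds + vdeg ds) + wsum ds"

definition teval :: "ptree \<Rightarrow> (nat \<times> int) list \<Rightarrow> 'h list \<Rightarrow> 'a" where
  "teval T ds xs = tree_eval A dh mul \<iota> h T ds xs"

text \<open>The comparison of exponents at a weight-3 root, stated for integers so that the
  difference can be exhibited as twice an explicit expression. Leaf numbers are \<open>p\<close>,
  \<open>q\<close>, weights \<open>a\<close>, \<open>b\<close>, and \<open>P\<close>,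
  \<open>Q\<close> count the weight-3 vertices of the two branches.\<close>

lemma V3_parity:
  fixes vy hy vz hz a b c c' p q k l :: int
  assumes "q = Q + 1" "p = P + 1"
  shows "even ((vy - (a + P)) + (c + (a * (hy + vy) + k)) + (a * (hz + vz + q)) + (c' + (b * (hz + vz) + l)) -
    ((c + c' + a + p + 1 + a * q) + ((a + b) * ((hy + hz) + (vy + vz)) + (k + q * vy + l)) +
     (b * hy + (- (b + Q)) * vy)))"
proof -
  have eq: "(vy - (a + P)) + (c + (a * (hy + vy) + k)) + (a * (hz + vz + q)) + (c' + (b * (hz + vz) + l)) -
    ((c + c' + a + p + 1 + a * q) + ((a + b) * ((hy + hz) + (vy + vz)) + (k + q * vy + l)) +
     (b * hy + (- (b + Q)) * vy)) = 2 * (- a - P - 1 - b * hy)"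
    unfolding assms by (simp add: algebra_simps)
  show ?thesis
    unfolding eq by (rule dvd_triv_left)
qed

text \<open>Links the degree-free recursion to the evaluation with Koszul signs. Membership in the
  carrier is proved along the way because signs can be merged only on elements of the
  carrier.\<close>

lemma Ft_Pt_teval:
  "(\<forall>ds xs. homogeneous H ds xs \<and> length xs = leaves T \<longrightarrow>
     on_edge h T (teval T ds xs) \<in> carrier A \<and>
     tree.Ft T xs = sg A (esign T + hsign T ds) (on_edge h T (teval T ds xs))) \<and>
   (\<forall>ds xs. homogeneous H ds xs \<and> length xs = leaves T \<longrightarrow>
     teval T ds xs \<in> carrier A \<and>
     (T \<noteq> Leaf \<longrightarrow> tree.Pt T xs = sg A (tsign T + hsign T ds) (teval T ds xs)))"
proof (induction T rule: tree.ptree_induct_FP)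
  case Leaf
  then show ?case
    by (auto simp: length_Suc_conv homogeneous_Cons teval_def on_edge_def esign_def hsign_def
        sg_eq H.grade_closed)
next
  case (V2 T)
  show ?case
  proof (intro allI impI; elim conjE)
    fix ds xs
    assume xs: "homogeneous H ds xs" "length xs = leaves (V2 T)"
    let ?E = "on_edge h T (teval T ds xs)"
    have IH: "?E \<in> carrier A" "tree.Ft T xs = sg A (esign T + hsign T ds) ?E"
      using V2[rule_format, of ds xs] xs by auto
    have te: "teval (V2 T) ds xs = dh ?E"
      by (simp add: teval_def)
    have "tree.Pt (V2 T) xs = sg A (1 + (hdeg ds - int (weight2 T)) + (vdeg ds - int (weight2 T + weight3 T)))
        (dh (sg A (esign T + hsign T ds) ?E))"
      using eA_gradez[OF Ft_gradez[OF xs(1)], of T] xs(2) by (simp add: tree.Pt_V2 IH(2))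
    also have "\<dots> = sg A ((1 + (hdeg ds - int (weight2 T)) + (vdeg ds - int (weight2 T + weight3 T))) +
        (esign T + hsign T ds)) (dh ?E)"
      using IH(1) by (simp add: dh.sg sg_sg del: One_nat_def)
    also have "\<dots> = sg A (tsign (V2 T) + hsign (V2 T) ds) (dh ?E)"
    proof (rule sg_cong)
      have "(1 + (hdeg ds - int (weight2 T)) + (vdeg ds - int (weight2 T + weight3 T))) +
          (esign T + hsign T ds) - (tsign (V2 T) + hsign (V2 T) ds) =
          2 * (- int (weight2 T) - int (weight3 T))"
        by (simp add: esign_def hsign_def leaves_weight3 algebra_simps)
      then show "even ((1 + (hdeg ds - int (weight2 T)) + (vdeg ds - int (weight2 T + weight3 T))) +
          (esign T + hsign T ds) - (tsign (V2 T) + hsign (V2 T) ds))"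
        by (metis dvd_triv_left)
    qed (use IH(1) in \<open>simp del: One_nat_def\<close>)
    finally show "teval (V2 T) ds xs \<in> carrier A \<and>
        (V2 T \<noteq> Leaf \<longrightarrow> tree.Pt (V2 T) xs = sg A (tsign (V2 T) + hsign (V2 T) ds) (teval (V2 T) ds xs))"
      using IH(1) te by (auto simp del: One_nat_def)
  qed
next
  case (V3 S T)
  show ?case
  proof (intro allI impI; elim conjE)
    fix ds xs
    assume xs: "homogeneous H ds xs" "length xs = leaves (V3 S T)"
    define n where "n = leaves S"
    define as bs ys zs where "as = take n ds" and "bs = drop n ds" and "ys = take n xs" and "zs = drop n xs"
    have hom: "homogeneous H as ys" "homogeneous H bs zs" "length ys = leaves S" "length zs = leaves T"
      using xs by (auto simp: as_def bs_def ys_def zs_def n_def homogeneous_take homogeneous_drop)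
    have len: "length as = leaves S" "length bs = leaves T"
      using hom homogeneous_length by metis+
    have ds: "ds = as @ bs"
      by (simp add: as_def bs_def)
    let ?E = "on_edge h S (teval S as ys)" and ?E' = "on_edge h T (teval T bs zs)"
    have IH: "?E \<in> carrier A" "tree.Ft S ys = sg A (esign S + hsign S as) ?E"
      "?E' \<in> carrier A" "tree.Ft T zs = sg A (esign T + hsign T bs) ?E'"
      using V3(1)[rule_format, of as ys] V3(2)[rule_format, of bs zs] hom by auto
    let ?a = "int (weight2 S)"
    \<comment> \<open>Each right input is multiplied by the sign of its total degree plus one, once
      for every weight-2 vertex of the left branch.\<close>
    have "signed H (?a * hdeg bs + ?a * vdeg bs + ?a * int (length bs)) (map (sH ^^ weight2 S) zs) zs"
      by (rule H.signed_map[OF hom(2)]) (simp add: sH_pow)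
    then have F: "tree.Ft T (map (sH ^^ weight2 S) zs) =
        sg A (?a * hdeg bs + ?a * vdeg bs + ?a * int (length bs)) (tree.Ft T zs)"
      using tree.mlin_Ft[of T] hom H.homogeneous_closed[OF hom(2)]
      by (intro mlin_signed[where H = H]) (auto simp: H.module_axioms module_axioms)
    have te: "teval (V3 S T) ds xs =
        sg A (int (weight2 T) * hdeg as + (- int (weight2 T + weight3 T)) * vdeg as) (mul ?E ?E')"
      by (simp add: teval_def koszul_def as_def bs_def ys_def zs_def n_def)
    have "tree.Pt (V3 S T) xs = bA (tree.Ft S ys) (tree.Ft T (map (sH ^^ weight2 S) zs))"
      by (simp add: tree.Pt_V3 ys_def zs_def n_def)
    also have "\<dots> = sg A (vdeg as - int (weight2 S + weight3 S))
        (mul (tree.Ft S ys) (tree.Ft T (map (sH ^^ weight2 S) zs)))"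
      using Ft_gradez[OF hom(1,3)] IH by (intro bA_gradez) (auto simp: F)
    also have "\<dots> = sg A ((vdeg as - (?a + int (weight3 S))) + (esign S + (?a * (hdeg as + vdeg as) + wsum as)) +
        ?a * (hdeg bs + vdeg bs + int (leaves T)) +
        (esign T + (int (weight2 T) * (hdeg bs + vdeg bs) + wsum bs))) (mul ?E ?E')"
      using IH by (simp add: F mul_sg sg_sg len hsign_def algebra_simps)
    also have "\<dots> = sg A ((esign S + esign T + ?a + int (leaves S) + 1 + ?a * int (leaves T)) +
        ((?a + int (weight2 T)) * ((hdeg as + hdeg bs) + (vdeg as + vdeg bs)) +
         (wsum as + int (leaves T) * vdeg as + wsum bs)) +
        (int (weight2 T) * hdeg as + (- (int (weight2 T) + int (weight3 T))) * vdeg as)) (mul ?E ?E')"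
      using IH by (intro sg_cong V3_parity) (auto simp: leaves_weight3)
    also have "\<dots> = sg A (tsign (V3 S T) + hsign (V3 S T) ds) (teval (V3 S T) ds xs)"
    proof -
      have "tsign (V3 S T) = esign S + esign T + ?a + int (leaves S) + 1 + ?a * int (leaves T)"
        by (simp add: esign_def)
      moreover have "hsign (V3 S T) ds = (?a + int (weight2 T)) * ((hdeg as + hdeg bs) + (vdeg as + vdeg bs)) +
          (wsum as + int (leaves T) * vdeg as + wsum bs)"
        by (simp add: hsign_def ds wsum_append len)
      ultimately show ?thesis
        using IH by (simp only: te, subst sg_sg) simp_all
    qed
    finally show "teval (V3 S T) ds xs \<in> carrier A \<and> (V3 S T \<noteq> Leaf \<longrightarrow>
        tree.Pt (V3 S T) xs = sg A (tsign (V3 S T) + hsign (V3 S T) ds) (teval (V3 S T) ds xs))"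
      using IH te by auto
  qed
next
  case (edge T)
  then show ?case
    by (auto simp: on_edge_def tree.Ft_not_Leaf[OF edge(1)] esign_def h.sg h.neg sg_eq)
qed

lemmas Pt_teval = Ft_Pt_teval[THEN conjunct2, rule_format, OF conjI]

end

lemma choose_two_add: "(a + b) choose 2 = (a choose 2) + (b choose 2) + a * b"
proof (induction a)
  case (Suc a)
  have "Suc n choose 2 = n + (n choose 2)" for n
    by (simp add: numeral_2_eq_2)
  then show ?case
    using Suc by simp
qed (simp add: numeral_2_eq_2)

text \<open>Left: the sign of the structure relation, the Koszul sign of the insertion, and the
  desuspension signs of the outer and of the inner operation. Right: an exponent depending only on
  \<open>u\<close>, \<open>v\<close> and the inputs, and the signs of the operators inside
  \<open>slot\<close>. The binomials enter only through their cross term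
  \<open>(j - 1) * (q - 1)\<close>.\<close>

lemma relation_parity:
  fixes i p q r t ha hb hc va vb vc wa wb wc cJ cQ :: int
  assumes "j = r + 1 + t" "u = i + p" "v = r + q + t" "cV = cJ + cQ + (j - 1) * (q - 1)"
  shows "even ((r * q + t + p * j) + (p * ha + (2 - p - q) * va) + ((cJ + i * j) +
      (i * ha + i * va + wa + (1 + t) * va + (i * (hb - p) + (i + t) * (vb + 2 - p - q)) +
       (i * hc + i * vc + wc)) + ((cQ + p * q) + (p * hb + p * vb + wb))) -
    ((cV + u * (v + 1) + u * (ha + hb + hc + (va + vb + vc)) +
      (wa + (q + t) * va + wb + t * vb + wc)) + ((va + r) + (p * hc + p * vc + p * t))))"
  (is "even ?D")
proof -
  have eq: "?D = 2 * (2 * t + va - p * va - q * va + i - i * p - i * q - q * t - p * t - hc * p - p * vc)"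
    unfolding assms by (simp add: algebra_simps)
  show ?thesis
    unfolding eq by (rule dvd_triv_left)
qed

context bidga_retract
begin

subsection \<open>The transferred structure\<close>

text \<open>Chosen so that composition works out: since \<open>v - 1 = (j - 1) + (q - 1)\<close>,
  the binomial splits with cross term \<open>(j - 1) * (q - 1)\<close>, and the products
  \<open>i * j\<close> and \<open>p * q\<close> combine with the \<open>p * j\<close> of the
  structure relation.\<close>

definition osign :: "nat \<Rightarrow> nat \<Rightarrow> int" where
  "osign i j = int ((j - 1) choose 2) + int i * int j"

definition transferred :: "nat \<Rightarrow> nat \<Rightarrow> 'h list \<Rightarrow> 'h" where
  "transferred i j xs = sg H (osign i j) (tree.N i (twists H i xs))"

lemma mlin_transferred: "mlin K H H j (transferred i j)"
  unfolding transferred_def[abs_def]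
  by (rule mlin_comp[OF H.mlin_twists[OF tree.mlin_N] H.klin_sg])

lemma transferred_homogeneous:
  assumes "homogeneous H ds xs"
  shows "transferred i j xs =
    sg H (osign i j + (int i * hdeg ds + int i * vdeg ds + wsum ds)) (tree.N i xs)"
proof -
  note xs = H.homogeneous_closed[OF assms]
  have "tree.N i (twists H i xs) = sg H (int i * hdeg ds + int i * vdeg ds + wsum ds) (tree.N i xs)"
    by (rule mlin_signed[OF H.signed_twists[OF assms] tree.mlin_N xs H.module_axioms H.module_axioms])
  then show ?thesis
    using xs by (simp add: transferred_def H.sg_sg)
qed

lemma multilinear_transferred:
  "multilinear K H H j (int i) (2 - int i - int j) (transferred i j)"
  unfolding multilinear_iff[OF H.module_axioms H.module_axioms]
proof (intro conjI allI impI; (elim conjE)?)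
  fix ds xs
  assume "length xs = j" "homogeneous H ds xs"
  then show "transferred i j xs \<in> gradez H (hdeg ds - int i) (vdeg ds + (2 - int i - int j))"
    using N_gradez[of ds xs i]
    by (simp add: transferred_homogeneous H.gradez_sg algebra_simps)
qed (rule mlin_transferred)

text \<open>The exponent on the right does not involve \<open>r\<close>, \<open>q\<close> or
  \<open>p\<close>. Hence all summands of a structure relation carry one common sign, and the
  relation reduces to the sign-free \<open>tree.N_relation\<close>.\<close>

lemma insert_op_transferred:
  assumes hom: "homogeneous H ds xs" and rq: "1 \<le> q" "r + q \<le> length xs" and p: "p \<le> u"
  shows "sg H (int (r * q + (length xs - r - q) + p * (length xs + 1 - q)))
      (insert_op H transferred (u - p) (length xs + 1 - q) p q r ds xs) =
    sg H (int ((length xs - 1) choose 2) + int u * (int (length xs) + 1) +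
      int u * (hdeg ds + vdeg ds) + wsum ds) (tree.N (u - p) (tree.slot r q p xs))"
proof -
  define i t j where "i = u - p" and "t = length xs - r - q" and "j = length xs + 1 - q"
  have nums: "u = i + p" "length xs = r + q + t" "j = r + 1 + t" "length xs - 1 = (j - 1) + (q - 1)"
    using rq p by (auto simp: i_def t_def j_def)
  define as bs cs where "as = take r xs" and "bs = take q (drop r xs)" and "cs = drop (r + q) xs"
  define da db dc where "da = take r ds" and "db = take q (drop r ds)" and "dc = drop (r + q) ds"
  have hom': "homogeneous H da as" "homogeneous H db bs" "homogeneous H dc cs"
    unfolding as_def bs_def cs_def da_def db_def dc_def
    by (intro homogeneous_take homogeneous_drop hom)+
  have len: "length as = r" "length bs = q" "length cs = t"
    using nums by (auto simp: as_def bs_def cs_def)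
  then have len': "length da = r" "length db = q" "length dc = t"
    using hom' homogeneous_length by metis+
  have ds: "ds = da @ db @ dc"
    by (simp add: da_def db_def dc_def add.commute flip: drop_drop)
  have cl: "set as \<subseteq> carrier H" "set bs \<subseteq> carrier H" "set cs \<subseteq> carrier H"
    using hom' H.homogeneous_closed by metis+
  let ?y = "transferred p q bs" and ?z = "tree.N p bs"
  let ?X = "tree.N i (as @ ?z # cs)"
  \<comment> \<open>\<open>?\<beta>\<close> desuspends the inner operation, \<open>?\<gamma>\<close>
    comes from the twists on the inputs of the outer one, and \<open>?\<delta>\<close> from the
    operators \<open>tH\<close> and \<open>sH\<close> that \<open>slot\<close> applies to the
    remaining inputs.\<close>
  let ?\<beta> = "osign p q + (int p * hdeg db + int p * vdeg db + wsum db)"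
  let ?\<gamma> = "int i * hdeg da + int i * vdeg da + wsum da + int (Suc (length cs)) * vdeg da +
      (int i * (hdeg db - int p) + int (i + length cs) * (vdeg db + 2 - int p - int q)) +
      (int i * hdeg dc + int i * vdeg dc + wsum dc)"
  let ?\<delta> = "(0 * hdeg da + 1 * vdeg da + 1 * int (length da)) +
      (0 + (int p * hdeg dc + int p * vdeg dc + int p * int (length dc)))"
  have z: "?z \<in> carrier H" "?X \<in> carrier H"
    using cl by simp_all
  have y: "?y = sg H ?\<beta> ?z"
    by (rule transferred_homogeneous[OF hom'(2)])
  have y_grade: "?y \<in> gradez H (hdeg db - int p) (vdeg db + 2 - int p - int q)"
    unfolding y using N_gradez[OF hom'(2), of p] len by (intro H.gradez_sg) simp
  have "tree.N i (twists H i (as @ ?y # cs)) = sg H ?\<gamma> (tree.N i (as @ ?y # cs))"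
    by (rule mlin_signed[OF H.signed_twists_slot[OF hom'(1,3) y_grade] tree.mlin_N])
      (use cl z in \<open>auto simp: y H.module_axioms\<close>)
  also have "tree.N i (as @ ?y # cs) = sg H ?\<beta> ?X"
    unfolding y using klin.sg[OF mlin_slot[OF tree.mlin_N refl cl(1,3) H.module_axioms] z(1)] .
  finally have "insert_op H transferred i j p q r ds xs =
      sg H (int p * hdeg da + (2 - int p - int q) * vdeg da)
        (sg H (osign i j) (sg H ?\<gamma> (sg H ?\<beta> ?X)))"
    by (simp add: insert_op_def koszul_def transferred_def[of i j] as_def bs_def cs_def da_def)
  then have lhs: "sg H (int (r * q + t + p * j)) (insert_op H transferred i j p q r ds xs) =
      sg H ((int r * int q + int t + int p * int j) + (int p * hdeg da + (2 - int p - int q) * vdeg da) +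
        (osign i j + ?\<gamma> + ?\<beta>)) ?X"
    using z by (simp add: H.sg_sg add.assoc)
  \<comment> \<open>The inserted entry is given the trivial exponent 0 so that the tuple fits the
    shape of \<open>signed\<close>.\<close>
  have "signed H ?\<delta> (map tH as @ sg H 0 ?z # map (sH ^^ p) cs) (as @ ?z # cs)"
    by (intro signed_append signed_Cons H.signed_map[OF hom'(1)] H.signed_map[OF hom'(3)])
      (simp_all add: sH_pow tH_grade)
  from mlin_signed[OF this tree.mlin_N]
  have rhs: "tree.N i (tree.slot r q p xs) = sg H ?\<delta> ?X"
    using cl z by (auto simp: tree.slot_def as_def bs_def cs_def H.module_axioms H.sg_eq)
  have w: "wsum ds = wsum da + (int q + int t) * vdeg da + wsum db + int t * vdeg db + wsum dc"
    by (simp add: ds wsum_append len' algebra_simps)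
  have "int ((length xs - 1) choose 2) = int ((j - 1) choose 2) + int ((q - 1) choose 2) +
      (int j - 1) * (int q - 1)"
    unfolding nums(4) choose_two_add using rq nums(3) by (simp add: of_nat_diff)
  moreover have "int j = int r + 1 + int t" "int u = int i + int p" "int (length xs) = int r + int q + int t"
    using nums by simp_all
  ultimately have par: "even ((int r * int q + int t + int p * int j) +
      (int p * hdeg da + (2 - int p - int q) * vdeg da) +
      (osign i j + ?\<gamma> + ?\<beta>) -
      ((int ((length xs - 1) choose 2) + int u * (int (length xs) + 1) +
        int u * (hdeg ds + vdeg ds) + wsum ds) + ?\<delta>))"
    using relation_parity[of "int j" "int r" "int t" "int u" "int i" "int p" "int (length xs)" "int q"
        "int ((length xs - 1) choose 2)" "int ((j - 1) choose 2)" "int ((q - 1) choose 2)"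
        "hdeg da" "vdeg da" "wsum da" "hdeg db" "vdeg db" "hdeg dc" "vdeg dc" "wsum dc" "wsum db"]
    unfolding w osign_def
    by (simp only: ds hdeg_simps vdeg_simps len len' of_nat_Suc of_nat_add mult_1 mult_zero_left add_0_left add.assoc)
  have "sg H ((int r * int q + int t + int p * int j) +
        (int p * hdeg da + (2 - int p - int q) * vdeg da) + (osign i j + ?\<gamma> + ?\<beta>)) ?X =
      sg H ((int ((length xs - 1) choose 2) + int u * (int (length xs) + 1) +
        int u * (hdeg ds + vdeg ds) + wsum ds) + ?\<delta>) ?X"
    using z(2) par by (rule H.sg_cong)
  then show ?thesis
    unfolding rhs i_def[symmetric] t_def[symmetric] j_def[symmetric] lhs using z(2)
    by (simp add: H.sg_sg)
qed

theorem derived_Ainf_transferred: "derived_Ainf K H transferred"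
proof (intro derived_Ainf.intro derived_Ainf_axioms.intro)
  show "bigraded_module K H"
    by (rule H.bigraded_module_axioms)
  show "multilinear K H H j (int i) (2 - int i - int j) (transferred i j)" for i j
    by (rule multilinear_transferred)
  fix v :: nat and xs ds and u :: nat
  assume v: "1 \<le> v" "length xs = v" and hom: "homogeneous H ds xs"
  note xs = H.homogeneous_closed[OF hom]
  let ?E = "int ((length xs - 1) choose 2) + int u * (int (length xs) + 1) +
      int u * (hdeg ds + vdeg ds) + wsum ds"
  let ?f = "\<lambda>i j p q r t. sg H (int (r * q + t + p * j)) (insert_op H transferred i j p q r ds xs)"
  have eq: "?f (u - p) (v + 1 - q) p q r (v - r - q) = sg H ?E (tree.N (u - p) (tree.slot r q p xs))"
    if "1 \<le> q" "r + q \<le> v" "p \<le> u" for r q p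
    using insert_op_transferred[OF hom, of q r p u] that v(2) by blast
  have "(\<Oplus>\<^bsub>H\<^esub>e \<in> {(i, j, p, q, r, t). u = i + p \<and> v + 1 = j + q \<and> j = 1 + r + t \<and> 1 \<le> q}.
      case e of (i, j, p, q, r, t) \<Rightarrow> ?f i j p q r t) =
    finsum H (\<lambda>(r, q, p). ?f (u - p) (v + 1 - q) p q r (v - r - q)) (positions v u)"
  proof (rule H.index_set_reindex)
    fix r q p
    assume "1 \<le> q" "r + q \<le> v" "p \<le> u"
    from eq[OF this] show "?f (u - p) (v + 1 - q) p q r (v - r - q) \<in> carrier H"
      using xs by (simp only: H.sg_closed tree.N_closed tree.slot_closed)
  qed
  also have "\<dots> = (\<Oplus>\<^bsub>H\<^esub>e\<in>positions v u. sg H ?E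
      (case e of (r, q, p) \<Rightarrow> tree.N (u - p) (tree.slot r q p xs)))"
  proof (rule H.finsum_cong'[OF refl])
    fix e
    assume "e \<in> positions v u"
    then obtain r q p where e: "e = (r, q, p)" and "1 \<le> q" "r + q \<le> v" "p \<le> u"
      by (cases e) auto
    from eq[OF this(2-)] show "(case e of (r, q, p) \<Rightarrow> ?f (u - p) (v + 1 - q) p q r (v - r - q)) =
        sg H ?E (case e of (r, q, p) \<Rightarrow> tree.N (u - p) (tree.slot r q p xs))"
      by (simp only: e prod.case)
  qed (use xs in auto)
  also have "\<dots> = sg H ?E (finsum H (\<lambda>(r, q, p). tree.N (u - p) (tree.slot r q p xs)) (positions v u))"
    using xs by (intro H.sg_finsum) auto
  also have "\<dots> = \<zero>\<^bsub>H\<^esub>"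
  proof -
    have "xs \<noteq> []"
      using v by auto
    from tree.N_relation[OF xs this, of u] show ?thesis
      by (simp only: v(2) H.sg_zero)
  qed
  finally show "(\<Oplus>\<^bsub>H\<^esub>e \<in> {(i, j, p, q, r, t). u = i + p \<and> v + 1 = j + q \<and> j = 1 + r + t \<and> 1 \<le> q}.
      case e of (i, j, p, q, r, t) \<Rightarrow> ?f i j p q r t) = \<zero>\<^bsub>H\<^esub>" .
qed

lemma transferred_0_1: "x \<in> carrier H \<Longrightarrow> transferred 0 1 [x] = \<zero>\<^bsub>H\<^esub>"
  by (simp add: transferred_def tree.N_def tree.P_single)

text \<open>The bidegree-dependent exponent occurs twice, once in desuspending and once in comparing
  each tree with its evaluation, and cancels modulo 2. What survives depends on \<open>i\<close>,
  \<open>j\<close> and the tree only.\<close>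

lemma transferred_trees:
  assumes "2 \<le> i + j" "length xs = j" and hom: "homogeneous H ds xs"
  shows "transferred i j xs = (\<Oplus>\<^bsub>H\<^esub>T\<in>trees i j. sg H (osign i j + tsign T) (tree_map A dh mul \<iota> \<pi> h T ds xs))"
proof -
  let ?k = "osign i j + (int i * hdeg ds + int i * vdeg ds + wsum ds)"
  have T: "\<pi> (tree.Pt T xs) = sg H (tsign T + (int i * hdeg ds + int i * vdeg ds + wsum ds))
      (tree_map A dh mul \<iota> \<pi> h T ds xs)"
    and cl: "tree.Pt T xs \<in> carrier A" "tree_map A dh mul \<iota> \<pi> h T ds xs \<in> carrier H"
    if "T \<in> trees i j" for T
  proof -
    \<comment> \<open>The bare edge lies in \<open>trees 0 1\<close> only, which
      \<open>2 \<le> i + j\<close> excludes; there \<open>Pt\<close> is zero while the evaluation is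
      \<open>\<iota>\<close>.\<close>
    have "T \<noteq> Leaf" "length xs = leaves T" "weight2 T = i"
      using that assms by (auto simp: trees_def)
    then show "\<pi> (tree.Pt T xs) = sg H (tsign T + (int i * hdeg ds + int i * vdeg ds + wsum ds))
        (tree_map A dh mul \<iota> \<pi> h T ds xs)"
      and "tree.Pt T xs \<in> carrier A" "tree_map A dh mul \<iota> \<pi> h T ds xs \<in> carrier H"
      using Pt_teval[OF hom, of T]
      by (auto simp: hsign_def tree_map_def teval_def \<pi>.sg algebra_simps simp del: One_nat_def)
  qed
  have "transferred i j xs = sg H ?k (\<Oplus>\<^bsub>H\<^esub>T\<in>trees i j. \<pi> (tree.Pt T xs))"
    unfolding transferred_homogeneous[OF hom] tree.N_def tree.P_def
    using cl assms by (subst \<pi>.finsum) auto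
  also have "\<dots> = (\<Oplus>\<^bsub>H\<^esub>T\<in>trees i j. sg H ?k (\<pi> (tree.Pt T xs)))"
    using cl by (intro H.sg_finsum[symmetric]) auto
  also have "\<dots> = (\<Oplus>\<^bsub>H\<^esub>T\<in>trees i j. sg H (osign i j + tsign T) (tree_map A dh mul \<iota> \<pi> h T ds xs))"
    using cl by (intro H.finsum_cong'[OF refl]) (auto simp: T H.sg_sg simp del: One_nat_def intro!: H.sg_cong)
  finally show ?thesis .
qed

end

section \<open>Vertical homology as a bigraded module\<close>

locale bigraded_endo = bigraded_module K A + d: klin K A A d
  for K :: "('k, 'r) ring_scheme" and A :: "('k, 'a) bigraded" and d
begin

lemma kernel_iff: "x \<in> a_kernel A A d \<longleftrightarrow> x \<in> carrier A \<and> d x = \<zero>\<^bsub>A\<^esub>"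
  by (auto simp: a_kernel_def')

lemma abelian_subgroup_boundaries: "abelian_subgroup (boundaries A d) A"
proof (rule abelian_subgroupI3)
  show "additive_subgroup (boundaries A d) A"
  proof (rule additive_subgroup.intro, rule add.subgroupI)
    fix x y
    assume "x \<in> boundaries A d" "y \<in> boundaries A d"
    then obtain u v where "x = d u" "y = d v" "u \<in> carrier A" "v \<in> carrier A"
      by (auto simp: boundaries_def)
    then show "x \<oplus>\<^bsub>A\<^esub> y \<in> boundaries A d" "\<ominus>\<^bsub>A\<^esub> x \<in> boundaries A d"
      by (auto simp: boundaries_def d.add[symmetric] d.neg[symmetric])
  qed (auto simp: boundaries_def)
qed (rule abelian_group_axioms)

sublocale B: abelian_subgroup "boundaries A d" A
  by (rule abelian_subgroup_boundaries)

lemma hclass_add: "x \<in> carrier A \<Longrightarrow> y \<in> carrier A \<Longrightarrow>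
    hclass A d x <+>\<^bsub>A\<^esub> hclass A d y = hclass A d (x \<oplus>\<^bsub>A\<^esub> y)"
  unfolding hclass_def by (rule B.a_rcos_sum)

lemma hclass_boundary: "b \<in> boundaries A d \<Longrightarrow> hclass A d b = boundaries A d"
  unfolding hclass_def by (rule B.a_rcos_const)

lemma hclass_zero: "hclass A d \<zero>\<^bsub>A\<^esub> = boundaries A d"
  by (rule hclass_boundary) simp

text \<open>Members of one class differ by some \<open>d u\<close>, and scaling it gives the
  boundary \<open>d\<close> of the scaled \<open>u\<close>; so all the cosets in the union
  coincide.\<close>

lemma hclass_smult:
  assumes a: "a \<in> carrier K" and z: "z \<in> carrier A"
  shows "(\<Union>x\<in>hclass A d z. hclass A d (a \<odot>\<^bsub>A\<^esub> x)) = hclass A d (a \<odot>\<^bsub>A\<^esub> z)"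
proof -
  have const: "hclass A d (a \<odot>\<^bsub>A\<^esub> x) = hclass A d (a \<odot>\<^bsub>A\<^esub> z)" if x: "x \<in> hclass A d z" for x
  proof -
    obtain u where u: "u \<in> carrier A" "x = d u \<oplus>\<^bsub>A\<^esub> z"
      using x by (auto simp: hclass_def a_r_coset_def' boundaries_def)
    have b: "d (a \<odot>\<^bsub>A\<^esub> u) \<in> boundaries A d"
      using a u by (auto simp: boundaries_def)
    have "hclass A d (a \<odot>\<^bsub>A\<^esub> x) = hclass A d (d (a \<odot>\<^bsub>A\<^esub> u)) <+>\<^bsub>A\<^esub> hclass A d (a \<odot>\<^bsub>A\<^esub> z)"
      using a z u by (simp add: hclass_add smult_r_distr d.smult)
    also have "\<dots> = hclass A d \<zero>\<^bsub>A\<^esub> <+>\<^bsub>A\<^esub> hclass A d (a \<odot>\<^bsub>A\<^esub> z)"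
      by (simp add: hclass_boundary[OF b] hclass_zero)
    also have "\<dots> = hclass A d (a \<odot>\<^bsub>A\<^esub> z)"
      using a z by (subst hclass_add) auto
    finally show ?thesis .
  qed
  have "z \<in> hclass A d z"
    unfolding hclass_def using z by (rule B.a_rcos_self)
  then have "(\<Union>x\<in>hclass A d z. hclass A d (a \<odot>\<^bsub>A\<^esub> z)) = hclass A d (a \<odot>\<^bsub>A\<^esub> z)"
    by blast
  then show ?thesis
    by (simp add: const cong: SUP_cong)
qed

abbreviation "HH \<equiv> homology A d"

lemma homology_simps:
  "carrier HH = hclass A d ` a_kernel A A d"
  "grade HH i j = hclass A d ` (a_kernel A A d \<inter> grade A i j)"
  "\<zero>\<^bsub>HH\<^esub> = hclass A d \<zero>\<^bsub>A\<^esub>"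
  "x \<in> carrier A \<Longrightarrow> y \<in> carrier A \<Longrightarrow> hclass A d x \<oplus>\<^bsub>HH\<^esub> hclass A d y = hclass A d (x \<oplus>\<^bsub>A\<^esub> y)"
  "a \<in> carrier K \<Longrightarrow> x \<in> carrier A \<Longrightarrow> a \<odot>\<^bsub>HH\<^esub> hclass A d x = hclass A d (a \<odot>\<^bsub>A\<^esub> x)"
  by (simp_all add: homology_def hclass_add hclass_zero hclass_smult)

lemma kernel_closed:
  "\<zero>\<^bsub>A\<^esub> \<in> a_kernel A A d"
  "x \<in> a_kernel A A d \<Longrightarrow> y \<in> a_kernel A A d \<Longrightarrow> x \<oplus>\<^bsub>A\<^esub> y \<in> a_kernel A A d"
  "x \<in> a_kernel A A d \<Longrightarrow> \<ominus>\<^bsub>A\<^esub> x \<in> a_kernel A A d"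
  "a \<in> carrier K \<Longrightarrow> x \<in> a_kernel A A d \<Longrightarrow> a \<odot>\<^bsub>A\<^esub> x \<in> a_kernel A A d"
  by (auto simp: kernel_iff d.add d.neg d.smult)

lemma module_homology: "module K HH"
proof (rule moduleI)
  show "cring K"
    by (rule R.is_cring)
  have ker: "x \<in> carrier A" if "x \<in> a_kernel A A d" for x
    using that by (simp add: kernel_iff)
  show "abelian_group HH"
  proof (rule abelian_groupI)
    fix x
    assume "x \<in> carrier HH"
    then obtain z where "z \<in> a_kernel A A d" "x = hclass A d z"
      by (auto simp: homology_simps)
    then show "\<exists>y\<in>carrier HH. y \<oplus>\<^bsub>HH\<^esub> x = \<zero>\<^bsub>HH\<^esub>"
      using kernel_closed(3)[of z]
      by (auto simp: homology_simps(1-4) ker l_neg intro!: bexI[of _ "\<ominus>\<^bsub>A\<^esub> z"])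
  qed (auto simp: homology_simps kernel_closed ker a_ac)
qed (auto simp: homology_simps kernel_closed kernel_iff smult_l_distr smult_r_distr smult_assoc1
      d.add d.smult)

end

text \<open>A degree-preserving retract inherits the direct sum decomposition. Existence: apply
  \<open>g\<close> to the components of \<open>f x\<close>. Uniqueness: apply \<open>f\<close>, use
  uniqueness in \<open>A\<close>, and return by injectivity of \<open>f\<close>.\<close>

lemma bigraded_module_retract:
  assumes "bigraded_module K A" "module K H" "\<And>i j. submodule (grade H i j) K H"
    and "klin K H A f" "klin K A H g" "\<And>x. x \<in> carrier H \<Longrightarrow> g (f x) = x"
    and f_grade: "\<And>i j x. x \<in> grade H i j \<Longrightarrow> f x \<in> grade A i j"
    and g_grade: "\<And>i j x. x \<in> grade A i j \<Longrightarrow> g x \<in> grade H i j"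
  shows "bigraded_module K H"
proof -
  interpret A: bigraded_module K A by fact
  interpret H: module K H by fact
  interpret f: klin K H A f by fact
  interpret g: klin K A H g by fact
  have H_closed: "x \<in> carrier H" if "x \<in> grade H i j" for x i j
    using H.submoduleE(1)[OF assms(3)] that by auto
  have f_zero: "f x = \<zero>\<^bsub>A\<^esub> \<longleftrightarrow> x = \<zero>\<^bsub>H\<^esub>" if "x \<in> carrier H" for x
    using assms(6)[OF that] by auto
  have dec_closed: "c e \<in> carrier H" if "decomposes H c x" for c x e
  proof -
    have "c (fst e, snd e) \<in> grade H (fst e) (snd e)"
      using that unfolding decomposes_def by blast
    then show ?thesis
      using H_closed by simp
  qed
  have dec: "decomposes A (\<lambda>e. f (c e)) (f x)" if c: "decomposes H c x" for c x
  proof -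
    have cl: "c e \<in> carrier H" for e
      using c by (rule dec_closed)
    have "{e. f (c e) \<noteq> \<zero>\<^bsub>A\<^esub>} = {e. c e \<noteq> \<zero>\<^bsub>H\<^esub>}"
      using f_zero[OF cl] by auto
    then show ?thesis
      using c cl f_grade by (auto simp: decomposes_def f.finsum)
  qed
  have "\<exists>!c. decomposes H c x" if x: "x \<in> carrier H" for x
  proof (rule ex_ex1I)
    define c where "c = components A (f x)"
    have c: "decomposes A c (f x)"
      unfolding c_def using x by (intro A.components) simp
    note cD = A.decomposesD[OF c]
    have "x = g (\<Oplus>\<^bsub>A\<^esub>e\<in>{e. c e \<noteq> \<zero>\<^bsub>A\<^esub>}. c e)"
      using c assms(6)[OF x] by (simp add: decomposes_def)
    also have "\<dots> = (\<Oplus>\<^bsub>H\<^esub>e\<in>{e. c e \<noteq> \<zero>\<^bsub>A\<^esub>}. g (c e))"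
      using cD by (intro g.finsum) auto
    \<comment> \<open>The support of the image family is only known to lie inside that of
      \<open>c\<close>; the indices in between contribute zero.\<close>
    also have "\<dots> = (\<Oplus>\<^bsub>H\<^esub>e\<in>{e. g (c e) \<noteq> \<zero>\<^bsub>H\<^esub>}. g (c e))"
      by (rule H.add.finprod_mono_neutral_cong_left[symmetric]) (use cD in auto)
    finally have "x = (\<Oplus>\<^bsub>H\<^esub>e\<in>{e. g (c e) \<noteq> \<zero>\<^bsub>H\<^esub>}. g (c e))" .
    moreover have "finite {e. g (c e) \<noteq> \<zero>\<^bsub>H\<^esub>}"
      by (rule finite_subset[OF _ cD(3)]) auto
    moreover have "g (c (i, j)) \<in> grade H i j" for i j
      using c by (auto simp: decomposes_def intro: g_grade)
    ultimately have "decomposes H (\<lambda>e. g (c e)) x"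
      unfolding decomposes_def by blast
    then show "\<exists>c. decomposes H c x"
      by blast
  next
    fix c c'
    assume c: "decomposes H c x" "decomposes H c' x"
    have cl: "c e \<in> carrier H" "c' e \<in> carrier H" for e
      using c by (blast intro: dec_closed)+
    have "f (c e) = f (c' e)" for e
      using A.decomposes_unique[OF dec[OF c(1)] dec[OF c(2)]] by (rule fun_cong)
    then show "c = c'"
      using assms(6) cl by (metis ext)
  qed
  then show ?thesis
    using assms(2,3)
    by (auto simp: bigraded_module_def bigraded_module_axioms_def decomposes_def)
qed

lemma (in bigraded_endo) submodule_homology: "submodule (grade HH i j) K HH"
proof -
  interpret HH: module K HH by (rule module_homology)
  have ker: "x \<in> carrier A" if "x \<in> a_kernel A A d" for x
    using that by (simp add: kernel_iff)
  show ?thesis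
  proof (rule HH.submoduleI)
    fix x
    assume "x \<in> grade HH i j"
    then obtain z where z: "z \<in> a_kernel A A d" "z \<in> grade A i j" "x = hclass A d z"
      by (auto simp: homology_simps)
    have "\<ominus>\<^bsub>HH\<^esub> x = hclass A d (\<ominus>\<^bsub>A\<^esub> z)"
      using z kernel_closed(3)[OF z(1)] ker
      by (intro HH.minus_equality) (auto simp: homology_simps l_neg)
    then show "\<ominus>\<^bsub>HH\<^esub> x \<in> grade HH i j"
      using z kernel_closed(3)[OF z(1)] grade_neg[OF z(2)] by (auto simp: homology_simps)
  qed (auto simp: homology_simps kernel_closed ker grade_add grade_smult)
qed

lemma (in bidga) bigraded_module_homology:
  assumes "homotopy_retract K A dv (homology A dv) (\<lambda>_. \<zero>\<^bsub>homology A dv\<^esub>) \<iota> \<pi> h"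
  shows "bigraded_module K (homology A dv)"
proof -
  interpret E: bigraded_endo K A dv
    by unfold_locales
  let ?H = "homology A dv"
  interpret H: module K ?H
    by (rule E.module_homology)
  have i: "linear_map K ?H A 0 0 \<iota>" and p: "linear_map K A ?H 0 0 \<pi>"
    and pi: "\<And>x. x \<in> carrier ?H \<Longrightarrow> \<pi> (\<iota> x) = x"
    using assms by (auto simp: homotopy_retract_def)
  have mi: "mlin K ?H A 1 (\<lambda>xs. \<iota> (hd xs))"
    using i unfolding multilinear_iff[OF H.module_axioms module_axioms] by (rule conjunct1)
  have mp: "mlin K A ?H 1 (\<lambda>xs. \<pi> (hd xs))"
    using p unfolding multilinear_iff[OF module_axioms H.module_axioms] by (rule conjunct1)
  have ki: "klin K ?H A \<iota>" and kp: "klin K A ?H \<pi>"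
    using mlin_slot[OF mi _ _ _ H.module_axioms, of "[]" "[]"]
      mlin_slot[OF mp _ _ _ module_axioms, of "[]" "[]"] by simp_all
  have gi: "\<iota> x \<in> grade A i j" if "x \<in> grade ?H i j" for x i j
  proof -
    have "length [x] = 1 \<and> homogeneous ?H [(i, j)] [x]"
      using that by (simp add: homogeneous_Cons)
    then have "\<iota> (hd [x]) \<in> gradez A (hdeg [(i, j)] - 0) (vdeg [(i, j)] + 0)"
      using i unfolding multilinear_def by blast
    then show ?thesis
      by simp
  qed
  have gp: "\<pi> x \<in> grade ?H i j" if "x \<in> grade A i j" for x i j
  proof -
    have "length [x] = 1 \<and> homogeneous A [(i, j)] [x]"
      using that by (simp add: homogeneous_Cons)
    then have "\<pi> (hd [x]) \<in> gradez ?H (hdeg [(i, j)] - 0) (vdeg [(i, j)] + 0)"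
      using p unfolding multilinear_def by blast
    then show ?thesis
      by (simp add: gradez_def)
  qed
  show ?thesis
    by (rule bigraded_module_retract[OF bigraded_module_axioms H.module_axioms E.submodule_homology
          ki kp pi gi gp])
qed

theorem proposition4p5:
  fixes K :: "('k, 'r) ring_scheme"
    and A :: "('k, 'a) bigraded"
    and m :: "nat \<Rightarrow> nat \<Rightarrow> 'a list \<Rightarrow> 'a"
    and dv dh :: "'a \<Rightarrow> 'a"
    and mul :: "'a \<Rightarrow> 'a \<Rightarrow> 'a"
    and H :: "('k, 'a set) bigraded"
    and \<iota> :: "'a set \<Rightarrow> 'a" and \<pi> :: "'a \<Rightarrow> 'a set" and h :: "'a \<Rightarrow> 'a"
  defines "dv \<equiv> \<lambda>x. m 0 1 [x]"
    and "dh \<equiv> \<lambda>x. m 1 1 [x]"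
    and "mul \<equiv> \<lambda>x y. m 0 2 [x, y]"
    and "H \<equiv> homology A dv"
  assumes "field K"
    and "bidga K A m"
    and "homotopy_retract K A dv H (\<lambda>_. \<zero>\<^bsub>H\<^esub>) \<iota> \<pi> h"
  shows "\<exists>n. derived_Ainf K H n \<and>
    (\<forall>x \<in> carrier H. n 0 1 [x] = \<zero>\<^bsub>H\<^esub>) \<and>
    (\<forall>i j. 1 \<le> j \<and> 2 \<le> i + j \<longrightarrow>
      (\<exists>\<epsilon> :: ptree \<Rightarrow> int. (\<forall>T \<in> trees i j. \<epsilon> T \<in> {1, - 1}) \<and>
        (\<forall>ds xs. length xs = j \<and> homogeneous H ds xs \<longrightarrow>
          n i j xs =
            (\<Oplus>\<^bsub>H\<^esub>T \<in> trees i j. [\<epsilon> T] \<cdot>\<^bsub>H\<^esub> tree_map A dh mul \<iota> \<pi> h T ds xs))))"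
proof -
  interpret bidga K A m by fact
  interpret R: bidga_retract K A m H \<iota> \<pi> h
  proof (intro bidga_retract.intro bidga_retract_axioms.intro bidga_axioms)
    show "bigraded_module K H"
      using bigraded_module_homology assms(7) unfolding H_def dv_def .
    show "homotopy_retract K A (\<lambda>x. m 0 1 [x]) H (\<lambda>_. \<zero>\<^bsub>H\<^esub>) \<iota> \<pi> h"
      using assms(7) unfolding dv_def .
  qed
  show ?thesis
  proof (intro exI conjI ballI allI impI; (elim conjE)?)
    show "derived_Ainf K H R.transferred"
      by (rule R.derived_Ainf_transferred)
    show "R.transferred 0 1 [x] = \<zero>\<^bsub>H\<^esub>" if "x \<in> carrier H" for x
      using that by (rule R.transferred_0_1)
    fix i j T
    \<comment> \<open>The sign of a tree is the desuspension sign of the operation, shared by all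
      its trees, times the sign accumulated at the vertices and edges of the tree.\<close>
    show "sgn_pow (R.osign i j + R.tsign T) \<in> {1, - 1}"
      by (simp add: sgn_pow_def)
    fix ds xs
    assume "1 \<le> j" "2 \<le> i + j" "length xs = j" "homogeneous H ds xs"
    then show "R.transferred i j xs = (\<Oplus>\<^bsub>H\<^esub>T \<in> trees i j.
        [sgn_pow (R.osign i j + R.tsign T)] \<cdot>\<^bsub>H\<^esub> tree_map A dh mul \<iota> \<pi> h T ds xs)"
      unfolding dh_def mul_def by (intro R.transferred_trees)
  qed
qed

end
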